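(* Let $n,n'\ge1$ be coprime integers, $N\ge1$, $q,v\in\mathbb{C}^*$ generic ($q^av^b\ne1$ for $(a,b)\in\mathbb{Z}^2\setminus\{(0,0)\}$), $u_0,\dots,u_{n-1}\in\mathbb{C}^*$. In the representation $\mathbf{C}^{(n,n')}_{u_0,\dots,u_{n-1}}$ there are, for every $\lambda\in\mathbb{Z}^N$, joint eigenvectors $\tilde E_\lambda=e_\lambda+\sum_{\mu\prec\lambda}\beta_{\lambda,\mu}e_\mu$ of $\mathbf{B}_1,\dots,\mathbf{B}_N$, with eigenvalues $$\mathbf{B}_i\tilde E_\lambda=u_0\cdots u_{n-1}\,q^{1-n}\,v^{\mathtt{l}^{(\lambda)}_i}\,q^{\lambda_i}\,\tilde E_\lambda .$$
   Context: **Representation.** $V=\mathbb{C}^n[Y^{\pm1}]$, $\mathbb{C}^n$ with basis $e_0,\dots,e_{n-1}$; $e_{nj+a}=Y^je_a$ ($j\in\mathbb{Z}$, $0\le a<n$); $e_\lambda=e_{\lambda_1}\otimes\dots\otimes e_{\lambda_N}$ for $\lambda\in\mathbb{Z}^N$. $\mathbf{C}^{(n,n')}_{u_0,\dots,u_{n-1}}$ is the space $V^{\otimes N}=(\mathbb{C}^n)^{\otimes N}[Y_1^{\pm1},\dots,Y_N^{\pm1}]$ with the operators: multiplication by $Y_i$; $T_i=s_i^YR_{i,i+1}+(v-v^{-1})\frac{s_i^Y-1}{Y_i/Y_{i+1}-1}$, where $s_i^Y$ swaps only the variables $Y_i,Y_{i+1}$ and $R=v\sum_aE_{aa}\otimes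 E_{aa}+\sum_{a<b}(E_{ab}\otimes E_{ba}+E_{ba}\otimes E_{ab}+(v-v^{-1})E_{aa}\otimes E_{bb})$; $\pi=\kappa_1^{n'}D_1s_1\cdots s_{N-1}$, where $s_i$ swaps tensor factors $i,i+1$ of $V^{\otimes N}$, $\kappa e_i=e_{i-1}$, $D(Y^je_a)=u_aq^jY^je_a$ ($0\le a<n$), subscript $1$ = acting on the first factor. These give an action of the double affine Hecke algebra. $X_1=T_1\cdots T_{N-1}\pi^{-1}$. **Operators.** $\mathbf{B}_1=Z_1\cdots Z_{n+n'}$ with $Z_j=Y_1$ if $\lfloor\frac{jn}{n+n'}\rfloor=\lfloor\frac{(j-1)n}{n+n'}\rfloor$ and $Z_j=X_1^{-1}$ otherwise; $\mathbf{B}_{i+1}=T_i\cdots T_1\mathbf{B}_1T_1\cdots T_i$. **Order.** For $\lambda,\mu\in\mathbb{Z}^N$, $\lambda\le\mu$ means $\mu-\lambda$ is a nonnegative integer combination of the simple roots $\alpha_i=\epsilon_i-\epsilon_{i+1}$; $\lambda^+$ is the weakly decreasing rearrangement of $\lambda$. $\lambda\prec\mu$ iff $\lambda^+<\mu^+$, or $\lambda^+=\mu^+$ and $\lambda<\mu$. **Exponent.** $\mathtt{l}^{(\lambda)}_i=|\{j:\lambda_j>\lambda_i\}|+|\{j<i:\lambda_j=\lambda_i\}|-|\{j:\lambda_j<\lambda_i\}|-|\{j>i:\lambda_j=\lambda_i\}|$. *)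

theory Defs
  imports Complex_Main "HOL-Library.Poly_Mapping"
begin

section \<open>The space\<close>

text \<open>
  The \<open>N\<close>-fold tensor power of \<open>V = C^n[Y, 1/Y]\<close> is the complex vector space with basis
  \<open>e\<^sub>\<lambda>\<close>, where \<open>\<lambda>\<close> ranges over integer lists of length \<open>N\<close>. The entry \<open>\<lambda> ! i = n * j + a\<close>
  with \<open>0 \<le> a < n\<close> stands for \<open>Y^j e\<^sub>a\<close> in the corresponding tensor factor, so \<open>j\<close> and \<open>a\<close> are
  recovered as \<open>\<lambda> ! i div n\<close> and \<open>\<lambda> ! i mod n\<close>.

  Tensor factors are numbered \<open>0, \<dots>, N - 1\<close>. Hence \<open>T i\<close> below (\<open>i + 1 < N\<close>) acts in the factors
  \<open>i\<close> and \<open>i + 1\<close> and is \<open>T\<^sub>i\<^sub>+\<^sub>1\<close> in one-based numbering; likewise \<open>B_op i\<close> (\<open>i < N\<close>).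
\<close>

type_synonym vec = "int list \<Rightarrow>\<^sub>0 complex"

definition weights :: "nat \<Rightarrow> int list set" where
  "weights N = {l. length l = N}"

definition tensor_space :: "nat \<Rightarrow> vec set" where
  "tensor_space N = {f. Poly_Mapping.keys f \<subseteq> weights N}"

definition e :: "int list \<Rightarrow> vec" where
  "e l = Poly_Mapping.single l 1"

definition scal :: "complex \<Rightarrow> vec \<Rightarrow> vec" where
  "scal c f = Poly_Mapping.map ((*) c) f"

definition lin_ext :: "(int list \<Rightarrow> vec) \<Rightarrow> vec \<Rightarrow> vec" where
  "lin_ext A f = (\<Sum>l\<in>Poly_Mapping.keys f. scal (Poly_Mapping.lookup f l) (A l))"

definition op_prod :: "(vec \<Rightarrow> vec) list \<Rightarrow> vec \<Rightarrow> vec" where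
  "op_prod As = foldr (\<circ>) As id"

section \<open>The generators\<close>

definition Y_pow :: "nat \<Rightarrow> nat \<Rightarrow> int \<Rightarrow> vec \<Rightarrow> vec" where
  "Y_pow n i k = lin_ext (\<lambda>l. e (l[i := l ! i + int n * k]))"

text \<open>The matrix unit \<open>E\<^sub>a\<^sub>b\<close> (sending \<open>e\<^sub>b\<close> to \<open>e\<^sub>a\<close>) acting on the \<open>C^n\<close> of the factor \<open>i\<close>.\<close>

definition mat_unit :: "nat \<Rightarrow> nat \<Rightarrow> nat \<Rightarrow> nat \<Rightarrow> vec \<Rightarrow> vec" where
  "mat_unit n i a b = lin_ext (\<lambda>l.
     if l ! i mod int n = int b then e (l[i := int n * (l ! i div int n) + int a]) else 0)"

definition R_op :: "nat \<Rightarrow> complex \<Rightarrow> nat \<Rightarrow> vec \<Rightarrow> vec" where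
  "R_op n v i f =
     scal v (\<Sum>a<n. mat_unit n i a a (mat_unit n (i + 1) a a f)) +
     (\<Sum>a<n. \<Sum>b\<in>{a<..<n}.
        mat_unit n i a b (mat_unit n (i + 1) b a f) +
        mat_unit n i b a (mat_unit n (i + 1) a b f) +
        scal (v - inverse v) (mat_unit n i a a (mat_unit n (i + 1) b b f)))"

text \<open>The swap of the variables \<open>Y\<close> of the factors \<open>i\<close> and \<open>i + 1\<close>, leaving the \<open>C^n\<close> parts alone.\<close>

definition swap_Y :: "nat \<Rightarrow> nat \<Rightarrow> vec \<Rightarrow> vec" where
  "swap_Y n i = lin_ext (\<lambda>l. e (l
     [i := int n * (l ! (i + 1) div int n) + l ! i mod int n,
      i + 1 := int n * (l ! i div int n) + l ! (i + 1) mod int n]))"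

text \<open>
  The quotient of \<open>swap_Y f - f\<close> by \<open>Y\<^sub>i / Y\<^sub>i\<^sub>+\<^sub>1 - 1\<close> in Laurent polynomials; see
  \<open>div_diff_ex1\<close> below for existence and uniqueness.
\<close>

definition div_diff :: "nat \<Rightarrow> nat \<Rightarrow> nat \<Rightarrow> vec \<Rightarrow> vec" where
  "div_diff n N i f = (THE g. g \<in> tensor_space N \<and>
     Y_pow n i 1 (Y_pow n (i + 1) (-1) g) - g = swap_Y n i f - f)"

definition T_op :: "nat \<Rightarrow> nat \<Rightarrow> complex \<Rightarrow> nat \<Rightarrow> vec \<Rightarrow> vec" where
  "T_op n N v i f =
     swap_Y n i (R_op n v i f) + scal (v - inverse v) (div_diff n N i f)"

definition swap_factors :: "nat \<Rightarrow> vec \<Rightarrow> vec" where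
  "swap_factors i = lin_ext (\<lambda>l. e (l[i := l ! (i + 1), i + 1 := l ! i]))"

definition kappa1 :: "vec \<Rightarrow> vec" where
  "kappa1 = lin_ext (\<lambda>l. e (l[0 := l ! 0 - 1]))"

definition D1 :: "nat \<Rightarrow> complex \<Rightarrow> (nat \<Rightarrow> complex) \<Rightarrow> vec \<Rightarrow> vec" where
  "D1 n q u = lin_ext (\<lambda>l.
     scal (u (nat (l ! 0 mod int n)) * q powi (l ! 0 div int n)) (e l))"

definition pi_op :: "nat \<Rightarrow> nat \<Rightarrow> nat \<Rightarrow> complex \<Rightarrow> (nat \<Rightarrow> complex) \<Rightarrow> vec \<Rightarrow> vec" where
  "pi_op n n' N q u =
     (kappa1 ^^ n') \<circ> D1 n q u \<circ> op_prod (map swap_factors [0..<N - 1])"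

definition X1 ::
  "nat \<Rightarrow> nat \<Rightarrow> nat \<Rightarrow> complex \<Rightarrow> complex \<Rightarrow> (nat \<Rightarrow> complex) \<Rightarrow> vec \<Rightarrow> vec" where
  "X1 n n' N q v u =
     op_prod (map (T_op n N v) [0..<N - 1]) \<circ> inv_into (tensor_space N) (pi_op n n' N q u)"

section \<open>The commuting operators\<close>

definition Z_op ::
  "nat \<Rightarrow> nat \<Rightarrow> nat \<Rightarrow> complex \<Rightarrow> complex \<Rightarrow> (nat \<Rightarrow> complex) \<Rightarrow> nat \<Rightarrow> vec \<Rightarrow> vec" where
  "Z_op n n' N q v u j =
     (if (j * n) div (n + n') = ((j - 1) * n) div (n + n') then Y_pow n 0 1
      else inv_into (tensor_space N) (X1 n n' N q v u))"

definition B1 ::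
  "nat \<Rightarrow> nat \<Rightarrow> nat \<Rightarrow> complex \<Rightarrow> complex \<Rightarrow> (nat \<Rightarrow> complex) \<Rightarrow> vec \<Rightarrow> vec" where
  "B1 n n' N q v u = op_prod (map (Z_op n n' N q v u) [1..<n + n' + 1])"

definition B_op ::
  "nat \<Rightarrow> nat \<Rightarrow> nat \<Rightarrow> complex \<Rightarrow> complex \<Rightarrow> (nat \<Rightarrow> complex) \<Rightarrow> nat \<Rightarrow> vec \<Rightarrow> vec" where
  "B_op n n' N q v u i =
     op_prod (map (T_op n N v) (rev [0..<i])) \<circ> B1 n n' N q v u \<circ>
     op_prod (map (T_op n N v) [0..<i])"

section \<open>The order and the exponent\<close>

definition simple_root :: "nat \<Rightarrow> nat \<Rightarrow> int" where
  "simple_root i j = (if j = i then 1 else if j = i + 1 then -1 else 0)"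

definition dom_le :: "nat \<Rightarrow> int list \<Rightarrow> int list \<Rightarrow> bool" where
  "dom_le N l m \<longleftrightarrow> l \<in> weights N \<and> m \<in> weights N \<and>
     (\<exists>k :: nat \<Rightarrow> nat. \<forall>j<N. m ! j - l ! j = (\<Sum>i<N - 1. int (k i) * simple_root i j))"

definition dom_less :: "nat \<Rightarrow> int list \<Rightarrow> int list \<Rightarrow> bool" where
  "dom_less N l m \<longleftrightarrow> dom_le N l m \<and> l \<noteq> m"

definition plus_part :: "int list \<Rightarrow> int list" where
  "plus_part l = rev (sort l)"

definition prec :: "nat \<Rightarrow> int list \<Rightarrow> int list \<Rightarrow> bool" where
  "prec N l m \<longleftrightarrow> dom_less N (plus_part l) (plus_part m) \<or>
     plus_part l = plus_part m \<and> dom_less N l m"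

definition ell :: "int list \<Rightarrow> nat \<Rightarrow> int" where
  "ell l i =
     int (card {j. j < length l \<and> l ! j > l ! i}) + int (card {j. j < i \<and> l ! j = l ! i})
     - int (card {j. j < length l \<and> l ! j < l ! i})
     - int (card {j. i < j \<and> j < length l \<and> l ! j = l ! i})"

section \<open>Well-definedness\<close>

lemma lookup_scal [simp]: "Poly_Mapping.lookup (scal c f) l = c * Poly_Mapping.lookup f l"
  by (auto simp: scal_def Poly_Mapping.map.rep_eq when_def)

lemma lookup_e: "Poly_Mapping.lookup (e l) m = (if m = l then 1 else 0)"
  by (simp add: e_def lookup_single when_def)

lemma lin_ext_superset:
  assumes "finite S" "Poly_Mapping.keys f \<subseteq> S"
  shows "lin_ext A f = (\<Sum>l\<in>S. scal (Poly_Mapping.lookup f l) (A l))"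
proof -
  have z: "scal 0 g = 0" for g by (rule poly_mapping_eqI) simp
  show ?thesis unfolding lin_ext_def
    by (rule sum.mono_neutral_left) (use assms z in \<open>auto simp: in_keys_iff\<close>)
qed

lemma lin_ext_add: "lin_ext A (f + g) = lin_ext A f + lin_ext A g"
proof -
  let ?S = "Poly_Mapping.keys f \<union> Poly_Mapping.keys g"
  have d: "scal (a + b) h = scal a h + scal b h" for a b h
    by (rule poly_mapping_eqI) (simp add: lookup_add algebra_simps)
  show ?thesis
    using Poly_Mapping.keys_add[of f g]
    by (subst (1 2 3) lin_ext_superset[of ?S])
       (auto simp: lookup_add d sum.distrib)
qed

lemma lin_ext_scal: "lin_ext A (scal c f) = scal c (lin_ext A f)"
proof -
  have "Poly_Mapping.keys (scal c f) \<subseteq> Poly_Mapping.keys f"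
    by (auto simp: in_keys_iff)
  then have "lin_ext A (scal c f) =
      (\<Sum>l\<in>Poly_Mapping.keys f. scal (Poly_Mapping.lookup (scal c f) l) (A l))"
    by (intro lin_ext_superset) auto
  also have "\<dots> = scal c (lin_ext A f)"
    by (rule poly_mapping_eqI) (simp add: lin_ext_def lookup_sum sum_distrib_left mult.assoc)
  finally show ?thesis .
qed

lemma scal_minus_one: "scal (-1) f = - f"
  by (rule poly_mapping_eqI) simp

lemma lin_ext_diff: "lin_ext A (f - g) = lin_ext A f - lin_ext A g"
  using lin_ext_add[of A f "scal (-1) g"]
  unfolding lin_ext_scal by (simp add: scal_minus_one)

lemma lin_ext_zero [simp]: "lin_ext A 0 = 0"
  by (simp add: lin_ext_def)

lemma lin_ext_e [simp]: "lin_ext A (e l) = A l"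
  by (rule poly_mapping_eqI) (simp add: lin_ext_def e_def)

lemma vec_decomp: "f = (\<Sum>l\<in>Poly_Mapping.keys f. scal (Poly_Mapping.lookup f l) (e l))"
proof (rule poly_mapping_eqI)
  fix k
  have "(\<Sum>l\<in>Poly_Mapping.keys f. Poly_Mapping.lookup f l * (if k = l then 1 else 0)) =
        (\<Sum>l\<in>Poly_Mapping.keys f. if k = l then Poly_Mapping.lookup f k else 0)"
    by (rule sum.cong) auto
  then show "Poly_Mapping.lookup f k =
      Poly_Mapping.lookup (\<Sum>l\<in>Poly_Mapping.keys f. scal (Poly_Mapping.lookup f l) (e l)) k"
    by (auto simp: lookup_sum lookup_e in_keys_iff)
qed

lemma tensor_space_zero [simp]: "0 \<in> tensor_space N"
  by (simp add: tensor_space_def)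

lemma tensor_space_add: "f \<in> tensor_space N \<Longrightarrow> g \<in> tensor_space N \<Longrightarrow> f + g \<in> tensor_space N"
  using Poly_Mapping.keys_add[of f g] by (auto simp: tensor_space_def)

lemma tensor_space_scal: "f \<in> tensor_space N \<Longrightarrow> scal c f \<in> tensor_space N"
  by (auto simp: tensor_space_def subset_iff in_keys_iff)

lemma tensor_space_diff: "f \<in> tensor_space N \<Longrightarrow> g \<in> tensor_space N \<Longrightarrow> f - g \<in> tensor_space N"
  using tensor_space_add[of f N "scal (-1) g"] tensor_space_scal[of g N "-1"]
  by (simp add: scal_minus_one)

lemma tensor_space_e: "length l = N \<Longrightarrow> e l \<in> tensor_space N"
  by (auto simp: tensor_space_def weights_def e_def)

lemma tensor_space_induct [consumes 1, case_names zero step]: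
  assumes "f \<in> tensor_space N" and z: "P 0"
    and s: "\<And>g c l. P g \<Longrightarrow> length l = N \<Longrightarrow> P (g + scal c (e l))"
  shows "P f"
proof -
  have "P (\<Sum>l\<in>S. scal (Poly_Mapping.lookup f l) (e l))"
    if "finite S" "S \<subseteq> weights N" for S
    using that
  proof (induction S rule: finite_induct)
    case empty then show ?case using z by simp
  next
    case (insert x F)
    then show ?case using s[of "\<Sum>l\<in>F. scal (Poly_Mapping.lookup f l) (e l)" x]
      by (simp add: add.commute weights_def)
  qed
  from this[of "Poly_Mapping.keys f"] show ?thesis
    using assms(1) vec_decomp[of f] by (simp add: tensor_space_def)
qed

text \<open>\<open>shift n i m l\<close> is the index of \<open>(Y\<^sub>i / Y\<^sub>i\<^sub>+\<^sub>1)^m e\<^sub>l\<close>.\<close>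

definition shift :: "nat \<Rightarrow> nat \<Rightarrow> int \<Rightarrow> int list \<Rightarrow> int list" where
  "shift n i m l = l[i := l ! i + int n * m, i + 1 := l ! (i + 1) - int n * m]"

lemma length_shift [simp]: "length (shift n i m l) = length l"
  by (simp add: shift_def)

lemma shift_shift: "i + 1 < length l \<Longrightarrow> shift n i m (shift n i k l) = shift n i (m + k) l"
  by (rule nth_equalityI) (auto simp: shift_def nth_list_update algebra_simps)

lemma shift_0: "shift n i 0 l = l"
  by (simp add: shift_def)

lemma Y_quot_e:
  assumes "i + 1 < length l"
  shows "Y_pow n i 1 (Y_pow n (i + 1) (-1) (e l)) = e (shift n i 1 l)"
proof -
  have "(l[Suc i := l ! Suc i - int n])[i := l ! i + int n] = shift n i 1 l"
    using assms by (intro nth_equalityI) (auto simp: shift_def nth_list_update)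
  then show ?thesis using assms by (simp add: Y_pow_def)
qed

lemma swap_Y_e:
  assumes "i + 1 < length l"
  shows "swap_Y n i (e l) = e (shift n i (l ! (i + 1) div int n - l ! i div int n) l)"
proof -
  have *: "int n * (b div int n) + a mod int n = a + int n * (b div int n - a div int n)" for a b
    by (simp add: right_diff_distrib algebra_simps minus_mult_div_eq_mod [symmetric])
  show ?thesis unfolding swap_Y_def lin_ext_e * shift_def
    by (simp add: algebra_simps)
qed

lemma div_diff_exists_e:
  assumes "i + 1 < N" "length l = N"
  shows "\<exists>g\<in>tensor_space N.
    Y_pow n i 1 (Y_pow n (i + 1) (-1) g) - g = e (shift n i (int m) l) - e l"
proof (induction m)
  case 0
  show ?case by (rule bexI[of _ 0]) (auto simp: shift_0 Y_pow_def)
next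
  case (Suc m)
  then obtain g where g: "g \<in> tensor_space N"
    "Y_pow n i 1 (Y_pow n (i + 1) (-1) g) - g = e (shift n i (int m) l) - e l" by blast
  let ?h = "e (shift n i (int m) l)"
  have "Y_pow n i 1 (Y_pow n (i + 1) (-1) ?h) = e (shift n i (int (Suc m)) l)"
    using assms by (subst Y_quot_e) (auto simp: shift_shift)
  moreover have "Y_pow n i 1 (Y_pow n (i + 1) (-1) (g + ?h)) =
     Y_pow n i 1 (Y_pow n (i + 1) (-1) g) + Y_pow n i 1 (Y_pow n (i + 1) (-1) ?h)"
    by (simp add: Y_pow_def lin_ext_add)
  moreover have "g + ?h \<in> tensor_space N"
    using g assms by (intro tensor_space_add tensor_space_e) auto
  ultimately show ?case using g(2)
    by (intro bexI[of _ "g + ?h"]) (auto simp: algebra_simps)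
qed

lemma div_diff_exists_e_int:
  assumes "i + 1 < N" "length l = N"
  shows "\<exists>g\<in>tensor_space N.
    Y_pow n i 1 (Y_pow n (i + 1) (-1) g) - g = e (shift n i k l) - e l"
proof (cases "k \<ge> 0")
  case True
  then show ?thesis using div_diff_exists_e[OF assms, of n "nat k"] by simp
next
  case False
  let ?l = "shift n i k l"
  have "shift n i (int (nat (- k))) ?l = l"
    using False assms by (simp add: shift_shift shift_0)
  then obtain g where g: "g \<in> tensor_space N"
    "Y_pow n i 1 (Y_pow n (i + 1) (-1) g) - g = e l - e ?l"
    using div_diff_exists_e[of i N ?l n "nat (- k)"] assms by auto
  have "Y_pow n i 1 (Y_pow n (i + 1) (-1) (0 - g)) - (0 - g) =
        - (Y_pow n i 1 (Y_pow n (i + 1) (-1) g) - g)"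
    unfolding Y_pow_def lin_ext_diff by simp
  then have "Y_pow n i 1 (Y_pow n (i + 1) (-1) (0 - g)) - (0 - g) = e ?l - e l"
    unfolding g(2) by simp
  moreover have "0 - g \<in> tensor_space N"
    using tensor_space_diff[OF tensor_space_zero g(1)] .
  ultimately show ?thesis by (rule bexI)
qed

lemma div_diff_exists:
  assumes "i + 1 < N" "f \<in> tensor_space N"
  shows "\<exists>g\<in>tensor_space N.
    Y_pow n i 1 (Y_pow n (i + 1) (-1) g) - g = swap_Y n i f - f"
  using assms(2)
proof (induction rule: tensor_space_induct)
  case zero
  show ?case by (rule bexI[of _ 0]) (auto simp: Y_pow_def swap_Y_def)
next
  case (step f c l)
  then obtain g where g: "g \<in> tensor_space N"
    "Y_pow n i 1 (Y_pow n (i + 1) (-1) g) - g = swap_Y n i f - f" by blast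
  obtain h where h: "h \<in> tensor_space N"
    "Y_pow n i 1 (Y_pow n (i + 1) (-1) h) - h = swap_Y n i (e l) - e l"
    using div_diff_exists_e_int[OF assms(1) step(2)] swap_Y_e[of i l n] assms step by auto
  have sd: "scal c (a - b) = scal c a - scal c b" for a b
    by (rule poly_mapping_eqI) (simp add: lookup_minus algebra_simps)
  have 1: "Y_pow n i 1 (Y_pow n (i + 1) (-1) (g + scal c h)) - (g + scal c h) =
     (Y_pow n i 1 (Y_pow n (i + 1) (-1) g) - g) +
     scal c (Y_pow n i 1 (Y_pow n (i + 1) (-1) h) - h)"
    by (simp add: Y_pow_def lin_ext_add lin_ext_scal sd algebra_simps)
  have 2: "swap_Y n i (f + scal c (e l)) - (f + scal c (e l)) =
     (swap_Y n i f - f) + scal c (swap_Y n i (e l) - e l)"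
    unfolding swap_Y_def lin_ext_add lin_ext_scal sd by (simp only: algebra_simps)
  show ?case unfolding 2
    using g h 1 by (intro bexI[of _ "g + scal c h"] tensor_space_add tensor_space_scal) auto
qed

lemma Y_quot_fixed_zero:
  assumes "n \<ge> 1" "i + 1 < N" "g \<in> tensor_space N"
    and fixed: "Y_pow n i 1 (Y_pow n (i + 1) (-1) g) = g"
  shows "g = 0"
proof (rule ccontr)
  assume "g \<noteq> 0"
  have len: "l \<in> Poly_Mapping.keys g \<Longrightarrow> length l = N" for l
    using assms(3) by (auto simp: tensor_space_def weights_def)
  let ?K = "(\<lambda>l. l ! i) ` Poly_Mapping.keys g"
  have "?K \<noteq> {}" using \<open>g \<noteq> 0\<close> by simp
  then have "Max ?K \<in> ?K" by (intro Max_in) auto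
  then obtain l where l: "l \<in> Poly_Mapping.keys g" "l ! i = Max ?K" by auto
  have max: "m ! i \<le> l ! i" if "m \<in> Poly_Mapping.keys g" for m
    unfolding l(2) using that by (intro Max_ge) auto
  have L: "Poly_Mapping.lookup (Y_pow n i 1 (Y_pow n (i + 1) (-1) f)) (shift n i 1 l)
      = Poly_Mapping.lookup f l" if "f \<in> tensor_space N" for f
    using that
  proof (induction rule: tensor_space_induct)
    case zero show ?case by (simp add: Y_pow_def)
  next
    case (step f c m)
    have inj: "shift n i 1 l = shift n i 1 m \<longleftrightarrow> l = m"
    proof
      assume "shift n i 1 l = shift n i 1 m"
      then have "shift n i (-1) (shift n i 1 l) = shift n i (-1) (shift n i 1 m)" by simp
      then show "l = m" using assms(2) step len[OF l(1)] by (simp add: shift_shift shift_0)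
    qed simp
    have "Y_pow n i 1 (Y_pow n (i + 1) (-1) (f + scal c (e m))) =
      Y_pow n i 1 (Y_pow n (i + 1) (-1) f) + scal c (e (shift n i 1 m))"
      using Y_quot_e[of i m n] assms(2) step(2)
      by (simp add: Y_pow_def lin_ext_add lin_ext_scal del: lin_ext_e)
    then show ?case using step.IH inj by (simp add: lookup_add lookup_e)
  qed
  have "shift n i 1 l \<in> Poly_Mapping.keys g"
    using L[OF assms(3)] l(1) unfolding fixed by (simp add: in_keys_iff)
  from max[OF this] show False
    using assms(1,2) len[OF l(1)] by (simp add: shift_def nth_list_update)
qed

lemma div_diff_ex1:
  assumes "n \<ge> 1" "i + 1 < N" "f \<in> tensor_space N"
  shows "\<exists>!g. g \<in> tensor_space N \<and>
     Y_pow n i 1 (Y_pow n (i + 1) (-1) g) - g = swap_Y n i f - f"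
proof (rule ex_ex1I)
  show "\<exists>g. g \<in> tensor_space N \<and>
     Y_pow n i 1 (Y_pow n (i + 1) (-1) g) - g = swap_Y n i f - f"
    using div_diff_exists[OF assms(2,3)] by blast
next
  fix g h
  assume g: "g \<in> tensor_space N \<and>
       Y_pow n i 1 (Y_pow n (i + 1) (-1) g) - g = swap_Y n i f - f"
    and h: "h \<in> tensor_space N \<and>
       Y_pow n i 1 (Y_pow n (i + 1) (-1) h) - h = swap_Y n i f - f"
  have "Y_pow n i 1 (Y_pow n (i + 1) (-1) g) - Y_pow n i 1 (Y_pow n (i + 1) (-1) h) = g - h"
    proof -
    have "a - b = c - d" if "a - c = x" "b - d = x" for a b c d x :: vec
    proof -
      have "a = x + c" "b = x + d" using that by (auto simp: algebra_simps)
      then show ?thesis by simp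
    qed
    then show ?thesis using g h by blast
  qed
  moreover have "Y_pow n i 1 (Y_pow n (i + 1) (-1) (g - h)) =
     Y_pow n i 1 (Y_pow n (i + 1) (-1) g) - Y_pow n i 1 (Y_pow n (i + 1) (-1) h)"
    by (simp add: Y_pow_def lin_ext_diff)
  ultimately have "g - h = 0"
    using Y_quot_fixed_zero[OF assms(1,2), of "g - h"] g h tensor_space_diff by simp
  then show "g = h" by simp
qed

text \<open>The sum over all \<open>\<mu> \<prec> \<lambda>\<close> ranges over a finite set.\<close>

lemma finite_prec: "finite {m. prec N m l}"
proof -
  have root: "(\<Sum>i<N - 1. int (k i) * simple_root i j) =
      (if j + 1 < N then int (k j) else 0) - (if 0 < j then int (k (j - 1)) else 0)"
    if "j < N" for k j
  proof -
    have "(\<Sum>i<N - 1. int (k i) * simple_root i j) =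
       (\<Sum>i<N - 1. (if i = j then int (k i) else 0)
          - (if 0 < j \<and> i = j - 1 then int (k i) else 0))"
      by (rule sum.cong) (auto simp: simple_root_def)
    also have "\<dots> = (\<Sum>i<N - 1. if i = j then int (k i) else 0)
        - (\<Sum>i<N - 1. if 0 < j \<and> i = j - 1 then int (k i) else 0)"
      by (rule sum_subtractf)
    also have "(\<Sum>i<N - 1. if 0 < j \<and> i = j - 1 then int (k i) else 0) =
        (if 0 < j then int (k (j - 1)) else 0)"
      using that by (cases "0 < j") (auto simp: sum.delta)
    finally show ?thesis using that by (auto simp: sum.delta)
  qed
  define p where "p = plus_part l"
  define S where "S = {p ! (N - 1) .. p ! 0}"
  have "set m \<subseteq> S \<and> length m = N" if "prec N m l" and "plus_part m \<noteq> p" for m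
  proof -
    from that have d: "dom_le N (plus_part m) p" by (auto simp: prec_def dom_less_def p_def)
    then obtain k :: "nat \<Rightarrow> nat" where len: "length m = N"
      and k: "\<And>j. j < N \<Longrightarrow> p ! j - plus_part m ! j =
        (\<Sum>i<N - 1. int (k i) * simple_root i j)"
      by (auto simp: dom_le_def weights_def plus_part_def)
    have lm: "length (plus_part m) = N" by (simp add: plus_part_def len)
    have dec: "plus_part m ! j \<le> plus_part m ! i" if "i \<le> j" "j < N" for i j
      using that lm sorted_rev_nth_mono[of "plus_part m" i j]
      by (simp add: plus_part_def)
    have "x \<in> S" if x: "x \<in> set m" for x
    proof -
      have "x \<in> set (plus_part m)" using x by (simp add: plus_part_def)
      then obtain j where j: "j < N" "x = plus_part m ! j" by (metis in_set_conv_nth lm)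
      have "p ! 0 - plus_part m ! 0 \<ge> 0" using j k[of 0] root[of 0 k] by (auto split: if_splits)
      moreover have "p ! (N - 1) - plus_part m ! (N - 1) \<le> 0"
        using j k[of "N - 1"] root[of "N - 1" k] by (auto split: if_splits)
      moreover have "j \<le> N - 1" "N - 1 < N" using j by auto
      ultimately show ?thesis using dec[of 0 j] dec[of j "N - 1"] j by (auto simp: S_def)
    qed
    then show ?thesis using len by blast
  qed
  moreover have "set m \<subseteq> set l \<and> length m = length l" if "plus_part m = p" for m
  proof -
    from that have "sort m = sort l" by (simp add: plus_part_def p_def)
    then show ?thesis by (metis set_sort length_sort subset_refl)
  qed
  ultimately have "{m. prec N m l} \<subseteq>
      {m. set m \<subseteq> S \<and> length m = N} \<union> {m. set m \<subseteq> set l \<and> length m = length l}" by blast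
  moreover have "finite \<dots>" by (simp add: finite_lists_length_eq S_def)
  ultimately show ?thesis by (rule finite_subset)
qed

end

theory Submission
  imports Defs "HOL-Combinatorics.List_Permutation"
begin

text \<open>
  Put \<open>A = X\<^sub>1\<inverse>\<close>. The pair \<open>(Y\<^sub>1, A)\<close> satisfies \<open>T\<^sub>1 p T\<^sub>1 p = p T\<^sub>1 p T\<^sub>1\<close> for \<open>p = Y\<^sub>1, A\<close> and
  \<open>T\<^sub>1 Y\<^sub>1 T\<^sub>1 A = A T\<^sub>1 Y\<^sub>1 T\<^sub>1\<inverse>\<close>, and these relations are inherited by \<open>(Y\<^sub>1, Y\<^sub>1 A)\<close> and \<open>(Y\<^sub>1 A, A)\<close>.
  The word defining \<open>B\<^sub>1\<close> is a Christoffel word, hence is reached by these substitutions, so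
  \<open>T\<^sub>1 B\<^sub>1 T\<^sub>1 B\<^sub>1 = B\<^sub>1 T\<^sub>1 B\<^sub>1 T\<^sub>1\<close>. As \<open>B\<^sub>1\<close> commutes with \<open>T\<^sub>2, T\<^sub>3, \<dots>\<close>, all the \<open>B\<^sub>i\<close> commute.
  Each \<open>B\<^sub>i\<close> moves the entry \<open>\<lambda>\<^sub>i\<close> around the list \<open>n\<close> times, each time with a different residue modulo
  \<open>n\<close>. Following the expansion of \<open>T\<^sub>k\<close> on basis vectors shows that \<open>B\<^sub>i\<close> is triangular with the stated
  diagonal. For generic parameters the joint diagonal separates the weights, so that commuting
  triangular operators have joint eigenvectors with the given leading terms.
\<close>

section \<open>Linear maps\<close>

text \<open>The given operators involve \<open>THE\<close> and \<open>inv_into\<close> and are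
  controlled only on \<open>tensor_space N\<close>. Each is therefore replaced by a linear operator
  with an explicit formula on basis vectors, and the two are shown to agree on that space. The Hecke
  relations are not computed in Laurent polynomials: the difference of the two sides of a relation
  intertwines the multiplications by the variables, so it suffices to look at basis vectors with
  entries in \<open>{0..<n}\<close>. The shape of the eigenvalue comes from the \<open>n\<close>
  rounds of the entry \<open>x = \<lambda>\<^sub>i\<close>. In these rounds it is lowered by
  \<open>r = 0, ..., n - 1\<close>, each value once, and the rotation contributes the eigenvalue of
  \<open>D\<close> at \<open>x - r\<close>. Every \<open>u_a\<close> occurs once, and by Hermite's
  identity the exponents \<open>floor ((x - r) / n)\<close> add up to \<open>x + 1 - n\<close>; this
  is the origin of \<open>q^(1 - n)\<close>. Another entry \<open>y\<close> is congruent to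
  \<open>x - r\<close> modulo \<open>n\<close> for exactly one \<open>r\<close>, so it contributes
  exactly one factor \<open>v\<close> or \<open>v^-1\<close>, decided by comparing \<open>x\<close>
  with \<open>y\<close> and, for equal entries, by their positions.\<close>

lemma scal_add_right: "scal c (f + g) = scal c f + scal c g"
  by (rule poly_mapping_eqI) (simp add: lookup_add algebra_simps)

lemma scal_diff_right: "scal c (f - g) = scal c f - scal c g"
  by (rule poly_mapping_eqI) (simp add: lookup_minus algebra_simps)

lemma scal_scal: "scal a (scal b f) = scal (a * b) f"
  by (rule poly_mapping_eqI) simp

lemma scal_1 [simp]: "scal 1 f = f"
  by (rule poly_mapping_eqI) simp

lemma scal_0_left [simp]: "scal 0 f = 0"
  by (rule poly_mapping_eqI) simp

lemma scal_0_right [simp]: "scal c 0 = 0"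
  by (rule poly_mapping_eqI) simp

lemma scal_sum: "scal c (\<Sum>x\<in>X. f x) = (\<Sum>x\<in>X. scal c (f x))"
  by (rule poly_mapping_eqI) (simp add: lookup_sum sum_distrib_left)

definition lin :: "(vec \<Rightarrow> vec) \<Rightarrow> bool" where
  "lin F \<longleftrightarrow> (\<forall>f g. F (f + g) = F f + F g) \<and> (\<forall>c f. F (scal c f) = scal c (F f))"

lemma lin_add: "lin F \<Longrightarrow> F (f + g) = F f + F g"
  by (simp add: lin_def)

lemma lin_scal: "lin F \<Longrightarrow> F (scal c f) = scal c (F f)"
  by (simp add: lin_def)

lemma lin_zero: "lin F \<Longrightarrow> F 0 = 0"
  using lin_scal[of F 0 0] by simp

lemma lin_diff:
  assumes "lin F" shows "F (f - g) = F f - F g"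
  using lin_add[OF assms, of f "scal (-1) g"] unfolding lin_scal[OF assms]
  by (simp add: scal_minus_one)

lemma lin_sum: "lin F \<Longrightarrow> F (\<Sum>x\<in>X. f x) = (\<Sum>x\<in>X. F (f x))"
  by (induction X rule: infinite_finite_induct) (auto simp: lin_zero lin_add)

lemma lin_lin_ext [intro, simp]: "lin (lin_ext A)"
  by (simp add: lin_def lin_ext_add lin_ext_scal)

lemma lin_Y_pow [intro, simp]: "lin (Y_pow n i k)"
  by (simp add: Y_pow_def)

lemma lin_comp [intro]: "lin F \<Longrightarrow> lin G \<Longrightarrow> lin (F \<circ> G)"
  by (simp add: lin_def)

lemma lin_compose: "lin F \<Longrightarrow> lin G \<Longrightarrow> lin (\<lambda>x. F (G x))"
  by (simp add: lin_def)

lemma lin_id [intro, simp]: "lin id" "lin (\<lambda>x. x)"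
  by (simp_all add: lin_def)

lemma lin_plus: "lin F \<Longrightarrow> lin G \<Longrightarrow> lin (\<lambda>x. F x + G x)"
  by (simp add: lin_def scal_add_right algebra_simps)

lemma lin_minus: "lin F \<Longrightarrow> lin G \<Longrightarrow> lin (\<lambda>x. F x - G x)"
  by (simp add: lin_def scal_diff_right algebra_simps)

lemma lin_smult: "lin F \<Longrightarrow> lin (\<lambda>x. scal c (F x))"
  by (simp add: lin_def scal_add_right scal_scal mult.commute)

lemma lin_fun_sum: "(\<And>x. x \<in> X \<Longrightarrow> lin (F x)) \<Longrightarrow> lin (\<lambda>f. \<Sum>x\<in>X. F x f)"
  by (simp add: lin_def scal_sum sum.distrib)

lemma lin_cong:
  assumes "lin F" "lin G" "\<And>l. length l = N \<Longrightarrow> F (e l) = G (e l)" "f \<in> tensor_space N"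
  shows "F f = G f"
  using assms(4)
  by (induction rule: tensor_space_induct)
     (simp_all add: lin_zero lin_add lin_scal assms)

lemma tensor_space_sum: "(\<And>x. x \<in> X \<Longrightarrow> f x \<in> tensor_space N) \<Longrightarrow> (\<Sum>x\<in>X. f x) \<in> tensor_space N"
  by (induction X rule: infinite_finite_induct) (auto simp: tensor_space_add)

lemma lin_tensor_space:
  assumes "lin F" "\<And>l. length l = N \<Longrightarrow> F (e l) \<in> tensor_space N" "f \<in> tensor_space N"
  shows "F f \<in> tensor_space N"
  using assms(3)
  by (induction rule: tensor_space_induct)
     (simp_all add: lin_zero lin_add lin_scal tensor_space_add tensor_space_scal assms)

lemma Y_pow_tensor_space: "f \<in> tensor_space N \<Longrightarrow> Y_pow n i k f \<in> tensor_space N"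
  by (erule lin_tensor_space[rotated 2]) (auto simp: Y_pow_def intro: tensor_space_e)

section \<open>The Hecke operators on the basis\<close>

text \<open>This is \<open>(z^m - 1) / (z - 1)\<close> applied to \<open>e l\<close>, where
  \<open>z = Y_k / Y_(k+1)\<close>. At most one of the two sums is nonempty, the second one for
  negative \<open>m\<close>, so that \<open>geom_plus_1\<close> holds for every integer.\<close>

definition geom :: "nat \<Rightarrow> nat \<Rightarrow> int \<Rightarrow> int list \<Rightarrow> vec" where
  "geom n k m l = (\<Sum>t\<in>{0..<m}. e (shift n k t l)) - (\<Sum>t\<in>{m..<0}. e (shift n k t l))"

lemma geom_0 [simp]: "geom n k 0 l = 0"
  by (simp add: geom_def)

lemma geom_plus_1: "geom n k (m + 1) l = geom n k m l + e (shift n k m l)"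
proof (cases "m \<ge> 0")
  case True
  then have "{0..<m + 1} = insert m {0..<m}" "{m..<0} = {}" "{m + 1..<0} = {}" by auto
  then show ?thesis by (simp add: geom_def add.commute)
next
  case False
  then have "{m..<0} = insert m {m + 1..<0}" "{0..<m} = {}" "{0..<m + 1} = {}" by auto
  then show ?thesis by (simp add: geom_def)
qed

text \<open>The equivalence makes one computation serve both directions; it suits identities whose
  step only adds the same vector to both sides or applies an invertible operator.\<close>

lemma int_step_induct:
  assumes "P 0" "\<And>m :: int. P m \<longleftrightarrow> P (m + 1)"
  shows "P m"
proof (induction m rule: int_induct[where k = 0])
  case (step2 i) then show ?case using assms(2)[of "i - 1"] by simp
next
  case (step1 i) then show ?case using assms(2)[of i] by simp
qed (rule assms(1))

text \<open>In terms of \<open>z\<close> this is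
  \<open>z (z^(m-1) - 1) / (z - 1) = (z^m - 1) / (z - 1) - 1\<close>.\<close>

lemma geom_shift_1:
  assumes "k + 1 < length l"
  shows "geom n k (m - 1) (shift n k 1 l) = geom n k m l - e l"
proof (induction m rule: int_step_induct)
  case 1
  have "geom n k 0 (shift n k 1 l) = geom n k (-1) (shift n k 1 l) + e l"
    using geom_plus_1[of n k "-1" "shift n k 1 l"] assms by (simp add: shift_shift shift_0)
  then have "e l + geom n k (-1) (shift n k 1 l) = 0" by (simp add: add.commute)
  then show ?case by (simp add: eq_neg_iff_add_eq_0 add.commute)
next
  case (2 m)
  have "geom n k m (shift n k 1 l) = geom n k (m - 1) (shift n k 1 l) + e (shift n k m l)"
    using geom_plus_1[of n k "m - 1" "shift n k 1 l"] assms by (simp add: shift_shift)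
  then show ?case by (simp add: geom_plus_1)
qed

lemma Y_quot_geom:
  assumes "k + 1 < length l"
  shows "Y_pow n k 1 (Y_pow n (k + 1) (-1) (geom n k m l)) - geom n k m l = e (shift n k m l) - e l"
proof (induction m rule: int_step_induct)
  case 1 then show ?case by (simp add: lin_zero shift_0)
next
  case (2 m)
  have "Y_pow n k 1 (Y_pow n (k + 1) (-1) (e (shift n k m l))) = e (shift n k (m + 1) l)"
    using assms by (subst Y_quot_e) (auto simp: shift_shift add.commute)
  moreover have "a - b = c - d \<longleftrightarrow> (a + x) - (b + c) = x - d" for a b c d x :: vec
  proof -
    have "(a + x) - (b + c) - (x - d) = (a - b) - (c - d)" by (simp add: algebra_simps)
    then show ?thesis by (metis right_minus_eq)
  qed
  ultimately show ?case by (simp only: geom_plus_1 lin_add lin_Y_pow)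
qed

lemma geom_tensor_space: "length l = N \<Longrightarrow> geom n k m l \<in> tensor_space N"
  unfolding geom_def by (intro tensor_space_diff tensor_space_sum tensor_space_e) auto

definition swap_index :: "nat \<Rightarrow> int list \<Rightarrow> int list" where
  "swap_index k l = l[k := l ! (k + 1), k + 1 := l ! k]"

lemma length_swap_index [simp]: "length (swap_index k l) = length l"
  by (simp add: swap_index_def)

text \<open>One formula for all cases of \<open>R\<close>. If the residue at \<open>k\<close> is
  smaller than that at \<open>Suc k\<close>, the diagonal term of \<open>R\<close> turns, after the
  swap of the variables, into the next summand of the divided difference; the floor of the
  difference of the entries accounts for it.\<close>

definition T_basis :: "nat \<Rightarrow> complex \<Rightarrow> nat \<Rightarrow> int list \<Rightarrow> vec" where
  "T_basis n v k l = scal (if (l ! k - l ! Suc k) mod int n = 0 then v else 1) (e (swap_index k l)) +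
     scal (v - inverse v) (geom n k (- ((l ! k - l ! Suc k) div int n)) l)"

definition T_lin :: "nat \<Rightarrow> complex \<Rightarrow> nat \<Rightarrow> vec \<Rightarrow> vec" where
  "T_lin n v k = lin_ext (T_basis n v k)"

lemma lin_T_lin [intro, simp]: "lin (T_lin n v k)"
  by (simp add: T_lin_def)

lemma T_lin_e: "T_lin n v k (e l) = T_basis n v k l"
  by (simp add: T_lin_def)

lemma T_lin_tensor_space: "f \<in> tensor_space N \<Longrightarrow> T_lin n v k f \<in> tensor_space N"
  by (erule lin_tensor_space[rotated 2])
     (auto simp: T_lin_e T_basis_def intro!: tensor_space_add tensor_space_scal tensor_space_e geom_tensor_space)

lemma lin_mat_unit [simp]: "lin (mat_unit n i a b)"
  by (simp add: mat_unit_def)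

lemma lin_R_op: "lin (R_op n v k)"
proof -
  have "lin (\<lambda>f. mat_unit n i a b (mat_unit n j c d f))" for i j a b c d
    by (rule lin_compose) auto
  then show ?thesis
    unfolding R_op_def[abs_def] by (intro lin_plus lin_smult lin_fun_sum)
qed

lemma sum_pair_delta:
  fixes x :: "'a :: comm_monoid_add" and n :: nat
  assumes "A < n" "B < n"
  shows "(\<Sum>a<n. \<Sum>b\<in>{a<..<n}. if A = a \<and> B = b then x else 0) = (if A < B then x else 0)"
proof -
  have "(\<Sum>a<n. \<Sum>b\<in>{a<..<n}. if A = a \<and> B = b then x else 0) =
      (\<Sum>a<n. if A = a then (\<Sum>b\<in>{a<..<n}. if B = b then x else 0) else 0)"
    by (intro sum.cong) auto
  also have "\<dots> = (if A < B then x else 0)"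
    using assms by (simp add: sum.delta')
  finally show ?thesis .
qed

lemma mat_unit_diag: "mat_unit n i a a (e l) = (if l ! i mod int n = int a then e l else 0)"
proof -
  have "l[i := int n * (l ! i div int n) + int a] = l" if "l ! i mod int n = int a"
    using that by (metis list_update_id mult_div_mod_eq)
  then show ?thesis by (simp add: mat_unit_def)
qed

lemma R_op_e:
  assumes "n \<ge> 1" "k + 1 < length l"
  shows "R_op n v k (e l) =
    (if l ! k mod int n = l ! (k + 1) mod int n then scal v (e l)
     else e (l[k := int n * (l ! k div int n) + l ! (k + 1) mod int n,
               k + 1 := int n * (l ! (k + 1) div int n) + l ! k mod int n]) +
       (if l ! k mod int n < l ! (k + 1) mod int n then scal (v - inverse v) (e l) else 0))"
proof -
  define A where "A = nat (l ! k mod int n)"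
  define B where "B = nat (l ! (k + 1) mod int n)"
  have A: "A < n" "int A = l ! k mod int n" and B: "B < n" "int B = l ! (k + 1) mod int n"
    using assms(1) by (auto simp: A_def B_def nat_less_iff)
  have B': "l ! Suc k mod int n = int B" using B by simp
  define sw where "sw = l[k := int n * (l ! k div int n) + int B,
               k + 1 := int n * (l ! (k + 1) div int n) + int A]"
  have same: "mat_unit n k a a (mat_unit n (k + 1) b b (e l)) = (if A = a \<and> B = b then e l else 0)" for a b
    by (simp only: mat_unit_diag lin_zero A(2)[symmetric] B(2)[symmetric] lin_mat_unit if_distrib[of "mat_unit n k a a"])
      auto
  have cross: "mat_unit n k a b (mat_unit n (k + 1) b a (e l)) = (if A = b \<and> B = a then e sw else 0)" for a b
    using assms(2) list_update_swap[of k "k + 1" l]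
    by (auto simp add: mat_unit_def sw_def A(2)[symmetric] B')
  have "R_op n v k (e l) = scal v (\<Sum>a<n. if A = a then (if B = a then e l else 0) else 0) +
     ((\<Sum>a<n. \<Sum>b\<in>{a<..<n}. if B = a \<and> A = b then e sw else 0) +
      (\<Sum>a<n. \<Sum>b\<in>{a<..<n}. if A = a \<and> B = b then e sw else 0) +
      scal (v - inverse v) (\<Sum>a<n. \<Sum>b\<in>{a<..<n}. if A = a \<and> B = b then e l else 0))"
    unfolding R_op_def same cross by (simp add: sum.distrib scal_sum conj_commute if_if_eq_conj)
  also have "\<dots> = (if A = B then scal v (e l) else e sw + (if A < B then scal (v - inverse v) (e l) else 0))"
    using A(1) B(1) by (simp add: sum_pair_delta)
  finally show ?thesis
    by (simp add: sw_def A(2)[symmetric] B')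
qed

lemma div_diff_eqI:
  assumes "n \<ge> 1" "k + 1 < N" "f \<in> tensor_space N" "g \<in> tensor_space N"
    "Y_pow n k 1 (Y_pow n (k + 1) (-1) g) - g = swap_Y n k f - f"
  shows "div_diff n N k f = g"
  unfolding div_diff_def using div_diff_ex1[OF assms(1-3)] assms(4,5) by (intro the1_equality) auto

definition div_diff_lin :: "nat \<Rightarrow> nat \<Rightarrow> vec \<Rightarrow> vec" where
  "div_diff_lin n k = lin_ext (\<lambda>l. geom n k (l ! (k + 1) div int n - l ! k div int n) l)"

lemma div_diff_eq:
  assumes "n \<ge> 1" "k + 1 < N" "f \<in> tensor_space N"
  shows "div_diff n N k f = div_diff_lin n k f"
proof (rule div_diff_eqI[OF assms])
  show "div_diff_lin n k f \<in> tensor_space N"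
    by (rule lin_tensor_space[OF _ _ assms(3)]) (auto simp: div_diff_lin_def geom_tensor_space)
  have lin: "lin (swap_Y n k)" "lin (div_diff_lin n k)" by (simp_all add: swap_Y_def div_diff_lin_def)
  show "Y_pow n k 1 (Y_pow n (k + 1) (-1) (div_diff_lin n k f)) - div_diff_lin n k f = swap_Y n k f - f"
  proof (rule lin_cong[OF _ _ _ assms(3)])
    show "lin (\<lambda>f. Y_pow n k 1 (Y_pow n (k + 1) (-1) (div_diff_lin n k f)) - div_diff_lin n k f)"
      using lin by (intro lin_minus lin_compose[OF lin_Y_pow] lin_compose[OF lin_Y_pow lin(2)])
    show "lin (\<lambda>f. swap_Y n k f - f)" using lin by (intro lin_minus) auto
  qed (use assms(2) Y_quot_geom swap_Y_e in \<open>simp add: div_diff_lin_def\<close>)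
qed

text \<open>The restriction to \<open>tensor_space N\<close> is essential to the argument, since
  only there \<open>div_diff_ex1\<close> identifies the description behind
  \<open>div_diff\<close>.\<close>

lemma T_op_eq:
  assumes "n \<ge> 1" "k + 1 < N" "f \<in> tensor_space N"
  shows "T_op n N v k f = T_lin n v k f"
proof -
  have "swap_Y n k (R_op n v k f) + scal (v - inverse v) (div_diff_lin n k f) = T_lin n v k f"
  proof (rule lin_cong[OF _ _ _ assms(3)])
    show "lin (\<lambda>f. swap_Y n k (R_op n v k f) + scal (v - inverse v) (div_diff_lin n k f))"
      by (rule lin_plus[OF lin_compose[OF _ lin_R_op] lin_smult]) (simp_all add: swap_Y_def div_diff_lin_def)
    show "lin (T_lin n v k)" by simp
  next
    fix l :: "int list" assume l: "length l = N"
    define a where "a = l ! k"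
    define b where "b = l ! (k + 1)"
    define d where "d = b div int n - a div int n"
    have n: "int n > 0" using assms(1) by simp
    define sw where "sw = l[k := int n * (a div int n) + b mod int n,
               k + 1 := int n * (b div int n) + a mod int n]"
    have sw: "swap_Y n k (e sw) = e (swap_index k l)"
    proof -
      have "sw[k := b, Suc k := a] = swap_index k l"
        using assms(2) l by (intro nth_equalityI) (auto simp: sw_def swap_index_def a_def b_def nth_list_update)
      then show ?thesis
        using assms(2) l n unfolding swap_Y_def by (simp add: sw_def nth_list_update)
    qed
    have swY: "swap_Y n k (e l) = e (shift n k d l)"
      using assms(2) l by (subst swap_Y_e) (auto simp: d_def a_def b_def)
    have lin: "lin (swap_Y n k)" by (simp add: swap_Y_def)
    have eq0: "(a - b) mod int n = 0 \<longleftrightarrow> a mod int n = b mod int n"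
      by (metis mod_eq_0_iff_dvd mod_eq_dvd_iff)
    have ab: "a - b = int n * (- d) + (a mod int n - b mod int n)"
      by (simp add: d_def right_diff_distrib minus_mult_div_eq_mod[symmetric])
    have bd: "0 \<le> a mod int n" "a mod int n < int n" "0 \<le> b mod int n" "b mod int n < int n"
      using n by auto
    have R: "R_op n v k (e l) = (if a mod int n = b mod int n then scal v (e l)
        else e sw + (if a mod int n < b mod int n then scal (v - inverse v) (e l) else 0))"
      using assms(1,2) l by (subst R_op_e) (auto simp: a_def b_def sw_def)
    have D: "div_diff_lin n k (e l) = geom n k d l"
      by (simp add: div_diff_lin_def d_def a_def b_def)
    have T: "T_lin n v k (e l) = scal (if a mod int n = b mod int n then v else 1) (e (swap_index k l)) +
        scal (v - inverse v) (geom n k (- ((a - b) div int n)) l)"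
      unfolding eq0[symmetric] by (simp add: T_lin_e T_basis_def a_def b_def)
    show "swap_Y n k (R_op n v k (e l)) + scal (v - inverse v) (div_diff_lin n k (e l)) = T_lin n v k (e l)"
    proof (cases "a mod int n = b mod int n")
      case True
      \<comment> \<open>For equal residues, swapping the variables is the same as swapping the
        entries.\<close>
      have "- ((a - b) div int n) = d"
        using ab True n by (metis add.right_neutral diff_self minus_minus nonzero_mult_div_cancel_left less_irrefl)
      moreover have "shift n k d l = swap_index k l"
      proof -
        have "a + int n * d = b" "b - int n * d = a" using ab True by auto
        then show ?thesis by (simp only: shift_def swap_index_def a_def b_def)
      qed
      ultimately show ?thesis using True by (simp add: R D T lin_scal[OF lin] swY)
    next
      case False
      show ?thesis
      proof (cases "a mod int n < b mod int n")
        case True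
        have "int n + (a mod int n - b mod int n) < int n" "0 \<le> int n + (a mod int n - b mod int n)"
          using True bd by linarith+
        then have "(a - b) div int n = - d - 1"
          using ab by (intro int_div_pos_eq[of _ _ _ "int n + (a mod int n - b mod int n)"])
            (auto simp: algebra_simps)
        then have "- ((a - b) div int n) = d + 1" by simp
        then show ?thesis using True False
          by (simp add: R D T lin_scal[OF lin] lin_add[OF lin] swY sw geom_plus_1 scal_add_right)
      next
        case f: False
        have "(a - b) div int n = - d"
        proof (intro int_div_pos_eq[of _ _ _ "a mod int n - b mod int n"])
          show "0 \<le> a mod int n - b mod int n" "a mod int n - b mod int n < int n"
            using f bd by linarith+
        qed (use ab in auto)
        then have "- ((a - b) div int n) = d" by simp
        then show ?thesis using f False
          by (simp add: R D T lin_scal[OF lin] lin_add[OF lin] swY sw)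
      qed
    qed
  qed
  then show ?thesis by (simp add: T_op_def div_diff_eq[OF assms])
qed

section \<open>Cross relations between the Hecke operators and multiplication by the
  variables\<close>

lemma lin_ext_eqI:
  assumes "lin F" "lin G" "\<And>l. F (e l) = G (e l)"
  shows "F f = G f"
proof -
  have "F (\<Sum>l\<in>X. scal (Poly_Mapping.lookup f l) (e l)) = G (\<Sum>l\<in>X. scal (Poly_Mapping.lookup f l) (e l))" for X
    by (simp add: lin_sum[OF assms(1)] lin_sum[OF assms(2)] lin_scal[OF assms(1)] lin_scal[OF assms(2)] assms(3))
  then show ?thesis by (metis vec_decomp)
qed

lemma lin_T_lin_comp: "lin F \<Longrightarrow> lin (\<lambda>x. T_lin n v k (F x))"
  by (rule lin_compose) auto

lemma lin_Y_pow_comp: "lin F \<Longrightarrow> lin (\<lambda>x. Y_pow n i k (F x))"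
  by (rule lin_compose) auto

lemmas T_Y_lin = lin_add[OF lin_T_lin] lin_diff[OF lin_T_lin] lin_scal[OF lin_T_lin]
  lin_add[OF lin_Y_pow] lin_diff[OF lin_Y_pow] lin_scal[OF lin_Y_pow]

lemmas lin_intros = lin_T_lin_comp lin_Y_pow_comp lin_smult lin_plus lin_minus lin_id

definition Y_index :: "nat \<Rightarrow> nat \<Rightarrow> int list \<Rightarrow> int list" where
  "Y_index n j l = l[j := l ! j + int n]"

lemma length_Y_index [simp]: "length (Y_index n j l) = length l"
  by (simp add: Y_index_def)

lemma Y_e: "Y_pow n j 1 (e l) = e (Y_index n j l)"
  by (simp add: Y_pow_def Y_index_def)

lemma Y_pow_e: "Y_pow n j k (e l) = e (l[j := l ! j + int n * k])"
  by (simp add: Y_pow_def)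

lemma Y_pow_inverse: "Y_pow n j (- k) (Y_pow n j k f) = f"
proof (rule lin_ext_eqI[of "\<lambda>f. Y_pow n j (- k) (Y_pow n j k f)" "\<lambda>f. f"])
  show "lin (\<lambda>f. Y_pow n j (- k) (Y_pow n j k f))" "lin (\<lambda>f. f)"
    by (intro lin_intros)+
  show "Y_pow n j (- k) (Y_pow n j k (e l)) = e l" for l
    by (cases "j < length l") (simp_all add: Y_pow_e list_update_beyond)
qed

lemmas Y_inverse = Y_pow_inverse[of _ _ 1] Y_pow_inverse[of _ _ "-1", unfolded minus_minus]

lemma Y_commute: "Y_pow n i 1 (Y_pow n j 1 f) = Y_pow n j 1 (Y_pow n i 1 f)"
proof (cases "i = j")
  case False
  show ?thesis
    by (rule lin_ext_eqI[of "\<lambda>f. Y_pow n i 1 (Y_pow n j 1 f)" "\<lambda>f. Y_pow n j 1 (Y_pow n i 1 f)"])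
       (intro lin_intros, intro lin_intros,
        simp add: Y_pow_e list_update_swap[OF False] False False[symmetric])
qed simp

lemma Y_index_swap_index:
  assumes "Suc k < length l"
  shows "swap_index k (Y_index n k l) = Y_index n (Suc k) (swap_index k l)" "swap_index k (Y_index n (Suc k) l) = Y_index n k (swap_index k l)"
    "j \<noteq> k \<Longrightarrow> j \<noteq> Suc k \<Longrightarrow> swap_index k (Y_index n j l) = Y_index n j (swap_index k l)"
  using assms
  by (cases "j < length l"; auto intro!: nth_equalityI simp: swap_index_def Y_index_def nth_list_update list_update_beyond)+

lemma Y_index_shift_1:
  assumes "Suc k < length l"
  shows "Y_index n k l = shift n k 1 (Y_index n (Suc k) l)"
  using assms by (auto intro!: nth_equalityI simp: shift_def Y_index_def nth_list_update)

lemma Y_index_shift: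
  assumes "Suc k < length l"
  shows "Y_index n j (shift n k t l) = shift n k t (Y_index n j l)"
  using assms
  by (cases "j < length l") (auto intro!: nth_equalityI simp: shift_def Y_index_def nth_list_update list_update_beyond)

lemma Y_geom:
  assumes "Suc k < length l"
  shows "Y_pow n j 1 (geom n k m l) = geom n k m (Y_index n j l)"
  using assms by (simp add: geom_def lin_diff lin_sum Y_e Y_index_shift)

text \<open>Multiplication by \<open>Y_k\<close> raises the difference of the two entries by
  \<open>n\<close>, so the geometric sum loses one summand; the lost summand is the correction
  term.\<close>

lemma T_lin_Y_left_e:
  assumes "Suc k < length l" "n \<ge> 1"
  shows "T_lin n v k (Y_pow n k 1 (e l)) =
    Y_pow n (Suc k) 1 (T_lin n v k (e l)) - scal (v - inverse v) (Y_pow n (Suc k) 1 (e l))"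
proof -
  define d where "d = l ! k - l ! (Suc k)"
  have d: "Y_index n k l ! k - Y_index n k l ! (Suc k) = d + int n"
    using assms by (simp add: Y_index_def d_def)
  have dv: "- ((d + int n) div int n) = - (d div int n) - 1" using assms by simp
  have "geom n k (- (d div int n) - 1) (Y_index n k l) =
      geom n k (- (d div int n)) (Y_index n (Suc k) l) - e (Y_index n (Suc k) l)"
    unfolding Y_index_shift_1[OF assms(1)] using assms(1) by (subst geom_shift_1) auto
  then show ?thesis
    unfolding Y_e T_lin_e T_basis_def d dv
    using assms by (simp add: lin_add lin_scal Y_geom Y_e Y_index_swap_index scal_diff_right d_def[symmetric])
qed

lemma T_lin_Y_right_e:
  assumes "Suc k < length l" "n \<ge> 1"
  shows "T_lin n v k (Y_pow n (Suc k) 1 (e l)) =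
    Y_pow n k 1 (T_lin n v k (e l)) + scal (v - inverse v) (Y_pow n (Suc k) 1 (e l))"
proof -
  define d where "d = l ! k - l ! (Suc k)"
  have d: "Y_index n (Suc k) l ! k - Y_index n (Suc k) l ! (Suc k) = d - int n"
    using assms by (simp add: Y_index_def d_def)
  have dv: "- ((d - int n) div int n) = - (d div int n) + 1" "(d - int n) mod int n = d mod int n"
    using assms div_mult_self1[of "int n" d "-1"] by auto
  have "geom n k ((- (d div int n) + 1) - 1) (Y_index n k l) =
      geom n k (- (d div int n) + 1) (Y_index n (Suc k) l) - e (Y_index n (Suc k) l)"
    unfolding Y_index_shift_1[OF assms(1)] using assms(1) by (subst geom_shift_1) auto
  then have "geom n k (- (d div int n) + 1) (Y_index n (Suc k) l) =
      geom n k (- (d div int n)) (Y_index n k l) + e (Y_index n (Suc k) l)"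
    by simp
  then show ?thesis
    unfolding Y_e T_lin_e T_basis_def d dv
    using assms by (simp add: d_def[symmetric] lin_add lin_scal Y_geom Y_e Y_index_swap_index scal_add_right)
qed

lemma T_lin_Y_far_e:
  assumes "Suc k < length l" "j \<noteq> k" "j \<noteq> Suc k"
  shows "T_lin n v k (Y_pow n j 1 (e l)) = Y_pow n j 1 (T_lin n v k (e l))"
  using assms
  by (simp add: Y_e T_lin_e T_basis_def lin_add lin_scal Y_geom Y_index_swap_index) (simp add: Y_index_def)

context
  fixes n N :: nat and v :: complex
  assumes n: "n \<ge> 1"
begin

lemma T_lin_Y_left:
  assumes "Suc k < N" "f \<in> tensor_space N"
  shows "T_lin n v k (Y_pow n k 1 f) = Y_pow n (Suc k) 1 (T_lin n v k f) - scal (v - inverse v) (Y_pow n (Suc k) 1 f)"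
proof (rule lin_cong[of "\<lambda>f. T_lin n v k (Y_pow n k 1 f)" "\<lambda>f. Y_pow n (Suc k) 1 (T_lin n v k f) - scal (v - inverse v) (Y_pow n (Suc k) 1 f)"])
  show "lin (\<lambda>f. T_lin n v k (Y_pow n k 1 f))" "lin (\<lambda>f. Y_pow n (Suc k) 1 (T_lin n v k f) - scal (v - inverse v) (Y_pow n (Suc k) 1 f))"
    by (intro lin_intros)+
qed (use assms n in \<open>auto intro!: T_lin_Y_left_e\<close>)

lemma T_lin_Y_right:
  assumes "Suc k < N" "f \<in> tensor_space N"
  shows "T_lin n v k (Y_pow n (Suc k) 1 f) = Y_pow n k 1 (T_lin n v k f) + scal (v - inverse v) (Y_pow n (Suc k) 1 f)"
proof (rule lin_cong[of "\<lambda>f. T_lin n v k (Y_pow n (Suc k) 1 f)" "\<lambda>f. Y_pow n k 1 (T_lin n v k f) + scal (v - inverse v) (Y_pow n (Suc k) 1 f)"])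
  show "lin (\<lambda>f. T_lin n v k (Y_pow n (Suc k) 1 f))" "lin (\<lambda>f. Y_pow n k 1 (T_lin n v k f) + scal (v - inverse v) (Y_pow n (Suc k) 1 f))"
    by (intro lin_intros)+
qed (use assms n in \<open>auto intro!: T_lin_Y_right_e\<close>)

lemma T_lin_Y_far:
  assumes "Suc k < N" "j \<noteq> k" "j \<noteq> Suc k" "f \<in> tensor_space N"
  shows "T_lin n v k (Y_pow n j 1 f) = Y_pow n j 1 (T_lin n v k f)"
proof (rule lin_cong[of "\<lambda>f. T_lin n v k (Y_pow n j 1 f)" "\<lambda>f. Y_pow n j 1 (T_lin n v k f)"])
  show "lin (\<lambda>f. T_lin n v k (Y_pow n j 1 f))" "lin (\<lambda>f. Y_pow n j 1 (T_lin n v k f))"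
    by (intro lin_intros)+
qed (use assms n in \<open>auto intro!: T_lin_Y_far_e\<close>)

section \<open>Quadratic and braid relations, by reduction to entries in
  \<open>{0..<n}\<close>\<close>

lemma Y_index_reduce:
  assumes "\<And>l. length l = N \<Longrightarrow> P l \<longleftrightarrow> P (Y_index n j l)" "length l = N" "j < N" "P (l[j := l ! j mod int n])"
  shows "P l"
proof -
  define r where "r = l ! j mod int n"
  have "P (l[j := r + int n * t])" for t
  proof (induction t rule: int_step_induct)
    case 1 show ?case using assms(4) by (simp add: r_def)
  next
    case (2 t)
    have "Y_index n j (l[j := r + int n * t]) = l[j := r + int n * (t + 1)]"
      using assms(2,3) by (simp add: Y_index_def algebra_simps)
    moreover have "length (l[j := r + int n * t]) = N" using assms(2) by simp
    ultimately show ?case using assms(1) by metis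
  qed
  moreover have "r + int n * (l ! j div int n) = l ! j" by (simp add: r_def)
  ultimately show ?thesis by (metis list_update_id)
qed

text \<open>\<open>F\<close> will be the difference of the two sides of a relation. As
  multiplication by a variable is injective, whether \<open>F\<close> kills \<open>e l\<close>
  depends on the entry \<open>l ! j\<close> only modulo \<open>n\<close>. The index
  \<open>j'\<close> may differ from \<open>j\<close> because a relation can permute the
  variables.\<close>

lemma Y_reduce:
  assumes "lin F" "\<And>f. f \<in> tensor_space N \<Longrightarrow> F (Y_pow n j 1 f) = Y_pow n j' 1 (F f)"
    "length l = N" "j < N" "F (e (l[j := l ! j mod int n])) = 0"
  shows "F (e l) = 0"
proof (rule Y_index_reduce[where P = "\<lambda>l. F (e l) = 0" and j = j])
  fix l :: "int list" assume "length l = N"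
  then have "F (e (Y_index n j l)) = Y_pow n j' 1 (F (e l))"
    using assms(2)[of "e l"] by (simp add: Y_e tensor_space_e)
  then show "F (e l) = 0 \<longleftrightarrow> F (e (Y_index n j l)) = 0"
    using Y_inverse(1)[of n j' "F (e l)"] by (auto simp: lin_zero)
qed (use assms in auto)

text \<open>For such entries the divided difference has at most one summand, and the formula is the
  R-matrix action of the finite Hecke algebra on a tensor power of \<open>C^n\<close>.\<close>

lemma T_basis_reduced:
  assumes "0 \<le> l ! k" "l ! k < int n" "0 \<le> l ! (Suc k)" "l ! (Suc k) < int n"
  shows "T_basis n v k l = scal (if l ! k = l ! (Suc k) then v else 1) (e (swap_index k l)) +
     (if l ! k < l ! (Suc k) then scal (v - inverse v) (e l) else 0)"
proof -
  have 1: "(l ! k - l ! (Suc k)) mod int n = 0 \<longleftrightarrow> l ! k = l ! (Suc k)"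
    using assms by (metis mod_eq_0_iff_dvd mod_eq_dvd_iff mod_pos_pos_trivial)
  have 2: "(l ! k - l ! (Suc k)) div int n = (if l ! k < l ! (Suc k) then -1 else 0)"
    using assms by (auto intro: int_div_pos_eq[of _ _ _ "l ! k - l ! (Suc k) + int n"] div_pos_pos_trivial)
  have "geom n k 1 l = e l" using geom_plus_1[of n k 0 l] by (simp add: shift_0)
  then show ?thesis unfolding T_basis_def 1 2 by simp
qed

lemma T_lin_quadratic:
  assumes v: "v \<noteq> 0" and k: "Suc k < N" and f: "f \<in> tensor_space N"
  shows "T_lin n v k (T_lin n v k f) = scal (v - inverse v) (T_lin n v k f) + f"
proof -
  define c where "c = v - inverse v"
  define Q where "Q f = T_lin n v k (T_lin n v k f) - scal c (T_lin n v k f) - f" for f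
  have lin: "lin Q" unfolding Q_def[abs_def] by (intro lin_intros)
  note rules = T_lin_Y_left[OF k] T_lin_Y_right[OF k] T_lin_tensor_space c_def[symmetric]
    T_Y_lin Y_pow_tensor_space tensor_space_add tensor_space_diff tensor_space_scal
  have YQ: "Q (Y_pow n k 1 f) = Y_pow n k 1 (Q f)"
       "Q (Y_pow n (Suc k) 1 f) = Y_pow n (Suc k) 1 (Q f)" if "f \<in> tensor_space N" for f
    unfolding Q_def using that
    by (simp_all add: rules) (rule poly_mapping_eqI; simp add: lookup_add lookup_minus algebra_simps)+
  have "Q (e l) = 0" if l: "length l = N" for l
  proof (rule Y_reduce[OF lin YQ(1) l], assumption)
    let ?l = "l[k := l ! k mod int n]"
    show "Q (e ?l) = 0"
    proof (rule Y_reduce[OF lin YQ(2)], assumption)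
      define L where "L a b = l[k := a, Suc k := b]" for a b
      have T: "T_lin n v k (e (L a b)) = scal (if a = b then v else 1) (e (L b a)) +
        (if a < b then scal c (e (L a b)) else 0)" if "0 \<le> a" "a < int n" "0 \<le> b" "b < int n" for a b
      proof -
        have "swap_index k (L a b) = L b a" using k l by (auto simp: L_def swap_index_def intro!: nth_equalityI simp: nth_list_update)
        then show ?thesis
          using that k l T_basis_reduced[of "L a b" k] by (simp add: T_lin_e L_def c_def)
      qed
      define a where "a = l ! k mod int n"
      define b where "b = l ! (Suc k) mod int n"
      have ab: "0 \<le> a" "a < int n" "0 \<le> b" "b < int n" using n by (auto simp: a_def b_def)
      have "Q (e (L a b)) = 0"
        using ab v by (cases a b rule: linorder_cases)
          (auto simp: Q_def T lin_add lin_scal scal_scal intro!: poly_mapping_eqI simp: lookup_add lookup_minus,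
           auto simp: c_def field_simps)
      then show "Q (e (?l[Suc k := ?l ! (Suc k) mod int n])) = 0"
        by (simp add: L_def a_def b_def)
    qed (use k l in auto)
  qed (use k in auto)
  then have "Q f = 0"
    by (intro lin_cong[OF lin _ _ f, where G = "\<lambda>_. 0"]) (auto simp: lin_def)
  then show ?thesis by (simp add: Q_def c_def algebra_simps)
qed

lemma T_lin_braid:
  assumes v: "v \<noteq> 0" and k: "Suc (Suc k) < N" and f: "f \<in> tensor_space N"
  shows "T_lin n v k (T_lin n v (Suc k) (T_lin n v k f)) = T_lin n v (Suc k) (T_lin n v k (T_lin n v (Suc k) f))"
proof -
  define c where "c = v - inverse v"
  define Q where "Q f = T_lin n v k (T_lin n v (Suc k) (T_lin n v k f)) -
     T_lin n v (Suc k) (T_lin n v k (T_lin n v (Suc k) f))" for f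
  have lin: "lin Q" unfolding Q_def[abs_def] by (intro lin_intros)
  have k1: "Suc k < N" and k2: "Suc (Suc k) < N" using k by auto
  note rules = T_lin_Y_left[OF k1] T_lin_Y_right[OF k1]
    T_lin_Y_left[OF k2] T_lin_Y_right[OF k2]
    T_lin_Y_far[OF k1, of "Suc (Suc k)", simplified]  T_lin_Y_far[OF k2, of k, simplified]
    T_lin_quadratic[OF v k1, folded c_def] T_lin_quadratic[OF v k2, folded c_def]
    T_lin_tensor_space c_def[symmetric]
    T_Y_lin Y_pow_tensor_space tensor_space_add tensor_space_diff tensor_space_scal
  \<comment> \<open>Both sides reverse the three variables. Products of two equal operators appear
    among the correction terms and are removed by the quadratic relation.\<close>
  have YQ: "Q (Y_pow n k 1 f) = Y_pow n (Suc (Suc k)) 1 (Q f)"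
       "Q (Y_pow n (Suc k) 1 f) = Y_pow n (Suc k) 1 (Q f)"
       "Q (Y_pow n (Suc (Suc k)) 1 f) = Y_pow n k 1 (Q f)" if "f \<in> tensor_space N" for f
    unfolding Q_def using that
    by (simp_all add: rules) (rule poly_mapping_eqI; simp add: lookup_add lookup_minus algebra_simps)+
  have "Q (e l) = 0" if l: "length l = N" for l
  proof (rule Y_reduce[OF lin YQ(1) l], assumption)
    let ?l = "l[k := l ! k mod int n]"
    show "Q (e ?l) = 0"
    proof (rule Y_reduce[OF lin YQ(2)], assumption)
      let ?m = "?l[Suc k := ?l ! (Suc k) mod int n]"
      show "Q (e ?m) = 0"
      proof (rule Y_reduce[OF lin YQ(3)], assumption)
        define L where "L a b d = l[k := a, Suc k := b, Suc (Suc k) := d]" for a b d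
        have T: "T_lin n v k (e (L a b d)) = scal (if a = b then v else 1) (e (L b a d)) +
          (if a < b then scal c (e (L a b d)) else 0)" if "0 \<le> a" "a < int n" "0 \<le> b" "b < int n" for a b d
        proof -
          have "swap_index k (L a b d) = L b a d"
            using k l by (auto simp: L_def swap_index_def intro!: nth_equalityI simp: nth_list_update)
          then show ?thesis
            using that k l T_basis_reduced[of "L a b d" k] by (simp add: T_lin_e L_def c_def)
        qed
        have T': "T_lin n v (Suc k) (e (L d a b)) = scal (if a = b then v else 1) (e (L d b a)) +
          (if a < b then scal c (e (L d a b)) else 0)" if "0 \<le> a" "a < int n" "0 \<le> b" "b < int n" for a b d
        proof -
          have "swap_index (Suc k) (L d a b) = L d b a"
            using k l by (auto simp: L_def swap_index_def intro!: nth_equalityI simp: nth_list_update)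
          then show ?thesis
            using that k l T_basis_reduced[of "L d a b" "Suc k"] by (simp add: T_lin_e L_def c_def)
        qed
        define a where "a = l ! k mod int n"
        define b where "b = l ! (Suc k) mod int n"
        define d where "d = l ! (Suc (Suc k)) mod int n"
        have ab: "0 \<le> a" "a < int n" "0 \<le> b" "b < int n" "0 \<le> d" "d < int n"
          using n by (auto simp: a_def b_def d_def)
        have "Q (e (L a b d)) = 0"
          using ab v by (cases a b rule: linorder_cases; cases b d rule: linorder_cases; cases a d rule: linorder_cases)
            (auto simp: Q_def T T' T_Y_lin scal_scal intro!: poly_mapping_eqI simp: lookup_add lookup_minus algebra_simps,
             simp_all add: c_def field_simps)
        then show "Q (e (?m[Suc (Suc k) := ?m ! (Suc (Suc k)) mod int n])) = 0"
          by (simp add: L_def a_def b_def d_def)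
      qed (use k l in auto)
    qed (use k l in auto)
  qed (use k in auto)
  then have "Q f = 0"
    by (intro lin_cong[OF lin _ _ f, where G = "\<lambda>_. 0"]) (auto simp: lin_def)
  then show ?thesis by (simp add: Q_def c_def)
qed

end

section \<open>Words in the elliptic braid group\<close>

text \<open>The braid relation of type B. It says that \<open>p\<close> commutes with
  \<open>s p s\<close>, which is how the first two members of the family come to commute.\<close>

definition braid :: "('a \<Rightarrow> 'a) \<Rightarrow> ('a \<Rightarrow> 'a) \<Rightarrow> bool" where
  "braid s p \<longleftrightarrow> (\<forall>x. s (p (s (p x))) = p (s (p (s x))))"

definition skew :: "('a \<Rightarrow> 'a) \<Rightarrow> ('a \<Rightarrow> 'a) \<Rightarrow> ('a \<Rightarrow> 'a) \<Rightarrow> ('a \<Rightarrow> 'a) \<Rightarrow> bool" where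
  "skew s si p r \<longleftrightarrow> (\<forall>x. s (p (s (r x))) = r (s (p (si x))))"

lemma skew_inverse:
  assumes "\<And>x. si (s x) = x" "skew s si p r"
  shows "r (s (p x)) = s (p (s (r (s x))))"
  using assms by (simp add: skew_def)

text \<open>Rewriting \<open>r s p\<close> as \<open>s p s r s\<close> brings both \<open>p\<close>
  to the left of both \<open>r\<close>; there the two braid relations apply separately, and the
  rewriting is undone.\<close>

lemma braid_comp:
  assumes inv: "\<And>x. s (si x) = x" "\<And>x. si (s x) = x"
    and p: "braid s p" and r: "braid s r" and pr: "skew s si p r"
  shows "braid s (p \<circ> r)"
  unfolding braid_def
proof
  fix x
  note sk = skew_inverse[OF inv(2) pr]
  have "s (p (r (s (p (r x))))) = s (p (s (p (s (r (s (r x)))))))" by (simp add: sk)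
  also have "\<dots> = p (s (p (s (r (s (r (s x)))))))" using p r by (simp add: braid_def)
  also have "\<dots> = p (r (s (p (r (s x)))))" by (simp add: sk)
  finally show "s ((p \<circ> r) (s ((p \<circ> r) x))) = (p \<circ> r) (s ((p \<circ> r) (s x)))" by simp
qed

lemma skew_comp:
  assumes inv: "\<And>x. s (si x) = x" "\<And>x. si (s x) = x"
    and p: "braid s p" and r: "braid s r" and pr: "skew s si p r"
  shows "skew s si p (p \<circ> r)" "skew s si (p \<circ> r) r"
proof -
  show "skew s si p (p \<circ> r)"
    using p pr by (simp add: skew_def braid_def)
  have "r (s (p (r (si x)))) = s (p (r (s (r x))))" for x
    using r inv by (simp add: skew_inverse[OF inv(2) pr] braid_def)
  then show "skew s si (p \<circ> r) r" by (simp add: skew_def)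
qed

section \<open>Words in two letters and Christoffel words\<close>

fun word_op :: "('a \<Rightarrow> 'a) \<Rightarrow> ('a \<Rightarrow> 'a) \<Rightarrow> bool list \<Rightarrow> 'a \<Rightarrow> 'a" where
  "word_op p r [] = id"
| "word_op p r (b # w) = (if b then r else p) \<circ> word_op p r w"

lemma word_op_append: "word_op p r (w @ w') = word_op p r w \<circ> word_op p r w'"
  by (induction w) auto

text \<open>A Christoffel word is the itinerary of \<open>0\<close> under the rotation by \<open>n\<close> of \<open>{0..<n + n'}\<close>, viewed
  as an exchange of two intervals. Inducing the rotation gives the substitutions below, so every
  Christoffel word arises from the pair of letters by Euclid's algorithm.\<close>

fun path :: "nat \<Rightarrow> nat \<Rightarrow> nat \<Rightarrow> bool list \<Rightarrow> nat \<Rightarrow> bool" where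
  "path n n' x [] y \<longleftrightarrow> x = y"
| "path n n' x (b # w) y \<longleftrightarrow> (if b then x \<ge> n' \<and> path n n' (x - n') w y else x < n' \<and> path n n' (x + n) w y)"

text \<open>The current point dictates the next letter. Hence two words with the same starting point
  and length can be identified without comparing their letters.\<close>

lemma path_unique: "path n n' x w y \<Longrightarrow> path n n' x w' y' \<Longrightarrow> length w = length w' \<Longrightarrow> w = w'"
proof (induction w arbitrary: x w')
  case (Cons b w)
  then obtain b' v where "w' = b' # v" by (cases w') auto
  then show ?case using Cons by (cases b; cases b') auto
qed simp

lemma path_count: "path n n' x w y \<Longrightarrow> x + n * count_list w False = y + n' * count_list w True"
proof (induction w arbitrary: x)
  case (Cons b w)
  show ?case
  proof (cases b)
    case True
    with Cons.prems have x: "x \<ge> n'" "path n n' (x - n') w y" by auto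
    from Cons.IH[OF x(2)] show ?thesis using x(1) True by auto
  next
    case False
    with Cons.prems have "path n n' (x + n) w y" by auto
    from Cons.IH[OF this] show ?thesis using False by auto
  qed
qed simp

text \<open>Named after the operator that changes: here the letter of \<open>r\<close> becomes
  \<open>p \<circ> r\<close>, in \<open>subst_p\<close> the letter of \<open>p\<close> does.\<close>

definition subst_r :: "bool list \<Rightarrow> bool list" where
  "subst_r w = concat (map (\<lambda>b. if b then [False, True] else [False]) w)"

definition subst_p :: "bool list \<Rightarrow> bool list" where
  "subst_p w = concat (map (\<lambda>b. if b then [True] else [False, True]) w)"

lemma word_op_subst_r: "word_op p r (subst_r w) = word_op p (p \<circ> r) w"
  by (induction w) (auto simp: subst_r_def word_op_append)

lemma word_op_subst_p: "word_op p r (subst_p w) = word_op (p \<circ> r) r w"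
  by (induction w) (auto simp: subst_p_def word_op_append)

lemma path_subst_r: "path n n' x w y \<Longrightarrow> x < n + n' \<Longrightarrow> path n (n' + n) x (subst_r w) y"
proof (induction w arbitrary: x)
  case (Cons b w)
  then show ?case by (cases b) (auto simp: subst_r_def)
qed (simp add: subst_r_def)

lemma path_subst_p: "path n n' x w y \<Longrightarrow> path (n + n') n' x (subst_p w) y"
proof (induction w arbitrary: x)
  case (Cons b w)
  then show ?case by (cases b) (auto simp: subst_p_def add.assoc)
qed (simp add: subst_p_def)

lemma length_subst:
  "length (subst_r w) = length w + count_list w True"
  "length (subst_p w) = length w + count_list w False"
  by (induction w) (auto simp: subst_r_def subst_p_def)

lemma length_count: "length w = count_list w False + count_list w True"
  by (induction w) auto

text \<open>\<open>True\<close> stands for the inverse of \<open>X_1\<close>: the floor of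
  \<open>j n / (n + n')\<close> jumps exactly when the remainder of \<open>j n\<close> is below
  \<open>n\<close>.\<close>

definition christoffel :: "nat \<Rightarrow> nat \<Rightarrow> bool list" where
  "christoffel n n' = map (\<lambda>j. j * n mod (n + n') < n) [1..<n + n' + 1]"

lemma rotation_step:
  fixes n n' i :: nat
  assumes "n \<ge> 1" "n' \<ge> 1"
  shows "Suc i * n mod (n + n') =
    (if i * n mod (n + n') < n' then i * n mod (n + n') + n else i * n mod (n + n') - n')"
proof -
  define x where "x = i * n mod (n + n')"
  have x: "x < n + n'" using assms by (simp add: x_def)
  have "Suc i * n mod (n + n') = (x + n) mod (n + n')"
    by (simp add: x_def mod_add_left_eq add.commute[of n])
  also have "\<dots> = (if x < n' then x + n else x - n')"
  proof (cases "x < n'")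
    case False
    then have "x + n = (x - n') + (n + n')" by simp
    then show ?thesis using False x by (metis less_imp_diff_less mod_add_self2 mod_less)
  qed simp
  finally show ?thesis by (simp add: x_def)
qed

lemma path_christoffel:
  assumes "n \<ge> 1" "n' \<ge> 1"
  shows "path n n' 0 (christoffel n n') 0"
proof -
  have "path n n' (i * n mod (n + n')) (map (\<lambda>j. j * n mod (n + n') < n) [Suc i..<n + n' + 1]) 0"
    if "i \<le> n + n'" for i
    using that
  proof (induction i rule: inc_induct)
    case base show ?case by simp
  next
    case (step i)
    define x where "x = i * n mod (n + n')"
    have x: "x < n + n'" using assms by (simp add: x_def)
    have "[Suc i..<n + n' + 1] = Suc i # [Suc (Suc i)..<n + n' + 1]"
      using step by (simp add: upt_rec)
    moreover have "Suc i * n mod (n + n') < n \<longleftrightarrow> x \<ge> n'"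
      using x unfolding rotation_step[OF assms] x_def[symmetric] by auto
    moreover have "path n n' (if x < n' then x + n else x - n')
        (map (\<lambda>j. j * n mod (n + n') < n) [Suc (Suc i)..<n + n' + 1]) 0"
      using step.IH unfolding rotation_step[OF assms] x_def[symmetric] .
    ultimately show ?case
      unfolding x_def[symmetric] by (auto simp del: upt_Suc mult_Suc split: if_splits)
  qed
  from this[of 0] show ?thesis by (simp add: christoffel_def)
qed

lemma length_christoffel: "length (christoffel n n') = n + n'"
  by (simp add: christoffel_def del: upt_Suc)

text \<open>Ascents and descents of a closed path balance, so the two counts are in the ratio
  \<open>n : n'\<close>, and the length of the word fixes them.\<close>

lemma count_christoffel:
  assumes "n \<ge> 1" "n' \<ge> 1"
  shows "count_list (christoffel n n') True = n" "count_list (christoffel n n') False = n'"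
proof -
  let ?a = "count_list (christoffel n n') True" and ?b = "count_list (christoffel n n') False"
  have 1: "n * ?b = n' * ?a" using path_count[OF path_christoffel[OF assms]] by simp
  have 2: "?b + ?a = n + n'"
    using length_count[of "christoffel n n'"] by (simp add: length_christoffel)
  have "(n + n') * ?a = n * (?b + ?a)" using 1 by (simp add: algebra_simps)
  then have "(n + n') * ?a = (n + n') * n" unfolding 2 by (simp only: mult.commute)
  then show a: "?a = n" using assms by auto
  show "?b = n'" using 2 a by simp
qed

lemma christoffel_subst:
  assumes "n \<ge> 1" "n' \<ge> 1"
  shows "christoffel n (n' + n) = subst_r (christoffel n n')"
    "christoffel (n + n') n' = subst_p (christoffel n n')"
proof -
  show "christoffel n (n' + n) = subst_r (christoffel n n')"
    by (rule path_unique[OF path_christoffel path_subst_r[OF path_christoffel]])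
       (use assms in \<open>auto simp: length_christoffel length_subst count_christoffel\<close>)
  show "christoffel (n + n') n' = subst_p (christoffel n n')"
    by (rule path_unique[OF path_christoffel path_subst_p[OF path_christoffel]])
       (use assms in \<open>auto simp: length_christoffel length_subst count_christoffel\<close>)
qed

lemma braid_christoffel:
  assumes inv: "\<And>x. s (si x) = x" "\<And>x. si (s x) = x"
    and "coprime n n'" "n \<ge> 1" "n' \<ge> 1" "braid s p" "braid s r" "skew s si p r"
  shows "braid s (word_op p r (christoffel n n'))"
  using assms(3-)
proof (induction "n + n'" arbitrary: n n' p r rule: less_induct)
  case less
  note hyps = less.prems
  consider "n = n'" | "n < n'" | "n' < n" by linarith
  then show ?case
  proof cases
    case 1
    \<comment> \<open>Coprimality enters here: Euclid's algorithm can only stop at the two-letter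
      word \<open>p r\<close>.\<close>
    with hyps have "n = 1" "n' = 1" by auto
    moreover have "christoffel 1 1 = [False, True]"
      by (simp add: christoffel_def upt_rec)
    ultimately show ?thesis
      using braid_comp[OF inv hyps(4-6)] by simp
  next
    case 2
    then have "coprime n (n' - n)" using hyps(1)
      by (metis gcd.commute gcd_diff1_nat coprime_iff_gcd_eq_1 less_imp_le_nat)
    moreover have "christoffel n n' = subst_r (christoffel n (n' - n))"
      using christoffel_subst(1)[of n "n' - n"] hyps 2 by simp
    ultimately show ?thesis
      using less.hyps[of n "n' - n" p "p \<circ> r"] hyps 2 braid_comp[OF inv hyps(4-6)] skew_comp[OF inv hyps(4-6)]
      by (simp add: word_op_subst_r)
  next
    case 3
    then have "coprime (n - n') n'" using hyps(1)
      by (metis gcd_diff1_nat coprime_iff_gcd_eq_1 less_imp_le_nat)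
    moreover have "christoffel n n' = subst_p (christoffel (n - n') n')"
      using christoffel_subst(2)[of "n - n'" n'] hyps 3 by simp
    ultimately show ?thesis
      using less.hyps[of "n - n'" n' "p \<circ> r" r] hyps 3 braid_comp[OF inv hyps(4-6)] skew_comp[OF inv hyps(4-6)]
      by (simp add: word_op_subst_p)
  qed
qed

section \<open>Commuting families in a braid group\<close>

text \<open>The order is chosen so that a chain of inverses starting at \<open>0\<close> inverts the
  product \<open>T_0 T_1 ...\<close> occurring in \<open>X_1\<close>.\<close>

fun chain :: "(nat \<Rightarrow> 'a \<Rightarrow> 'a) \<Rightarrow> nat \<Rightarrow> nat \<Rightarrow> 'a \<Rightarrow> 'a" where
  "chain S a 0 x = x"
| "chain S a (Suc m) x = S (a + m) (chain S a m x)"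

lemma chain_Suc_left: "chain S a (Suc m) x = chain S (Suc a) m (S a x)"
  by (induction m) auto

lemma chain_commute:
  assumes "\<And>i y. a \<le> i \<Longrightarrow> i < a + m \<Longrightarrow> S i (F y) = F (S i y)"
  shows "chain S a m (F x) = F (chain S a m x)"
  using assms by (induction m) auto

fun conj_family :: "(nat \<Rightarrow> 'a \<Rightarrow> 'a) \<Rightarrow> ('a \<Rightarrow> 'a) \<Rightarrow> nat \<Rightarrow> 'a \<Rightarrow> 'a" where
  "conj_family T B 0 x = B x"
| "conj_family T B (Suc i) x = T i (conj_family T B i (T i x))"

text \<open>The relations are required at every point of the type, which keeps the group-like
  computations free of membership conditions; \<open>restr\<close> later provides such total
  operators.\<close>

locale braid_action =
  fixes N :: nat and T Ti :: "nat \<Rightarrow> 'a \<Rightarrow> 'a"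
  assumes T_Ti: "Suc k < N \<Longrightarrow> T k (Ti k x) = x" and Ti_T: "Suc k < N \<Longrightarrow> Ti k (T k x) = x"
    and T_braid: "Suc (Suc k) < N \<Longrightarrow> T k (T (Suc k) (T k x)) = T (Suc k) (T k (T (Suc k) x))"
    and T_far: "Suc j < k \<Longrightarrow> Suc k < N \<Longrightarrow> T j (T k x) = T k (T j x)"
begin

lemma T_far': "Suc j < k \<or> Suc k < j \<Longrightarrow> Suc k < N \<Longrightarrow> Suc j < N \<Longrightarrow> T j (T k x) = T k (T j x)"
  using T_far[of j k x] T_far[of k j x] by auto

lemma Ti_commute:
  assumes "Suc j < N" "\<And>x. T j (F x) = F (T j x)"
  shows "Ti j (F x) = F (Ti j x)"
proof -
  have "Ti j (F (T j (Ti j x))) = F (Ti j x)"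
    using assms by (simp add: Ti_T flip: assms(2))
  then show ?thesis using assms(1) by (simp add: T_Ti)
qed

lemma Ti_T_far:
  assumes "Suc j < k \<or> Suc k < j" "Suc k < N" "Suc j < N"
  shows "Ti j (T k x) = T k (Ti j x)"
  using assms by (intro Ti_commute[of j "T k"] T_far') auto

lemma Ti_Ti_far:
  assumes "Suc j < k \<or> Suc k < j" "Suc k < N" "Suc j < N"
  shows "Ti j (Ti k x) = Ti k (Ti j x)"
  using assms by (intro Ti_commute[of j "Ti k"] Ti_T_far[of k j, symmetric]) auto

lemma Ti_Ti_T:
  assumes "Suc (Suc k) < N"
  shows "Ti (Suc k) (Ti k (T (Suc k) x)) = T k (Ti (Suc k) (Ti k x))"
proof -
  define y where "y = Ti (Suc k) (Ti k x)"
  have "T (Suc k) (T k (T (Suc k) y)) = T k (T (Suc k) (T k y))"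
    using T_braid[OF assms] by simp
  moreover have "x = T k (T (Suc k) y)" using assms by (simp add: y_def T_Ti)
  ultimately have "Ti (Suc k) (Ti k (T (Suc k) x)) = T k y" using assms by (simp add: Ti_T)
  then show ?thesis by (simp add: y_def)
qed

lemma Ti_Ti_T':
  assumes "Suc (Suc k) < N"
  shows "Ti k (Ti (Suc k) (T k x)) = T (Suc k) (Ti k (Ti (Suc k) x))"
proof -
  define y where "y = Ti k (Ti (Suc k) x)"
  have "T k (T (Suc k) (T k y)) = T (Suc k) (T k (T (Suc k) y))"
    using T_braid[OF assms] by simp
  moreover have "x = T (Suc k) (T k y)" using assms by (simp add: y_def T_Ti)
  ultimately have "Ti k (Ti (Suc k) (T k x)) = T (Suc k) y" using assms by (simp add: Ti_T)
  then show ?thesis by (simp add: y_def)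
qed

lemma conj_family_T_right:
  assumes "\<And>k x. 1 \<le> k \<Longrightarrow> Suc k < N \<Longrightarrow> B (T k x) = T k (B x)"
  shows "i < k \<Longrightarrow> Suc k < N \<Longrightarrow> conj_family T B i (T k x) = T k (conj_family T B i x)"
proof (induction i arbitrary: x)
  case (Suc i) then show ?case by (simp add: T_far[of i k])
qed (use assms in auto)

text \<open>As for Jucys-Murphy elements: the braid relation turns \<open>T k\<close> into
  \<open>T (Suc k)\<close> on its way in, this commutes with the \<open>k\<close>-th member of the
  family, and the braid relation turns it back on the way out.\<close>

lemma conj_family_T_left:
  assumes "\<And>k x. 1 \<le> k \<Longrightarrow> Suc k < N \<Longrightarrow> B (T k x) = T k (B x)"
  shows "Suc k < i \<Longrightarrow> i < N \<Longrightarrow> conj_family T B i (T k x) = T k (conj_family T B i x)"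
proof (induction i arbitrary: x)
  case (Suc i)
  show ?case
  proof (cases "i = Suc k")
    case True
    have "T (Suc k) (T k (conj_family T B k (T k (T (Suc k) (T k x))))) =
      T (Suc k) (T k (T (Suc k) (conj_family T B k (T k (T (Suc k) x)))))"
      using Suc.prems True conj_family_T_right[of B k "Suc k"] assms by (simp add: T_braid)
    also have "\<dots> = T k (T (Suc k) (T k (conj_family T B k (T k (T (Suc k) x)))))"
      using Suc.prems True by (simp add: T_braid)
    finally show ?thesis using True by simp
  next
    case False
    then have "Suc k < i" using Suc.prems by auto
    then show ?thesis using Suc.IH Suc.prems by (simp add: T_far[of k i, symmetric])
  qed
qed simp

text \<open>The relation \<open>braid (T 0) B\<close> gives the case of indices 0 and 1. Since
  \<open>B\<close> commutes with the later \<open>T k\<close>, it commutes with the whole family.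
  Then the smaller index is raised, because \<open>T i\<close> commutes with every member of index
  above \<open>Suc i\<close>.\<close>

lemma conj_family_commute:
  assumes BT: "\<And>k x. 1 \<le> k \<Longrightarrow> Suc k < N \<Longrightarrow> B (T k x) = T k (B x)"
    and B_lin: "1 < N \<Longrightarrow> braid (T 0) B"
    and "i < N" "j < N"
  shows "conj_family T B i (conj_family T B j x) = conj_family T B j (conj_family T B i x)"
proof -
  have 0: "B (conj_family T B j x) = conj_family T B j (B x)" if "j < N" for j x
    using that
  proof (induction j arbitrary: x)
    case (Suc j)
    show ?case
    proof (cases j)
      case 0 then show ?thesis using B_lin Suc.prems by (simp add: braid_def)
    next
      case (Suc m) then show ?thesis using Suc.IH Suc.prems BT[of j] by simp
    qed
  qed simp
  have less: "conj_family T B i (conj_family T B j x) = conj_family T B j (conj_family T B i x)"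
    if "i < j" "j < N" for i j x
    using that
  proof (induction i arbitrary: x)
    case (Suc i)
    then have "conj_family T B j (T i y) = T i (conj_family T B j y)" for y
      using conj_family_T_left[of B i j] BT by simp
    then show ?case using Suc.IH[of "T i x"] Suc.prems by (metis Suc_lessD conj_family.simps(2))
  qed (use 0 in simp)
  then show ?thesis using assms(3,4) less[of j i x] by (cases i j rule: linorder_cases) auto
qed

end

section \<open>The rotation \<open>pi\<close> and the inverse \<open>A\<close> of
  \<open>X_1\<close>\<close>

locale affine_braid_action = braid_action +
  fixes pi Y Y' :: "'a \<Rightarrow> 'a"
  assumes pi_T: "Suc (Suc k) < N \<Longrightarrow> pi (T k x) = T (Suc k) (pi x)"
    and pi_pi_T: "N = Suc (Suc M) \<Longrightarrow> pi (pi (T M x)) = T 0 (pi (pi x))"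
    and pi_Y: "1 < N \<Longrightarrow> pi (Y x) = Y' (pi x)"
    and T_Y_T: "1 < N \<Longrightarrow> T 0 (Y (T 0 x)) = Y' x"
    and Y_Y': "1 < N \<Longrightarrow> Y (Y' x) = Y' (Y x)"
    and T_Y: "1 \<le> k \<Longrightarrow> Suc k < N \<Longrightarrow> T k (Y x) = Y (T k x)"
begin

definition A :: "'a \<Rightarrow> 'a" where
  "A x = pi (chain Ti 0 (N - 1) x)"

text \<open>The chain carries the first strand past the others, which lowers their positions by one;
  \<open>pi\<close> raises them again, so that \<open>A\<close> commutes with \<open>T k\<close> for
  \<open>k \<ge> 1\<close>.\<close>

lemma chain_T: "Suc k < m \<Longrightarrow> m < N \<Longrightarrow> chain Ti 0 m (T (Suc k) x) = T k (chain Ti 0 m x)"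
proof (induction m)
  case (Suc m)
  show ?case
  proof (cases "m = Suc k")
    case True
    have "chain Ti 0 k (T (Suc k) x) = T (Suc k) (chain Ti 0 k x)"
      by (rule chain_commute) (use Suc True in \<open>auto intro: Ti_T_far\<close>)
    then show ?thesis using True Suc.prems by (simp add: Ti_Ti_T)
  next
    case False
    then show ?thesis using Suc by (simp add: Ti_T_far)
  qed
qed simp

lemma A_T: "1 \<le> k \<Longrightarrow> Suc k < N \<Longrightarrow> A (T k x) = T k (A x)"
  using chain_T[of "k - 1" "N - 1" x] by (simp add: A_def pi_T)

lemma chain_0_Suc: "Suc 0 < N \<Longrightarrow> chain Ti 0 (N - Suc 0) x = chain Ti (Suc 0) (N - 2) (Ti 0 x)"
  using chain_Suc_left[of Ti 0 "N - 2" x] by (simp add: Suc_diff_Suc numeral_2_eq_2)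

text \<open>On the left \<open>T 0 Y T 0\<close> is \<open>Y'\<close>, which passes
  \<open>pi\<close> and becomes \<open>Y\<close>. This commutes with all factors of the chain except
  \<open>Ti 0\<close>, and \<open>Ti 0\<close> is the factor that remains on the right.\<close>

lemma skew_Y_A: "1 < N \<Longrightarrow> skew (T 0) (Ti 0) Y A"
  unfolding skew_def
proof
  fix x assume N: "1 < N"
  have "chain Ti 1 (N - 2) (Y (Ti 0 x)) = Y (chain Ti 1 (N - 2) (Ti 0 x))"
    by (rule chain_commute) (auto intro!: Ti_commute T_Y)
  then show "T 0 (Y (T 0 (A x))) = A (T 0 (Y (Ti 0 x)))"
    using N by (simp add: A_def chain_0_Suc Ti_T pi_Y T_Y_T)
qed

lemma braid_Y: "1 < N \<Longrightarrow> braid (T 0) Y"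
  by (auto simp: braid_def T_Y_T Y_Y')

text \<open>The double chain moves two neighbouring strands together past \<open>m\<close> others,
  so their crossing slides from position \<open>0\<close> to position \<open>m\<close>. Combined
  with \<open>pi_pi_T\<close> this yields the braid relation for \<open>A\<close>.\<close>

lemma chain_chain_T:
  "Suc m < N \<Longrightarrow> chain Ti 0 m (chain Ti 1 m (T 0 x)) = T m (chain Ti 0 m (chain Ti 1 m x))"
proof (induction m)
  case (Suc m)
  have *: "chain Ti 0 (Suc m) (chain Ti 1 (Suc m) y) = Ti m (Ti (Suc m) (chain Ti 0 m (chain Ti 1 m y)))" for y
  proof -
    have "chain Ti 0 m (Ti (Suc m) z) = Ti (Suc m) (chain Ti 0 m z)" for z
      by (rule chain_commute) (use Suc.prems in \<open>auto intro: Ti_Ti_far\<close>)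
    then show ?thesis by simp
  qed
  show ?case unfolding * using Suc by (simp add: Ti_Ti_T')
qed simp

lemma pi_Ti: "Suc (Suc k) < N \<Longrightarrow> pi (Ti k x) = Ti (Suc k) (pi x)"
  by (metis T_Ti[of k x] Ti_T[of "Suc k" "pi (Ti k x)"] pi_T[of k "Ti k x"] Suc_lessD)

lemma pi_chain: "m + 1 < N \<Longrightarrow> pi (chain Ti 0 m x) = chain Ti 1 m (pi x)"
  by (induction m) (simp_all add: pi_Ti)

lemma braid_A:
  assumes N: "1 < N"
  shows "braid (T 0) A"
  unfolding braid_def
proof
  fix x
  define M where "M = N - 2"
  have M: "N = Suc (Suc M)" using N by (simp add: M_def)
  \<comment> \<open>Splitting off \<open>Ti 0\<close> leaves chains of length \<open>N - 2\<close>;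
    such a chain can be moved through \<open>pi\<close> without meeting the affine
    generator.\<close>
  have AT: "A (T 0 y) = pi (chain Ti 1 M y)" for y
    using N by (simp add: A_def chain_0_Suc Ti_T M_def)
  have AT': "A y = pi (chain Ti 1 M (Ti 0 y))" for y
    using N by (simp add: A_def chain_0_Suc M_def)
  have pp: "pi (chain Ti (Suc 0) M (pi y)) = pi (pi (chain Ti 0 M y))" for y
    using pi_chain[of M y] M by simp
  have "T 0 (A (T 0 (A x))) = T 0 (pi (pi (chain Ti 0 M (chain Ti 1 M (Ti 0 x)))))"
    by (simp add: AT AT'[of x] pp)
  also have "\<dots> = pi (pi (chain Ti 0 M (chain Ti 1 M x)))"
    using M chain_chain_T[of M "Ti 0 x"] pi_pi_T[OF M, symmetric] by (simp add: T_Ti)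
  also have "\<dots> = A (T 0 (A (T 0 x)))"
    by (simp add: AT pp)
  finally show "T 0 (A (T 0 (A x))) = A (T 0 (A (T 0 x)))" .
qed

lemma word_op_T: "1 \<le> k \<Longrightarrow> Suc k < N \<Longrightarrow> word_op Y A w (T k x) = T k (word_op Y A w x)"
  by (induction w) (auto simp: A_T T_Y)

theorem christoffel_family_commute:
  assumes "coprime n n'" "n \<ge> 1" "n' \<ge> 1" "i < N" "j < N"
  defines "B \<equiv> conj_family T (word_op Y A (christoffel n n'))"
  shows "B i (B j x) = B j (B i x)"
  unfolding B_def
proof (rule conj_family_commute)
  assume N: "1 < N"
  show "braid (T 0) (word_op Y A (christoffel n n'))"
    by (rule braid_christoffel[where si = "Ti 0"])
       (use assms N braid_Y braid_A skew_Y_A in \<open>auto simp: T_Ti Ti_T\<close>)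
qed (use assms in \<open>auto simp: word_op_T\<close>)

end

section \<open>Relations with the rotation\<close>

lemma T_lin_far:
  assumes n: "n \<ge> 1" and v: "v \<noteq> 0" and jk: "Suc j < k" and k: "Suc k < N" and f: "f \<in> tensor_space N"
  shows "T_lin n v j (T_lin n v k f) = T_lin n v k (T_lin n v j f)"
proof -
  define c where "c = v - inverse v"
  define Q where "Q f = T_lin n v j (T_lin n v k f) - T_lin n v k (T_lin n v j f)" for f
  have lin: "lin Q" unfolding Q_def[abs_def] by (intro lin_intros)
  have j: "Suc j < N" using jk k by simp
  note rules = T_lin_Y_left[OF n k] T_lin_Y_right[OF n k] T_lin_Y_left[OF n j] T_lin_Y_right[OF n j]
    T_lin_Y_far[OF n k, of j] T_lin_Y_far[OF n k, of "Suc j"] T_lin_Y_far[OF n j, of k] T_lin_Y_far[OF n j, of "Suc k"]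
    T_lin_tensor_space c_def[symmetric] T_Y_lin Y_pow_tensor_space
    tensor_space_add tensor_space_diff tensor_space_scal
  have YQ: "Q (Y_pow n k 1 f) = Y_pow n (Suc k) 1 (Q f)" "Q (Y_pow n (Suc k) 1 f) = Y_pow n k 1 (Q f)"
       "Q (Y_pow n j 1 f) = Y_pow n (Suc j) 1 (Q f)" "Q (Y_pow n (Suc j) 1 f) = Y_pow n j 1 (Q f)"
       if "f \<in> tensor_space N" for f
    unfolding Q_def using that jk by (simp_all add: rules)
  have "Q (e l) = 0" if l: "length l = N" for l
  proof (rule Y_reduce[OF n lin YQ(1) l], assumption)
    let ?l = "l[k := l ! k mod int n]"
    show "Q (e ?l) = 0"
    proof (rule Y_reduce[OF n lin YQ(2)], assumption)
      let ?m = "?l[Suc k := ?l ! Suc k mod int n]"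
      show "Q (e ?m) = 0"
      proof (rule Y_reduce[OF n lin YQ(3)], assumption)
        let ?p = "?m[j := ?m ! j mod int n]"
        show "Q (e ?p) = 0"
        proof (rule Y_reduce[OF n lin YQ(4)], assumption)
          define L where "L a b c d = l[k := a, Suc k := b, j := c, Suc j := d]" for a b c d
          have T: "T_lin n v k (e (L a b x y)) = scal (if a = b then v else 1) (e (L b a x y)) +
            (if a < b then scal c (e (L a b x y)) else 0)"
            if "0 \<le> a" "a < int n" "0 \<le> b" "b < int n" for a b x y
          proof -
            have "swap_index k (L a b x y) = L b a x y"
              using jk k l by (auto simp: L_def swap_index_def intro!: nth_equalityI simp: nth_list_update)
            then show ?thesis
              using that jk k l T_basis_reduced[OF n, where l = "L a b x y" and k = k] by (simp add: T_lin_e L_def c_def)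
          qed
          have T': "T_lin n v j (e (L x y a b)) = scal (if a = b then v else 1) (e (L x y b a)) +
            (if a < b then scal c (e (L x y a b)) else 0)"
            if "0 \<le> a" "a < int n" "0 \<le> b" "b < int n" for a b x y
          proof -
            have "swap_index j (L x y a b) = L x y b a"
              using jk k l by (auto simp: L_def swap_index_def intro!: nth_equalityI simp: nth_list_update)
            then show ?thesis
              using that jk k l T_basis_reduced[OF n, where l = "L x y a b" and k = j] by (simp add: T_lin_e L_def c_def)
          qed
          define a b x y where "a = l ! k mod int n" and "b = l ! Suc k mod int n"
            and "x = l ! j mod int n" and "y = l ! Suc j mod int n"
          have "0 \<le> a" "a < int n" "0 \<le> b" "b < int n" "0 \<le> x" "x < int n" "0 \<le> y" "y < int n"
            using n by (auto simp: a_def b_def x_def y_def)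
          then have "Q (e (L a b x y)) = 0"
            by (cases a b rule: linorder_cases; cases x y rule: linorder_cases)
              (auto simp: Q_def T T' T_Y_lin scal_scal scal_add_right intro!: poly_mapping_eqI simp: lookup_add lookup_minus algebra_simps)
          then show "Q (e (?p[Suc j := ?p ! Suc j mod int n])) = 0"
            using jk by (simp add: L_def a_def b_def x_def y_def)
        qed (use jk k l in auto)
      qed (use jk k l in auto)
    qed (use k l in auto)
  qed (use k in auto)
  then have "Q f = 0"
    by (intro lin_cong[OF lin _ _ f, where G = "\<lambda>_. 0"]) (auto simp: lin_def)
  then show ?thesis by (simp add: Q_def)
qed

section \<open>Closed form of the rotation and its relations\<close>

definition pi_coeff :: "nat \<Rightarrow> complex \<Rightarrow> (nat \<Rightarrow> complex) \<Rightarrow> int \<Rightarrow> complex" where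
  "pi_coeff n q u x = u (nat (x mod int n)) * q powi (x div int n)"

definition pi_lin :: "nat \<Rightarrow> nat \<Rightarrow> complex \<Rightarrow> (nat \<Rightarrow> complex) \<Rightarrow> vec \<Rightarrow> vec" where
  "pi_lin n n' q u = lin_ext (\<lambda>l. scal (pi_coeff n q u (last l)) (e ((last l - int n') # butlast l)))"

definition pi_inv :: "nat \<Rightarrow> nat \<Rightarrow> complex \<Rightarrow> (nat \<Rightarrow> complex) \<Rightarrow> vec \<Rightarrow> vec" where
  "pi_inv n n' q u =
     lin_ext (\<lambda>l. scal (inverse (pi_coeff n q u (hd l + int n'))) (e (tl l @ [hd l + int n'])))"

lemma op_prod_simps [simp]:
  "op_prod [] = id" "op_prod (F # Fs) = F \<circ> op_prod Fs" "op_prod (Fs @ Gs) = op_prod Fs \<circ> op_prod Gs"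
proof -
  show "op_prod [] = id" "op_prod (F # Fs) = F \<circ> op_prod Fs" for F Fs by (simp_all add: op_prod_def)
  then show "op_prod (Fs @ Gs) = op_prod Fs \<circ> op_prod Gs"
    by (induction Fs) (auto simp: comp_assoc)
qed

lemma lin_op_prod: "(\<And>F. F \<in> set Fs \<Longrightarrow> lin F) \<Longrightarrow> lin (op_prod Fs)"
  by (induction Fs) (auto intro!: lin_comp)

lemma lin_funpow: "lin F \<Longrightarrow> lin (F ^^ m)"
  by (induction m) (auto intro!: lin_comp)

lemma lin_pi_lin [simp, intro]: "lin (pi_lin n n' q u)" "lin (pi_inv n n' q u)"
  by (simp_all add: pi_lin_def pi_inv_def)

lemma cycle_e: "m < length l \<Longrightarrow>
  op_prod (map swap_factors [0..<m]) (e l) = e (l ! m # take m l @ drop (Suc m) l)"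
proof (induction m arbitrary: l)
  case 0 then show ?case by (cases l) auto
next
  case (Suc m)
  let ?l = "l[m := l ! Suc m, Suc m := l ! m]"
  have "?l ! m # take m ?l @ drop (Suc m) ?l = l ! Suc m # take (Suc m) l @ drop (Suc (Suc m)) l"
    using Suc.prems by (simp add: take_Suc_conv_app_nth Cons_nth_drop_Suc[of "Suc m" ?l, symmetric])
  then show ?case using Suc.IH[of ?l] Suc.prems by (simp add: swap_factors_def)
qed

lemma pi_op_eq:
  assumes "N \<ge> 1" "f \<in> tensor_space N"
  shows "pi_op n n' N q u f = pi_lin n n' q u f"
proof (rule lin_cong[OF _ _ _ assms(2)])
  show "lin (pi_op n n' N q u)"
    unfolding pi_op_def by (intro lin_comp lin_funpow lin_op_prod) (auto simp: kappa1_def D1_def swap_factors_def)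
  show "lin (pi_lin n n' q u)" by simp
  fix l :: "int list" assume l: "length l = N"
  have "(kappa1 ^^ m) (e (x # l)) = e ((x - int m) # l)" for m x l
    by (induction m) (auto simp: kappa1_def algebra_simps)
  moreover have "lin (kappa1 ^^ n')" by (intro lin_funpow) (simp add: kappa1_def)
  moreover have "l \<noteq> []" "N - 1 < length l" using l assms(1) by auto
  ultimately show "pi_op n n' N q u (e l) = pi_lin n n' q u (e l)"
    using l by (simp add: pi_op_def cycle_e D1_def pi_lin_def lin_scal pi_coeff_def last_conv_nth butlast_conv_take)
qed

lemma pi_lin_snoc: "pi_lin n n' q u (e (l @ [x])) = scal (pi_coeff n q u x) (e ((x - int n') # l))"
  by (simp add: pi_lin_def)

lemma pi_lin_tensor_space:
  assumes "N \<ge> 1" "f \<in> tensor_space N"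
  shows "pi_lin n n' q u f \<in> tensor_space N" "pi_inv n n' q u f \<in> tensor_space N"
  by (rule lin_tensor_space[OF _ _ assms(2)]; use assms(1) in
      \<open>auto simp: pi_lin_def pi_inv_def intro!: tensor_space_scal tensor_space_e\<close>)+

lemma lin_geom:
  assumes "lin F" "\<And>t. F (e (shift n k t l)) = scal c (e (shift n k' t l'))"
  shows "F (geom n k m l) = scal c (geom n k' m l')"
  by (simp add: geom_def lin_diff[OF assms(1)] lin_sum[OF assms(1)] assms(2) scal_sum scal_diff_right)

lemma pi_lin_T_lin:
  assumes "Suc (Suc k) < N" "f \<in> tensor_space N"
  shows "pi_lin n n' q u (T_lin n v k f) = T_lin n v (Suc k) (pi_lin n n' q u f)"
proof (rule lin_cong[of "pi_lin n n' q u \<circ> T_lin n v k" "T_lin n v (Suc k) \<circ> pi_lin n n' q u", OF _ _ _ assms(2), simplified])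
  show "lin (pi_lin n n' q u \<circ> T_lin n v k)" "lin (T_lin n v (Suc k) \<circ> pi_lin n n' q u)"
    by (auto intro!: lin_comp)
  fix l :: "int list" assume l: "length l = N"
  then obtain m x where m: "l = m @ [x]" "length m = N - 1"
    using assms(1) by (metis length_append_singleton length_butlast snoc_eq_iff_butlast zero_less_Suc length_0_conv not_less_zero)
  have k: "Suc k < length m" using assms(1) m by simp
  have sh: "shift n k t l = shift n k t m @ [x]" "shift n (Suc k) t (y # m) = y # shift n k t m" for t y
    using k by (simp_all add: m shift_def list_update_append1 nth_append)
  have sw: "swap_index k l = swap_index k m @ [x]" "swap_index (Suc k) (y # m) = y # swap_index k m" for y
    using k by (simp_all add: m swap_index_def list_update_append1 nth_append)
  have "pi_lin n n' q u (geom n k r l) = scal (pi_coeff n q u x) (geom n (Suc k) r ((x - int n') # m))" for r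
    by (rule lin_geom) (simp_all add: sh pi_lin_snoc)
  moreover have "l ! k = m ! k" "l ! Suc k = m ! Suc k" using k by (simp_all add: m nth_append)
  moreover have "pi_lin n n' q u (e l) = scal (pi_coeff n q u x) (e ((x - int n') # m))"
    by (simp add: m pi_lin_snoc)
  moreover have "pi_lin n n' q u (e (swap_index k l)) = scal (pi_coeff n q u x) (e (swap_index (Suc k) ((x - int n') # m)))"
    by (simp add: sw pi_lin_snoc)
  ultimately show "pi_lin n n' q u (T_lin n v k (e l)) = T_lin n v (Suc k) (pi_lin n n' q u (e l))"
    by (simp add: T_lin_e T_basis_def lin_add[OF lin_pi_lin(1)] lin_scal[OF lin_pi_lin(1)] T_Y_lin scal_add_right scal_scal mult.commute)
qed

lemma pi_lin_pi_lin_T_lin: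
  assumes "N = Suc (Suc M)" "f \<in> tensor_space N" "n \<ge> 1" "q \<noteq> 0"
  shows "pi_lin n n' q u (pi_lin n n' q u (T_lin n v M f)) = T_lin n v 0 (pi_lin n n' q u (pi_lin n n' q u f))"
proof (rule lin_cong[of "pi_lin n n' q u \<circ> (pi_lin n n' q u \<circ> T_lin n v M)" "T_lin n v 0 \<circ> (pi_lin n n' q u \<circ> pi_lin n n' q u)",
    OF _ _ _ assms(2), simplified])
  show "lin (pi_lin n n' q u \<circ> (pi_lin n n' q u \<circ> T_lin n v M))" "lin (T_lin n v 0 \<circ> (pi_lin n n' q u \<circ> pi_lin n n' q u))"
    by (auto intro!: lin_comp)
  fix l :: "int list" assume l: "length l = N"
  have "l = take M l @ [l ! M, l ! Suc M]"
    using l assms(1) by (metis append_take_drop_id Cons_nth_drop_Suc drop_eq_Nil lessI less_SucI order_refl)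
  then obtain m a b where m: "l = m @ [a, b]" "length m = M"
    using l assms(1) by (metis length_take less_SucI lessI min.absorb4)
  define C where "C = pi_coeff n q u a * pi_coeff n q u b"
  define l' where "l' = (a - int n') # (b - int n') # m"
  have PP: "pi_lin n n' q u (pi_lin n n' q u (e (m @ [x, y]))) =
      scal (pi_coeff n q u x * pi_coeff n q u y) (e ((x - int n') # (y - int n') # m))" for x y
    using pi_lin_snoc[of n n' q u "m @ [x]" y] pi_lin_snoc[of n n' q u "(y - int n') # m" x]
    by (simp add: lin_scal[OF lin_pi_lin(1)] scal_scal mult.commute)
  have lin: "lin (\<lambda>f. pi_lin n n' q u (pi_lin n n' q u f))" by (rule lin_compose) auto
  have "pi_lin n n' q u (pi_lin n n' q u (geom n M r l)) = scal C (geom n 0 r l')" for r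
  proof (rule lin_geom[OF lin])
    fix t
    \<comment> \<open>The shift keeps both residues and moves \<open>t\<close> from one exponent of
      \<open>q\<close> to the other, so the product of the two scalars is the same for all
      summands.\<close>
    have "pi_coeff n q u (a + int n * t) * pi_coeff n q u (b - int n * t) = C"
    proof -
      have "(b - int n * t) mod int n = b mod int n" "(b - int n * t) div int n = b div int n - t"
        using assms(3) mod_mult_self2[of b "int n" "- t"] div_mult_self2[of "int n" b "- t"] by auto
      then show ?thesis
        using assms(3,4) by (simp add: pi_coeff_def C_def power_int_add power_int_diff)
    qed
    moreover have "shift n M t l = m @ [a + int n * t, b - int n * t]"
      using m by (simp add: shift_def list_update_append nth_append)
    moreover have "shift n 0 t l' = (a + int n * t - int n') # (b - int n * t - int n') # m"
      by (simp add: shift_def l'_def)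
    ultimately show "pi_lin n n' q u (pi_lin n n' q u (e (shift n M t l))) = scal C (e (shift n 0 t l'))"
      by (simp add: PP)
  qed
  moreover have "swap_index M l = m @ [b, a]" "swap_index 0 l' = (b - int n') # (a - int n') # m"
    "l ! M = a" "l ! Suc M = b" "l' ! 0 = a - int n'" "l' ! Suc 0 = b - int n'"
    using m by (simp_all add: swap_index_def list_update_append nth_append l'_def)
  moreover have "pi_lin n n' q u (pi_lin n n' q u (e l)) = scal C (e l')"
    by (simp add: m PP C_def l'_def)
  ultimately show "pi_lin n n' q u (pi_lin n n' q u (T_lin n v M (e l))) = T_lin n v 0 (pi_lin n n' q u (pi_lin n n' q u (e l)))"
    by (simp add: T_lin_e T_basis_def lin_add[OF lin] lin_scal[OF lin] T_Y_lin scal_add_right scal_scal mult.commute PP)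
       (simp add: C_def mult.commute)
qed

lemma pi_lin_Y:
  assumes "1 < N" "f \<in> tensor_space N"
  shows "pi_lin n n' q u (Y_pow n 0 1 f) = Y_pow n 1 1 (pi_lin n n' q u f)"
  unfolding One_nat_def
proof (rule lin_cong[of "pi_lin n n' q u \<circ> Y_pow n 0 1" "Y_pow n (Suc 0) 1 \<circ> pi_lin n n' q u", OF _ _ _ assms(2), simplified])
  show "lin (pi_lin n n' q u \<circ> Y_pow n 0 1)" "lin (Y_pow n (Suc 0) 1 \<circ> pi_lin n n' q u)"
    by (auto intro!: lin_comp)
  fix l :: "int list" assume l: "length l = N"
  then obtain x m y where "l = x # m @ [y]"
    using assms(1) by (cases l; cases "tl l" rule: rev_cases) auto
  then show "pi_lin n n' q u (Y_pow n 0 1 (e l)) = Y_pow n (Suc 0) 1 (pi_lin n n' q u (e l))"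
    by (simp add: Y_pow_e pi_lin_def lin_scal)
qed

lemma pi_lin_inverse:
  assumes "N \<ge> 1" "f \<in> tensor_space N" "n \<ge> 1" "q \<noteq> 0" "\<forall>a<n. u a \<noteq> 0"
  shows "pi_lin n n' q u (pi_inv n n' q u f) = f" "pi_inv n n' q u (pi_lin n n' q u f) = f"
proof -
  have nz: "pi_coeff n q u x \<noteq> 0" for x
  proof -
    have "nat (x mod int n) < n" using assms(3) by (simp add: nat_less_iff)
    then show ?thesis using assms(4,5) by (simp add: pi_coeff_def)
  qed
  show "pi_lin n n' q u (pi_inv n n' q u f) = f"
  proof (rule lin_cong[of "pi_lin n n' q u \<circ> pi_inv n n' q u" id, OF _ _ _ assms(2), simplified])
    fix l :: "int list" assume "length l = N"
    then obtain x m where "l = x # m" using assms(1) by (cases l) auto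
    then show "pi_lin n n' q u (pi_inv n n' q u (e l)) = e l"
      using nz by (simp add: pi_inv_def lin_scal pi_lin_snoc scal_scal)
  qed (auto intro!: lin_comp)
  show "pi_inv n n' q u (pi_lin n n' q u f) = f"
  proof (rule lin_cong[of "pi_inv n n' q u \<circ> pi_lin n n' q u" id, OF _ _ _ assms(2), simplified])
    fix l :: "int list" assume "length l = N"
    then obtain x m where "l = m @ [x]" using assms(1) by (cases l rule: rev_cases) auto
    then show "pi_inv n n' q u (pi_lin n n' q u (e l)) = e l"
      using nz by (simp add: pi_inv_def lin_scal pi_lin_snoc scal_scal)
  qed (auto intro!: lin_comp)
qed

section \<open>Commutation of the family\<close>

text \<open>Extension by the identity: relations valid on \<open>S\<close> then hold on the whole
  type.\<close>

definition restr :: "'a set \<Rightarrow> ('a \<Rightarrow> 'a) \<Rightarrow> 'a \<Rightarrow> 'a" where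
  "restr S F x = (if x \<in> S then F x else x)"

lemma chain_restr:
  assumes "\<And>k y. a \<le> k \<Longrightarrow> k < a + m \<Longrightarrow> y \<in> S \<Longrightarrow> F k y \<in> S" "x \<in> S"
  shows "chain F a m x \<in> S \<and> chain (\<lambda>k. restr S (F k)) a m x = chain F a m x"
  using assms(1) by (induction m) (auto simp: restr_def assms(2))

lemma word_op_restr:
  assumes "\<And>y. y \<in> S \<Longrightarrow> F y \<in> S" "\<And>y. y \<in> S \<Longrightarrow> G y \<in> S" "\<And>y. y \<in> S \<Longrightarrow> F' y = F y"
    "\<And>y. y \<in> S \<Longrightarrow> G' y = G y" "x \<in> S"
  shows "word_op F G w x \<in> S \<and> word_op F' G' w x = word_op F G w x"
  by (induction w) (auto simp: assms)

lemma conj_family_restr: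
  assumes "\<And>k y. k < i \<Longrightarrow> y \<in> S \<Longrightarrow> F k y \<in> S" "\<And>y. y \<in> S \<Longrightarrow> B y \<in> S"
    "\<And>k y. k < i \<Longrightarrow> y \<in> S \<Longrightarrow> F' k y = F k y" "\<And>y. y \<in> S \<Longrightarrow> B' y = B y" "x \<in> S"
  shows "conj_family F B i x \<in> S \<and> conj_family F' B' i x = conj_family F B i x"
  using assms by (induction i arbitrary: x) auto

definition T_inv :: "nat \<Rightarrow> complex \<Rightarrow> nat \<Rightarrow> vec \<Rightarrow> vec" where
  "T_inv n v k f = T_lin n v k f - scal (v - inverse v) f"

lemma lin_T_inv [simp, intro]: "lin (T_inv n v k)"
  unfolding T_inv_def[abs_def] by (intro lin_intros)

lemma T_inv_tensor_space: "f \<in> tensor_space N \<Longrightarrow> T_inv n v k f \<in> tensor_space N"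
  by (simp add: T_inv_def tensor_space_diff tensor_space_scal T_lin_tensor_space)

lemma T_lin_T_inv:
  assumes "n \<ge> 1" "v \<noteq> 0" "Suc k < N" "f \<in> tensor_space N"
  shows "T_lin n v k (T_inv n v k f) = f" "T_inv n v k (T_lin n v k f) = f"
  using T_lin_quadratic[OF assms] by (simp_all add: T_inv_def T_Y_lin)

definition X_inv :: "nat \<Rightarrow> nat \<Rightarrow> nat \<Rightarrow> complex \<Rightarrow> complex \<Rightarrow> (nat \<Rightarrow> complex) \<Rightarrow> vec \<Rightarrow> vec" where
  "X_inv n n' N q v u f = pi_lin n n' q u (chain (T_inv n v) 0 (N - 1) f)"

definition B_lin :: "nat \<Rightarrow> nat \<Rightarrow> nat \<Rightarrow> complex \<Rightarrow> complex \<Rightarrow> (nat \<Rightarrow> complex) \<Rightarrow> nat \<Rightarrow> vec \<Rightarrow> vec" where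
  "B_lin n n' N q v u = conj_family (T_lin n v) (word_op (Y_pow n 0 1) (X_inv n n' N q v u) (christoffel n n'))"

section \<open>Instantiation of the braid relations and identification with the given
  operators\<close>

locale elliptic_rep =
  fixes n n' N :: nat and q v :: complex and u :: "nat \<Rightarrow> complex"
  assumes n: "n \<ge> 1" and n': "n' \<ge> 1" and coprime: "coprime n n'" and N: "N \<ge> 1"
    and q: "q \<noteq> 0" and v: "v \<noteq> 0" and u: "\<forall>a<n. u a \<noteq> 0"
begin

abbreviation "S \<equiv> tensor_space N"
abbreviation "X \<equiv> X_inv n n' N q v u"
abbreviation "P \<equiv> pi_lin n n' q u"
abbreviation "Tk \<equiv> T_lin n v"
abbreviation "Tk_inv \<equiv> T_inv n v"
abbreviation "Y \<equiv> \<lambda>i. Y_pow n i 1"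
abbreviation "W \<equiv> word_op (Y 0) X (christoffel n n')"
abbreviation "BBk \<equiv> B_lin n n' N q v u"

lemma chain_inv_S: "f \<in> S \<Longrightarrow> chain Tk_inv a m f \<in> S"
  by (induction m) (auto simp: T_inv_tensor_space)

lemma X_S: "f \<in> S \<Longrightarrow> X f \<in> S"
  using N by (simp add: X_inv_def pi_lin_tensor_space chain_inv_S)

sublocale affine_braid_action N "\<lambda>k. restr S (Tk k)" "\<lambda>k. restr S (Tk_inv k)"
  "restr S P" "restr S (Y 0)" "restr S (Y 1)"
proof
  note S = T_lin_tensor_space T_inv_tensor_space pi_lin_tensor_space[OF N] Y_pow_tensor_space
  note defs = restr_def T_lin_T_inv[OF n v] S
  fix k j M x
  show "Suc k < N \<Longrightarrow> restr S (Tk k) (restr S (Tk_inv k) x) = x"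
    "Suc k < N \<Longrightarrow> restr S (Tk_inv k) (restr S (Tk k) x) = x"
    by (cases "x \<in> S"; simp add: defs)+
  show "Suc (Suc k) < N \<Longrightarrow> restr S (Tk k) (restr S (Tk (Suc k)) (restr S (Tk k) x)) =
     restr S (Tk (Suc k)) (restr S (Tk k) (restr S (Tk (Suc k)) x))"
    by (cases "x \<in> S"; simp add: defs T_lin_braid[OF n v])
  show "Suc j < k \<Longrightarrow> Suc k < N \<Longrightarrow> restr S (Tk j) (restr S (Tk k) x) = restr S (Tk k) (restr S (Tk j) x)"
    by (cases "x \<in> S") (simp_all add: defs T_lin_far[OF n v, of j k])
  show "Suc (Suc k) < N \<Longrightarrow> restr S P (restr S (Tk k) x) = restr S (Tk (Suc k)) (restr S P x)"
    by (cases "x \<in> S"; simp add: defs pi_lin_T_lin)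
  show "N = Suc (Suc M) \<Longrightarrow> restr S P (restr S P (restr S (Tk M) x)) = restr S (Tk 0) (restr S P (restr S P x))"
    using pi_lin_pi_lin_T_lin[where N = N and M = M and f = x and n' = n' and u = u and v = v, OF _ _ n q] by (cases "x \<in> S"; simp add: defs pi_lin_tensor_space[of "Suc (Suc M)"])
  show "1 < N \<Longrightarrow> restr S P (restr S (Y 0) x) = restr S (Y 1) (restr S P x)"
    using pi_lin_Y[of N x n n' q u] by (cases "x \<in> S"; simp add: defs)
  show "1 < N \<Longrightarrow> restr S (Tk 0) (restr S (Y 0) (restr S (Tk 0) x)) = restr S (Y 1) x"
    by (cases "x \<in> S"; simp add: defs T_lin_Y_left[OF n] T_lin_quadratic[OF n v] T_Y_lin)
  show "1 < N \<Longrightarrow> restr S (Y 0) (restr S (Y 1) x) = restr S (Y 1) (restr S (Y 0) x)"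
    by (cases "x \<in> S"; simp add: defs Y_commute[of n 0])
  show "1 \<le> k \<Longrightarrow> Suc k < N \<Longrightarrow> restr S (Tk k) (restr S (Y 0) x) = restr S (Y 0) (restr S (Tk k) x)"
    by (cases "x \<in> S"; simp add: defs T_lin_Y_far[OF n])
qed

lemma A_eq: "f \<in> S \<Longrightarrow> A f = X f"
  using chain_restr[of 0 "N - 1" S Tk_inv f] chain_inv_S[of f 0 "N - 1"]
  by (simp add: A_def X_inv_def T_inv_tensor_space restr_def)

lemma W_eq: "f \<in> S \<Longrightarrow> W f \<in> S \<and> word_op (restr S (Y 0)) A (christoffel n n') f = W f"
  by (rule word_op_restr) (auto simp: A_eq X_S Y_pow_tensor_space restr_def)

lemma B_lin_eq:
  assumes "f \<in> S" "i < N"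
  shows "BBk i f \<in> S \<and> conj_family (\<lambda>k. restr S (Tk k)) (word_op (restr S (Y 0)) A (christoffel n n')) i f = BBk i f"
  unfolding B_lin_def
  by (rule conj_family_restr) (use assms W_eq in \<open>auto simp: T_lin_tensor_space restr_def\<close>)

lemma B_lin_commute: "f \<in> S \<Longrightarrow> i < N \<Longrightarrow> j < N \<Longrightarrow> BBk i (BBk j f) = BBk j (BBk i f)"
  using christoffel_family_commute[OF coprime n n', of i j f] B_lin_eq[of f] B_lin_eq[of "BBk i f"] B_lin_eq[of "BBk j f"]
  by auto

lemma chain_op_prod:
  "m < N \<Longrightarrow> f \<in> S \<Longrightarrow> op_prod (map (T_op n N v) [0..<m]) f \<in> S \<and>
    chain Tk_inv 0 m (op_prod (map (T_op n N v) [0..<m]) f) = f"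
proof (induction m arbitrary: f)
  case (Suc m)
  then have "T_op n N v m f = Tk m f" "Tk m f \<in> S" by (simp_all add: T_op_eq[OF n] T_lin_tensor_space)
  then show ?case using Suc by (simp add: T_lin_T_inv[OF n v])
qed simp

lemma op_prod_chain:
  "m < N \<Longrightarrow> f \<in> S \<Longrightarrow> op_prod (map (T_op n N v) [0..<m]) (chain Tk_inv 0 m f) = f"
proof (induction m)
  case (Suc m)
  have "T_op n N v m (Tk_inv m (chain Tk_inv 0 m f)) = chain Tk_inv 0 m f"
    using Suc.prems by (simp add: T_op_eq[OF n] T_lin_T_inv[OF n v] chain_inv_S T_inv_tensor_space)
  then show ?case using Suc by simp
qed simp

lemma inv_pi_op: "f \<in> S \<Longrightarrow> inv_into S (pi_op n n' N q u) f = pi_inv n n' q u f"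
  by (rule inv_into_f_eq[OF inj_on_inverseI[where g = "pi_inv n n' q u"]])
     (simp_all add: pi_op_eq[OF N] pi_lin_inverse[OF N _ n q u] pi_lin_tensor_space[OF N])

lemma X1_eq: "f \<in> S \<Longrightarrow> X1 n n' N q v u f = op_prod (map (T_op n N v) [0..<N - 1]) (pi_inv n n' q u f)"
  by (simp add: X1_def inv_pi_op)

lemma inv_X1: "f \<in> S \<Longrightarrow> inv_into S (X1 n n' N q v u) f = X f"
proof (rule inv_into_f_eq[OF inj_on_inverseI[where g = X]])
  fix f assume "f \<in> S"
  then show "X (X1 n n' N q v u f) = f"
    using N chain_op_prod[of "N - 1" "pi_inv n n' q u f"]
    by (simp add: X1_eq X_inv_def pi_lin_tensor_space[OF N] pi_lin_inverse[OF N _ n q u])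
next
  assume f: "f \<in> S"
  then show "X f \<in> S" by (rule X_S)
  then show "X1 n n' N q v u (X f) = f"
    using N f op_prod_chain[of "N - 1" f] chain_inv_S[of f 0 "N - 1"]
    by (simp add: X1_eq X_inv_def pi_lin_inverse[OF N _ n q u])
qed

text \<open>With \<open>j = Suc i\<close> and \<open>x\<close> the remainder of \<open>i n\<close>,
  the floor jumps exactly when \<open>x + n\<close> reaches \<open>n + n'\<close>, that is, when the
  rotation wraps around and the next remainder falls below \<open>n\<close>.\<close>

lemma Z_op_eq:
  assumes "1 \<le> j" "f \<in> S"
  shows "Z_op n n' N q v u j f = (if j * n mod (n + n') < n then X f else Y 0 f)"
proof -
  obtain i where j: "j = Suc i" using assms(1) by (cases j) auto
  define x where "x = i * n mod (n + n')"
  define d where "d = i * n div (n + n')"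
  have x: "x < n + n'" using n by (simp add: x_def)
  have "j * n = d * (n + n') + (x + n)"
    using div_mult_mod_eq[of "i * n" "n + n'"] by (simp add: j x_def d_def)
  then have "j * n div (n + n') = d + (x + n) div (n + n')" using n by simp
  also have "(x + n) div (n + n') = (if x < n' then 0 else 1)"
    using x by (auto simp: div_if)
  finally have "j * n div (n + n') = (j - 1) * n div (n + n') \<longleftrightarrow> x < n'" by (simp add: j d_def)
  moreover have "j * n mod (n + n') < n \<longleftrightarrow> \<not> x < n'"
    using x unfolding j rotation_step[OF n n'] x_def[symmetric] by auto
  ultimately show ?thesis using assms(2) by (simp add: Z_op_def inv_X1)
qed

lemma B1_eq:
  assumes "f \<in> S"
  shows "B1 n n' N q v u f = W f"
proof -
  have "op_prod (map (Z_op n n' N q v u) js) f =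
      word_op (Y 0) X (map (\<lambda>j. j * n mod (n + n') < n) js) f \<and>
      word_op (Y 0) X (map (\<lambda>j. j * n mod (n + n') < n) js) f \<in> S" if "\<forall>j\<in>set js. 1 \<le> j" for js
    using that by (induction js) (auto simp: Z_op_eq assms X_S Y_pow_tensor_space)
  from this[of "[1..<n + n' + 1]"] show ?thesis
    by (simp add: B1_def christoffel_def del: upt_Suc)
qed

lemma B_op_eq: "i < N \<Longrightarrow> f \<in> S \<Longrightarrow> B_op n n' N q v u i f = BBk i f"
proof (induction i arbitrary: f)
  case 0 then show ?case by (simp add: B_op_def B_lin_def B1_eq)
next
  case (Suc i)
  have "B_op n n' N q v u (Suc i) f = T_op n N v i (B_op n n' N q v u i (T_op n N v i f))"
    by (simp add: B_op_def)
  also have "\<dots> = Tk i (BBk i (Tk i f))"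
    using Suc B_lin_eq[of "Tk i f" i] by (simp add: T_op_eq[OF n] T_lin_tensor_space)
  finally show ?case by (simp add: B_lin_def)
qed

end

section \<open>Dominance order\<close>

definition psum :: "int list \<Rightarrow> nat \<Rightarrow> int" where
  "psum l j = (\<Sum>i<j. l ! i)"

lemma psum_Suc: "psum l (Suc j) = psum l j + l ! j"
  by (simp add: psum_def)

lemma sum_simple_root:
  assumes "j < N"
  shows "(\<Sum>i<N - 1. int (k i) * simple_root i j) =
      (if Suc j < N then int (k j) else 0) - (if 0 < j then int (k (j - 1)) else 0)"
proof -
  have "(\<Sum>i<N - 1. int (k i) * simple_root i j) =
     (\<Sum>i<N - 1. (if i = j then int (k i) else 0) - (if 0 < j \<and> i = j - 1 then int (k i) else 0))"
    by (rule sum.cong) (auto simp: simple_root_def)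
  also have "\<dots> = (\<Sum>i<N - 1. if i = j then int (k i) else 0)
      - (\<Sum>i<N - 1. if 0 < j \<and> i = j - 1 then int (k i) else 0)"
    by (rule sum_subtractf)
  also have "(\<Sum>i<N - 1. if 0 < j \<and> i = j - 1 then int (k i) else 0) =
      (if 0 < j then int (k (j - 1)) else 0)"
    using assms by (cases "0 < j") auto
  finally show ?thesis using assms by auto
qed

text \<open>The coefficient of the \<open>i\<close>-th simple root is the difference of the partial
  sums at \<open>Suc i\<close>; this reads off both directions.\<close>

lemma dom_le_iff_psum:
  "dom_le N l m \<longleftrightarrow> length l = N \<and> length m = N \<and> (\<forall>j\<le>N. psum l j \<le> psum m j) \<and> psum l N = psum m N"
proof (intro iffI conjI)
  assume d: "dom_le N l m"
  show "length l = N" "length m = N" using d by (auto simp: dom_le_def weights_def)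
  obtain k :: "nat \<Rightarrow> nat" where "\<forall>j<N. m ! j - l ! j = (\<Sum>i<N - 1. int (k i) * simple_root i j)"
    using d by (auto simp: dom_le_def)
  then have k: "m ! j - l ! j = (if Suc j < N then int (k j) else 0) - (if 0 < j then int (k (j - 1)) else 0)"
    if "j < N" for j
    using that sum_simple_root by simp
  have *: "psum m j - psum l j = (if 0 < j \<and> j < N then int (k (j - 1)) else 0)" if "j \<le> N" for j
    using that
  proof (induction j)
    case (Suc j)
    then show ?case using k[of j] by (auto simp: psum_Suc split: if_splits)
  qed (simp add: psum_def)
  show "\<forall>j\<le>N. psum l j \<le> psum m j"
  proof (intro allI impI)
    fix j assume "j \<le> N"
    from *[OF this] show "psum l j \<le> psum m j" by (simp split: if_splits)
  qed
  show "psum l N = psum m N" using *[of N] by simp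
next
  assume a: "length l = N \<and> length m = N \<and> (\<forall>j\<le>N. psum l j \<le> psum m j) \<and> psum l N = psum m N"
  define k where "k i = nat (psum m (Suc i) - psum l (Suc i))" for i
  have k: "int (k i) = psum m (Suc i) - psum l (Suc i)" if "i < N" for i
    using a that by (simp add: k_def)
  have "m ! j - l ! j = (\<Sum>i<N - 1. int (k i) * simple_root i j)" if j: "j < N" for j
  proof -
    have "(if Suc j < N then int (k j) else 0) = psum m (Suc j) - psum l (Suc j)"
      using a j k[of j] by (cases "Suc j = N") auto
    moreover have "(if 0 < j then int (k (j - 1)) else 0) = psum m j - psum l j"
      using j k[of "j - 1"] by (cases j) (auto simp: psum_def)
    ultimately show ?thesis unfolding sum_simple_root[OF j] by (simp add: psum_Suc)
  qed
  then show "dom_le N l m" using a by (auto simp: dom_le_def weights_def)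
qed

lemma dom_le_trans: "dom_le N l m \<Longrightarrow> dom_le N m p \<Longrightarrow> dom_le N l p"
  unfolding dom_le_iff_psum by (auto intro: order_trans)

lemma dom_le_antisym:
  assumes "dom_le N l m" "dom_le N m l"
  shows "l = m"
proof (rule nth_equalityI)
  show "length l = length m" using assms by (simp add: dom_le_iff_psum)
  fix j assume "j < length l"
  then have "psum l j = psum m j" "psum l (Suc j) = psum m (Suc j)"
    using assms by (auto simp: dom_le_iff_psum intro!: antisym)
  then show "l ! j = m ! j" by (simp add: psum_Suc)
qed

lemma dom_less_trans: "dom_less N l m \<Longrightarrow> dom_less N m p \<Longrightarrow> dom_less N l p"
  unfolding dom_less_def using dom_le_trans dom_le_antisym by metis

lemma prec_trans: "prec N l m \<Longrightarrow> prec N m p \<Longrightarrow> prec N l p"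
  unfolding prec_def using dom_less_trans by metis

lemma prec_irrefl: "\<not> prec N l l"
  by (simp add: prec_def dom_less_def)

lemma prec_length: "prec N l m \<Longrightarrow> length l = N \<and> length m = N"
  by (auto simp: prec_def dom_less_def dom_le_def weights_def plus_part_def)

lemma psum_list_update:
  "i < length l \<Longrightarrow> k \<le> length l \<Longrightarrow> psum (l[i := x]) k = psum l k + (if i < k then x - l ! i else 0)"
  by (induction k) (auto simp: psum_Suc psum_def nth_list_update)

lemma mset_plus_part: "mset (plus_part l) = mset l"
  by (simp add: plus_part_def)

lemma plus_part_cong: "mset l = mset m \<Longrightarrow> plus_part l = plus_part m"
  using properties_for_sort[of "sort m" l] by (simp add: plus_part_def)

lemma prec_swap:
  assumes "i < j" "j < length m" "m ! j < m ! i" "length m = N"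
  shows "prec N (m[i := m ! j, j := m ! i]) m"
proof -
  let ?l = "m[i := m ! j, j := m ! i]"
  have "plus_part ?l = plus_part m"
    using assms by (intro plus_part_cong mset_swap) auto
  moreover have "psum ?l k \<le> psum m k" if "k \<le> N" for k
    using assms that by (auto simp: psum_list_update)
  moreover have "psum ?l N = psum m N"
    using assms by (auto simp: psum_list_update)
  moreover have "?l \<noteq> m"
  proof
    assume "?l = m"
    then have "?l ! i = m ! i" by (rule arg_cong)
    then show False using assms by simp
  qed
  ultimately show ?thesis
    using assms by (simp add: prec_def dom_less_def dom_le_iff_psum)
qed

section \<open>Partial sums of the dominant rearrangement as maxima over subsets\<close>

lemma sum_le_sum_initial:
  fixes d :: "nat \<Rightarrow> int"
  assumes "finite X" "X \<subseteq> {..<N}" and dec: "\<And>i j. i \<le> j \<Longrightarrow> j < N \<Longrightarrow> d j \<le> d i"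
  shows "sum d X \<le> (\<Sum>i<card X. d i)"
  using assms(1,2)
proof (induction rule: finite_linorder_max_induct)
  case (insert t X)
  have "X \<subseteq> {..<t}" using insert by auto
  then have "card X \<le> t" using card_mono[of "{..<t}" X] by simp
  then have "d t \<le> d (card X)" using dec insert.prems by auto
  moreover have "t \<notin> X" using insert by auto
  ultimately show ?case using insert by simp
qed simp

lemma plus_part_bij:
  obtains f where "bij_betw f {..<length l} {..<length l}" "\<And>i. i < length l \<Longrightarrow> plus_part l ! i = l ! f i"
proof -
  have "length (plus_part l) = length l" by (simp add: plus_part_def)
  then show thesis
    using permutation_Ex_bij[OF mset_plus_part[of l]] that by auto
qed

lemma sum_le_psum_plus_part:
  assumes "X \<subseteq> {..<length l}"
  shows "(\<Sum>i\<in>X. l ! i) \<le> psum (plus_part l) (card X)"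
proof -
  obtain f where f: "bij_betw f {..<length l} {..<length l}"
    "\<And>i. i < length l \<Longrightarrow> plus_part l ! i = l ! f i" using plus_part_bij[of l] by blast
  define Z where "Z = {i. i < length l \<and> f i \<in> X}"
  have "bij_betw f Z X"
  proof (rule bij_betw_imageI)
    show "inj_on f Z" using f(1) by (auto simp: Z_def bij_betw_def intro: inj_on_subset)
    have "X \<subseteq> f ` {..<length l}" using assms f(1) by (simp add: bij_betw_def)
    then show "f ` Z = X" by (auto simp: Z_def)
  qed
  then have card: "card Z = card X" and "(\<Sum>i\<in>X. l ! i) = (\<Sum>i\<in>Z. l ! f i)"
    by (auto simp: sum.reindex_bij_betw bij_betw_same_card)
  note this(2)
  also have "(\<Sum>i\<in>Z. l ! f i) = (\<Sum>i\<in>Z. plus_part l ! i)"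
    by (rule sum.cong) (auto simp: Z_def f)
  also have "\<dots> \<le> (\<Sum>i<card Z. plus_part l ! i)"
    by (rule sum_le_sum_initial[of _ "length l"])
       (auto simp: Z_def plus_part_def intro!: sorted_rev_nth_mono)
  finally show ?thesis using card by (simp add: psum_def)
qed

lemma psum_plus_part_attained:
  assumes "j \<le> length l"
  obtains X where "X \<subseteq> {..<length l}" "card X = j" "psum (plus_part l) j = (\<Sum>i\<in>X. l ! i)"
proof -
  obtain f where f: "bij_betw f {..<length l} {..<length l}"
    "\<And>i. i < length l \<Longrightarrow> plus_part l ! i = l ! f i" using plus_part_bij[of l] by blast
  have "inj_on f {..<j}" using f(1) assms by (auto simp: bij_betw_def intro: inj_on_subset)
  then have "card (f ` {..<j}) = j" "(\<Sum>i\<in>f ` {..<j}. l ! i) = (\<Sum>i<j. l ! f i)"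
    by (auto simp: card_image sum.reindex)
  moreover have "psum (plus_part l) j = (\<Sum>i<j. l ! f i)"
    unfolding psum_def using assms by (intro sum.cong) (auto simp: f)
  moreover have "f ` {..<j} \<subseteq> {..<length l}" using f(1) assms by (auto simp: bij_betw_def)
  ultimately show thesis using that by metis
qed

lemma psum_total: "length l = N \<Longrightarrow> psum l N = sum_list l"
  by (simp add: psum_def sum_list_sum_nth atLeast0LessThan)

text \<open>A transfer between two entries that keeps their sum and moves both strictly inward makes
  the weight smaller in majorization order. The positions are irrelevant, since partial sums of
  \<open>plus_part\<close> are the largest sums over subsets of given size.\<close>

lemma prec_transfer:
  assumes len: "length m = N" and ij: "i < N" "j < N" "i \<noteq> j"
    and sum: "a + b = m ! i + m ! j" and less: "m ! i < a" "a < m ! j"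
  shows "prec N (m[i := a, j := b]) m"
proof -
  let ?l = "m[i := a, j := b]"
  have nth: "?l ! i = a" "?l ! j = b" "k \<noteq> i \<Longrightarrow> k \<noteq> j \<Longrightarrow> ?l ! k = m ! k" for k
    using len ij by auto
  have b: "b < m ! j" using sum less by simp
  have "psum (plus_part ?l) k \<le> psum (plus_part m) k" if "k \<le> N" for k
  proof -
    have "k \<le> length ?l" using that len by simp
    then obtain X where X: "X \<subseteq> {..<length ?l}" "card X = k" "psum (plus_part ?l) k = (\<Sum>t\<in>X. ?l ! t)"
      by (rule psum_plus_part_attained)
    have X': "X \<subseteq> {..<length m}" "finite X" using X(1) by (auto intro: finite_subset)
    have bound: "(\<Sum>t\<in>X'. m ! t) \<le> psum (plus_part m) k" if "X' \<subseteq> {..<length m}" "card X' = k" for X'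
      using sum_le_psum_plus_part[OF that(1)] that(2) by simp
    have rest: "(\<Sum>t\<in>X - {i, j}. ?l ! t) = (\<Sum>t\<in>X - {i, j}. m ! t)"
      by (rule sum.cong) auto
    have split: "(\<Sum>t\<in>X. f t) = (\<Sum>t\<in>X - {i, j}. f t) + (if i \<in> X then f i else 0) + (if j \<in> X then f j else 0)"
      for f :: "nat \<Rightarrow> int"
    proof -
      have "sum f X = sum f (X - {i, j}) + sum f (X \<inter> {i, j})"
        using sum.Int_Diff[OF X'(2), of f "{i, j}"] by simp
      also have "sum f (X \<inter> {i, j}) = (if i \<in> X then f i else 0) + (if j \<in> X then f j else 0)"
        using ij(3) by (cases "i \<in> X"; cases "j \<in> X") auto
      finally show ?thesis by simp
    qed
    show ?thesis
    proof (cases "i \<in> X \<longleftrightarrow> j \<in> X")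
      case True
      then have "(\<Sum>t\<in>X. ?l ! t) = (\<Sum>t\<in>X. m ! t)"
        unfolding split[of "\<lambda>t. ?l ! t"] split[of "\<lambda>t. m ! t"] rest nth using sum by simp
      then show ?thesis using bound[OF X'(1)] X by simp
    next
      case False
      \<comment> \<open>Only one of the two positions lies in the maximizing set. The set of the
        same size that uses the larger old entry \<open>m ! j\<close> dominates in either case, as
        \<open>a\<close> and \<open>b\<close> are both below \<open>m ! j\<close>.\<close>
      define X2 where "X2 = insert j (X - {i, j})"
      have "card X2 = k"
      proof (cases "i \<in> X")
        case True
        then have "X2 = insert j (X - {i})" "j \<notin> X" using False by (auto simp: X2_def)
        moreover have "card X > 0" using True X'(2) by (auto simp: card_gt_0_iff)
        ultimately show ?thesis using True X'(2) X(2) ij(3) by simp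
      next
        case i: False
        then have "X2 = X" using False by (auto simp: X2_def)
        then show ?thesis using X(2) by simp
      qed
      moreover have "X2 \<subseteq> {..<length m}" using X' ij len by (auto simp: X2_def)
      ultimately have "(\<Sum>t\<in>X2. m ! t) \<le> psum (plus_part m) k" by (intro bound)
      moreover have "(\<Sum>t\<in>X2. m ! t) = (\<Sum>t\<in>X - {i, j}. m ! t) + m ! j"
        using X'(2) by (simp add: X2_def)
      moreover have "(\<Sum>t\<in>X. ?l ! t) \<le> (\<Sum>t\<in>X - {i, j}. m ! t) + m ! j"
        unfolding split[of "\<lambda>t. ?l ! t"] rest nth using False less b by auto
      ultimately show ?thesis using X(3) by simp
    qed
  qed
  moreover have "psum (plus_part ?l) N = psum (plus_part m) N"
  proof -
    have "psum (plus_part l) N = psum l N" if "length l = N" for l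
    proof -
      have "psum (plus_part l) N = sum_list (plus_part l)"
        using that by (intro psum_total) (simp add: plus_part_def)
      also have "\<dots> = sum_list l" by (simp only: sum_mset_sum_list[symmetric] mset_plus_part)
      finally show ?thesis using psum_total[OF that] by simp
    qed
    then show ?thesis using len ij sum by (simp add: psum_list_update)
  qed
  moreover have "plus_part ?l \<noteq> plus_part m"
  proof
    assume "plus_part ?l = plus_part m"
    then have "mset (plus_part ?l) = mset (plus_part m)" by (rule arg_cong)
    then have "mset ?l = mset m" by (simp only: mset_plus_part)
    \<comment> \<open>The sum of squares detects strictness: it changes by a nonzero multiple of
      \<open>(a - m ! i) (m ! j - a)\<close>.\<close>
    then have "sum_mset (image_mset (\<lambda>x. x * x) (mset ?l)) = sum_mset (image_mset (\<lambda>x. x * x) (mset m))"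
      by (rule arg_cong)
    then have "sum_list (map (\<lambda>x. x * x) ?l) = sum_list (map (\<lambda>x. x * x) m)"
      by (simp only: mset_map[symmetric] sum_mset_sum_list)
    then have "psum (map (\<lambda>x. x * x) ?l) N = psum (map (\<lambda>x. x * x) m) N"
      using len by (simp add: psum_total)
    then have "a * a + b * b = m ! i * m ! i + m ! j * m ! j"
      using len ij by (simp add: map_update psum_list_update)
    moreover have b_eq: "b = m ! i + m ! j - a" using sum by simp
    ultimately have "(a - m ! i) * (m ! j - a) = 0" unfolding b_eq by (simp add: algebra_simps)
    then show False using less by simp
  qed
  ultimately show ?thesis
    using len by (auto simp: prec_def dom_less_def dom_le_iff_psum plus_part_def)
qed

section \<open>Triangular operators\<close>

definition lower :: "nat \<Rightarrow> (int list \<Rightarrow> int list) \<Rightarrow> int list \<Rightarrow> vec set" where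
  "lower N \<phi> l = {f. Poly_Mapping.keys f \<subseteq> \<phi> ` {m. prec N m l}}"

lemma lower_zero [simp]: "0 \<in> lower N \<phi> l"
  by (simp add: lower_def)

lemma lower_add: "f \<in> lower N \<phi> l \<Longrightarrow> g \<in> lower N \<phi> l \<Longrightarrow> f + g \<in> lower N \<phi> l"
  using Poly_Mapping.keys_add[of f g] unfolding lower_def by blast

lemma lower_scal: "f \<in> lower N \<phi> l \<Longrightarrow> scal c f \<in> lower N \<phi> l"
  by (auto simp: lower_def subset_iff in_keys_iff)

lemma lower_sum: "(\<And>x. x \<in> I \<Longrightarrow> f x \<in> lower N \<phi> l) \<Longrightarrow> (\<Sum>x\<in>I. f x) \<in> lower N \<phi> l"
  by (induction I rule: infinite_finite_induct) (auto intro: lower_add)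

lemma lower_e: "prec N m l \<Longrightarrow> e (\<phi> m) \<in> lower N \<phi> l"
  by (auto simp: lower_def e_def)

lemma lower_mono: "prec N m l \<Longrightarrow> f \<in> lower N \<phi> m \<Longrightarrow> f \<in> lower N \<phi> l"
  using prec_trans unfolding lower_def by blast

text \<open>Domain and codomain carry their own labellings \<open>\<phi>\<close> and
  \<open>\<psi>\<close> of basis vectors by weights. Such operators compose with multiplied
  diagonals, and only the total product has to return to the identity labelling.\<close>

definition triangular ::
  "nat \<Rightarrow> (int list \<Rightarrow> int list) \<Rightarrow> (int list \<Rightarrow> int list) \<Rightarrow> (int list \<Rightarrow> complex) \<Rightarrow> (vec \<Rightarrow> vec) \<Rightarrow> bool" where
  "triangular N \<phi> \<psi> c F \<longleftrightarrow> (\<forall>l\<in>weights N. F (e (\<phi> l)) - scal (c l) (e (\<psi> l)) \<in> lower N \<psi> l)"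

lemma triangular_lower:
  assumes "triangular N \<phi> \<psi> c F" "lin F" "f \<in> lower N \<phi> l"
  shows "F f \<in> lower N \<psi> l"
proof -
  have "F f = F (\<Sum>m\<in>Poly_Mapping.keys f. scal (Poly_Mapping.lookup f m) (e m))"
    using vec_decomp[of f] by simp
  also have "\<dots> = (\<Sum>m\<in>Poly_Mapping.keys f. scal (Poly_Mapping.lookup f m) (F (e m)))"
    by (simp add: lin_sum[OF assms(2)] lin_scal[OF assms(2)])
  also have "\<dots> \<in> lower N \<psi> l"
  proof (intro lower_sum lower_scal)
    fix m assume "m \<in> Poly_Mapping.keys f"
    then obtain p where p: "m = \<phi> p" "prec N p l" using assms(3) by (auto simp: lower_def)
    then have "p \<in> weights N" using prec_length by (simp add: weights_def)
    then have "F (e m) - scal (c p) (e (\<psi> p)) \<in> lower N \<psi> l"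
      using assms(1) p lower_mono unfolding triangular_def by blast
    moreover have "scal (c p) (e (\<psi> p)) \<in> lower N \<psi> l"
      using p by (intro lower_scal lower_e)
    ultimately have "F (e m) - scal (c p) (e (\<psi> p)) + scal (c p) (e (\<psi> p)) \<in> lower N \<psi> l"
      by (rule lower_add)
    then show "F (e m) \<in> lower N \<psi> l" by simp
  qed
  finally show ?thesis .
qed

lemma triangular_comp:
  assumes F: "triangular N \<phi> \<psi> c F" and G: "triangular N \<psi> \<chi> d G" "lin G"
  shows "triangular N \<phi> \<chi> (\<lambda>l. d l * c l) (\<lambda>f. G (F f))"
  unfolding triangular_def
proof
  fix l assume l: "l \<in> weights N"
  define r where "r = F (e (\<phi> l)) - scal (c l) (e (\<psi> l))"
  have "G r \<in> lower N \<chi> l"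
    using triangular_lower[OF G] F l by (simp add: triangular_def r_def)
  moreover have "scal (c l) (G (e (\<psi> l)) - scal (d l) (e (\<chi> l))) \<in> lower N \<chi> l"
    using G(1) l by (auto simp: triangular_def intro: lower_scal)
  ultimately have "G r + scal (c l) (G (e (\<psi> l)) - scal (d l) (e (\<chi> l))) \<in> lower N \<chi> l"
    by (rule lower_add)
  moreover have "G (F (e (\<phi> l))) = G r + scal (c l) (G (e (\<psi> l)))"
    by (simp add: r_def lin_diff[OF G(2)] lin_scal[OF G(2)])
  ultimately show "G (F (e (\<phi> l))) - scal (d l * c l) (e (\<chi> l)) \<in> lower N \<chi> l"
    by (simp add: scal_diff_right scal_scal mult.commute add_diff_eq)
qed

lemma triangular_id: "triangular N \<phi> \<phi> (\<lambda>_. 1) (\<lambda>f. f)"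
  by (simp add: triangular_def)

lemma triangular_cong:
  assumes "triangular N \<phi> \<psi> c F" "\<And>l. l \<in> weights N \<Longrightarrow> \<phi> l = \<phi>' l" "\<And>l. l \<in> weights N \<Longrightarrow> \<psi> l = \<psi>' l"
    "\<And>l. l \<in> weights N \<Longrightarrow> c l = c' l" "\<And>l. l \<in> weights N \<Longrightarrow> F (e (\<phi> l)) = F' (e (\<phi> l))"
  shows "triangular N \<phi>' \<psi>' c' F'"
  unfolding triangular_def
proof
  fix l assume l: "l \<in> weights N"
  have "\<psi> ` {m. prec N m l} = \<psi>' ` {m. prec N m l}"
    using assms(3) prec_length by (intro image_cong) (auto simp: weights_def)
  then have "lower N \<psi> l = lower N \<psi>' l" by (simp add: lower_def)
  moreover have "F (e (\<phi> l)) - scal (c l) (e (\<psi> l)) \<in> lower N \<psi> l"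
    using assms(1) l by (simp add: triangular_def)
  moreover have "F' (e (\<phi>' l)) = F (e (\<phi> l))"
    using assms(2,5)[OF l] by simp
  ultimately show "F' (e (\<phi>' l)) - scal (c' l) (e (\<psi>' l)) \<in> lower N \<psi>' l"
    using assms(3,4)[OF l] by simp
qed

section \<open>Moving one entry through the list\<close>

text \<open>\<open>carry h k r \<mu>\<close> is \<open>\<mu>\<close> with its entry number \<open>h\<close> lowered by \<open>r\<close> and moved to position \<open>k\<close>. The
  individual factors of the commuting operators are triangular only when the intermediate basis vectors
  are labelled in this way: the deficit \<open>r\<close> vanishes again after the last factor.\<close>

definition other :: "nat \<Rightarrow> nat \<Rightarrow> nat" where
  "other h k = (if k < h then k else Suc k)"

definition carry :: "nat \<Rightarrow> nat \<Rightarrow> nat \<Rightarrow> int list \<Rightarrow> int list" where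
  "carry h k r m = map (\<lambda>i. if i < k then m ! other h i else if i = k then m ! h - int r
     else m ! other h (i - 1)) [0..<length m]"

lemma length_carry [simp]: "length (carry h k r m) = length m"
  by (simp add: carry_def)

lemma nth_carry: "i < length m \<Longrightarrow> carry h k r m ! i =
  (if i < k then m ! other h i else if i = k then m ! h - int r else m ! other h (i - 1))"
  by (simp add: carry_def)

lemma carry_self: "h < length m \<Longrightarrow> carry h h 0 m = m"
  by (intro nth_equalityI) (auto simp: nth_carry other_def)

text \<open>A change at the positions \<open>k\<close> and \<open>Suc k\<close> is read in the
  labels of the next stage: position \<open>k\<close> now shows the entry \<open>other h k\<close>
  that has been passed, and position \<open>Suc k\<close> the carried entry, to which the deficit is
  added back.\<close>

lemma carry_update:
  assumes "h < length m" "Suc k < length m"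
  shows "(carry h k r m)[k := a, Suc k := b] = carry h (Suc k) r (m[other h k := a, h := b + int r])"
proof (rule nth_equalityI)
  fix i assume "i < length ((carry h k r m)[k := a, Suc k := b])"
  then have i: "i < length m" by simp
  have o: "other h k < length m" "other h k \<noteq> h" using assms by (auto simp: other_def)
  consider "i < k" | "i = k" | "i = Suc k" | "i > Suc k" by linarith
  then show "(carry h k r m)[k := a, Suc k := b] ! i =
      carry h (Suc k) r (m[other h k := a, h := b + int r]) ! i"
  proof cases
    case 1
    then have "other h i \<noteq> other h k" "other h i \<noteq> h" by (auto simp: other_def)
    then show ?thesis using i 1 assms by (simp add: nth_carry)
  next
    case 2 then show ?thesis using i o assms by (simp add: nth_carry)
  next
    case 3 then show ?thesis using i o assms by (simp add: nth_carry)
  next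
    case 4
    then have "other h (i - 1) \<noteq> other h k" "other h (i - 1) \<noteq> h" by (auto simp: other_def)
    then show ?thesis using i 4 assms by (simp add: nth_carry)
  qed
qed simp

lemma carry_nth:
  assumes "h < length m" "Suc k < length m"
  shows "carry h k r m ! k = m ! h - int r" "carry h k r m ! Suc k = m ! other h k"
  using assms by (simp_all add: nth_carry)

lemma carry_shift:
  assumes "h < length m" "Suc k < length m"
  shows "shift n k t (carry h k r m) = carry h (Suc k) r
    (m[other h k := m ! h - int r + int n * t, h := m ! other h k - int n * t + int r])"
  using carry_update[OF assms, of r "m ! h - int r + int n * t" "m ! other h k - int n * t"] carry_nth[OF assms, of r]
  by (simp add: shift_def)

lemma carry_swap_index:
  assumes "h < length m" "Suc k < length m"
  shows "swap_index k (carry h k r m) = carry h (Suc k) r m"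
  using carry_update[OF assms, of r "m ! other h k" "m ! h - int r"] carry_nth[OF assms, of r]
  by (simp add: swap_index_def)

text \<open>Leading coefficient of the inverse of \<open>T\<close> when \<open>x\<close>, with
  deficit \<open>r\<close>, passes \<open>y\<close>. The value \<open>inverse v\<close> arises as
  \<open>v - (v - inverse v)\<close>, from a summand of the geometric sum that coincides with the
  leading vector.\<close>

definition T_inv_coeff :: "nat \<Rightarrow> complex \<Rightarrow> nat \<Rightarrow> int \<Rightarrow> int \<Rightarrow> complex" where
  "T_inv_coeff n v r x y = (if (x - int r - y) mod int n = 0 then (if x - int r < y then v else inverse v) else 1)"

definition T_coeff :: "nat \<Rightarrow> complex \<Rightarrow> int \<Rightarrow> int \<Rightarrow> complex" where
  "T_coeff n v x y = (if (x - y) mod int n = 0 then (if x \<le> y then v else inverse v) else 1)"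

text \<open>\<open>M\<close> is the least \<open>t\<close> with \<open>0 \<le> d + n t\<close>, and
  also the length of the geometric sum in \<open>T_basis\<close>. The bounds decide on which side of
  the passed entry each summand falls.\<close>

lemma neg_div_bounds:
  fixes d :: int and n :: nat
  assumes "n \<ge> 1"
  defines "M \<equiv> - (d div int n)"
  shows "t < M \<Longrightarrow> d + int n * t < 0" "M \<le> t \<Longrightarrow> 0 \<le> d + int n * t"
    "M < t \<Longrightarrow> 0 < d + int n * t" "M \<le> t \<Longrightarrow> d mod int n \<noteq> 0 \<Longrightarrow> 0 < d + int n * t"
    "d mod int n = 0 \<Longrightarrow> d + int n * M = 0"
proof -
  have d: "d = d mod int n - int n * M" using assms by (simp add: minus_mult_div_eq_mod[symmetric])
  have m: "0 \<le> d mod int n" "d mod int n < int n" using assms by auto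
  have e: "d + int n * t = d mod int n + int n * (t - M)" using d by (simp add: algebra_simps)
  show "d mod int n = 0 \<Longrightarrow> d + int n * M = 0" using d by simp
  show "d + int n * t < 0" if "t < M"
  proof -
    have "int n * (t - M) \<le> int n * (-1)" using that by (intro mult_left_mono) auto
    then show ?thesis using e m by linarith
  qed
  show ge: "0 \<le> d + int n * t" if "M \<le> t" using that e m by simp
  show "0 < d + int n * t" if "M \<le> t" "d mod int n \<noteq> 0"
  proof -
    have "0 \<le> int n * (t - M)" using that by simp
    then show ?thesis using e m that by linarith
  qed
  show "0 < d + int n * t" if "M < t"
  proof -
    have "int n * 1 \<le> int n * (t - M)" using that by (intro mult_left_mono) auto
    then show ?thesis using e m assms(1) by linarith
  qed
qed

lemma geom_pos: "0 \<le> m \<Longrightarrow> geom n k m l = (\<Sum>t\<in>{0..<m}. e (shift n k t l))"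
  by (simp add: geom_def)

lemma geom_neg: "m \<le> 0 \<Longrightarrow> geom n k m l = - (\<Sum>t\<in>{m..<0}. e (shift n k t l))"
  by (simp add: geom_def)

context elliptic_rep
begin

lemma triangular_step:
  assumes h: "h < N" and k: "Suc k < N"
    and I: "\<And>m. m \<in> weights N \<Longrightarrow> F (e (carry h k r m)) =
        scal (c m) (e (carry h (Suc k) r m)) + scal (d m) (\<Sum>t\<in>I m. e (shift n k t (carry h k r m)))"
    and prec: "\<And>m t. m \<in> weights N \<Longrightarrow> t \<in> I m \<Longrightarrow>
        prec N (m[other h k := m ! h - int r + int n * t, h := m ! other h k - int n * t + int r]) m"
  shows "triangular N (carry h k r) (carry h (Suc k) r) c F"
  unfolding triangular_def
proof
  fix m assume m: "m \<in> weights N"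
  then have "length m = N" by (simp add: weights_def)
  then have "(\<Sum>t\<in>I m. e (shift n k t (carry h k r m))) \<in> lower N (carry h (Suc k) r) m"
    using h k prec[OF m] by (intro lower_sum) (simp add: carry_shift lower_e)
  then show "F (e (carry h k r m)) - scal (c m) (e (carry h (Suc k) r m)) \<in> lower N (carry h (Suc k) r) m"
    unfolding I[OF m] by (simp add: lower_scal)
qed

lemma prec_between:
  assumes "m \<in> weights N" "h < N" "p < N" "p \<noteq> h" "a + b = m ! p + m ! h"
    "m ! h < a \<and> a < m ! p \<or> m ! p < a \<and> a < m ! h"
  shows "prec N (m[p := a, h := b]) m"
proof -
  have len: "length m = N" using assms(1) by (simp add: weights_def)
  from assms(6) show ?thesis
  proof
    assume "m ! p < a \<and> a < m ! h"
    then show ?thesis using prec_transfer[OF len, of p h a b] assms by auto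
  next
    assume "m ! h < a \<and> a < m ! p"
    then have "prec N (m[h := b, p := a]) m"
      using assms by (intro prec_transfer[OF len]) auto
    then show ?thesis by (simp add: list_update_swap[OF assms(4)])
  qed
qed

text \<open>In the summand \<open>t\<close> the passed entry becomes \<open>m ! h - r + n t\<close>.
  Because \<open>r < n\<close>, this lies strictly between the two old entries, so
  \<open>prec_transfer\<close> applies. The exception is \<open>t = 0\<close> with
  \<open>r = 0\<close>, a plain exchange, which lowers the weight when the larger entry stood on the
  left; hence the condition \<open>h \<le> k\<close>.\<close>

lemma triangular_T_inv:
  assumes h: "h < N" and k: "Suc k < N" and r: "r < n" and hk: "r = 0 \<Longrightarrow> h \<le> k"
  shows "triangular N (carry h k r) (carry h (Suc k) r) (\<lambda>m. T_inv_coeff n v r (m ! h) (m ! other h k)) (Tk_inv k)"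
proof -
  define c where "c = v - inverse v"
  define d where "d m = m ! h - int r - m ! other h k" for m :: "int list"
  define M where "M m = - (d m div int n)" for m
  \<comment> \<open>The term \<open>- c e\<close> of the inverse cancels the summand
    \<open>t = 0\<close> if \<open>d < 0\<close> and adds it otherwise. If moreover \<open>n\<close>
    divides \<open>d \<ge> 0\<close>, the summand \<open>t = M\<close> is the leading vector and is
    counted in the diagonal.\<close>
  define I where "I m = (if d m < 0 then {1..<M m} else if d m mod int n = 0 then {M m<..0} else {M m..0})" for m
  show ?thesis
  proof (rule triangular_step[OF h k, where I = I and d = "\<lambda>m. if d m < 0 then c else - c"])
    fix m t assume m: "m \<in> weights N" and t: "t \<in> I m"
    have len: "length m = N" using m by (simp add: weights_def)
    have p: "other h k < N" "other h k \<noteq> h" using h k by (auto simp: other_def)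
    note bounds = neg_div_bounds(1-4)[OF n, where t = t and d = "d m", folded M_def]
    let ?a = "m ! h - int r + int n * t"
    have a: "?a = m ! other h k + (d m + int n * t)" by (simp add: d_def)
    show "prec N (m[other h k := ?a, h := m ! other h k - int n * t + int r]) m"
    proof (cases "d m < 0")
      case True
      then have t: "1 \<le> t" "t < M m" using t by (auto simp: I_def)
      have "int n * 1 \<le> int n * t" using t by (intro mult_left_mono) auto
      then have "m ! h < ?a" using r by linarith
      moreover have "?a < m ! other h k" using bounds(1)[OF t(2)] a by linarith
      ultimately show ?thesis using m h p by (intro prec_between) auto
    next
      case False
      have gt: "m ! other h k < ?a"
        using False t bounds(3,4) unfolding a by (auto simp: I_def split: if_splits)
      have t0: "t \<le> 0" using False t by (auto simp: I_def split: if_splits)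
      show ?thesis
      proof (cases "t = 0 \<and> r = 0")
        case True
        then have "h < other h k" using hk by (simp add: other_def)
        moreover have "m ! other h k < m ! h" using gt True by simp
        ultimately have "prec N (m[h := m ! other h k, other h k := m ! h]) m"
          using p len by (intro prec_swap) auto
        then show ?thesis using True by (simp add: list_update_swap[OF p(2)])
      next
        case f: False
        have "?a < m ! h"
        proof (cases "t = 0")
          case True then show ?thesis using f by simp
        next
          case t1: False
          have "int n * t \<le> int n * (-1)" using t1 t0 by (intro mult_left_mono) auto
          then show ?thesis using n by linarith
        qed
        then show ?thesis using gt m h p by (intro prec_between) auto
      qed
    qed
  next
    fix m assume m: "m \<in> weights N"
    then have len: "h < length m" "Suc k < length m" using h k by (auto simp: weights_def)
    let ?l = "carry h k r m" and ?l' = "carry h (Suc k) r m"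
    define E where "E t = e (shift n k t ?l)" for t
    have dk: "?l ! k - ?l ! Suc k = d m" using len by (simp add: carry_nth d_def)
    have T: "Tk_inv k (e ?l) = scal (if d m mod int n = 0 then v else 1) (e ?l') +
        scal c (geom n k (M m) ?l) - scal c (e ?l)"
      by (simp add: T_inv_def T_lin_e T_basis_def dk carry_swap_index[OF len] c_def M_def)
    have E0: "E 0 = e ?l" by (simp add: E_def shift_0)
    have T_inv_coeff: "T_inv_coeff n v r (m ! h) (m ! other h k) =
        (if d m mod int n = 0 then (if d m < 0 then v else inverse v) else 1)"
      by (auto simp: T_inv_coeff_def d_def)
    note bounds = neg_div_bounds[OF n, where d = "d m", folded M_def]
    show "Tk_inv k (e ?l) = scal (T_inv_coeff n v r (m ! h) (m ! other h k)) (e ?l') +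
        scal (if d m < 0 then c else - c) (\<Sum>t\<in>I m. e (shift n k t ?l))"
    proof (cases "d m < 0")
      case True
      then have M: "0 < M m" using bounds(2)[of 0] by force
      then have "{0..<M m} = insert 0 {1..<M m}" by auto
      then have "geom n k (M m) ?l = e ?l + (\<Sum>t\<in>{1..<M m}. E t)"
        using M E0 by (simp add: geom_pos flip: E_def)
      then show ?thesis using True by (simp add: T T_inv_coeff I_def scal_add_right flip: E_def)
    next
      case False
      then have M: "M m \<le> 0" using bounds(1)[of 0] by force
      then have "{M m..0} = insert 0 {M m..<0}" by auto
      then have S: "geom n k (M m) ?l - e ?l = - (\<Sum>t\<in>{M m..0}. E t)"
        using M E0 by (simp add: geom_neg flip: E_def)
      have T2: "Tk_inv k (e ?l) = scal (if d m mod int n = 0 then v else 1) (e ?l') - scal c (\<Sum>t\<in>{M m..0}. E t)"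
        using arg_cong[OF S, of "scal c"] unfolding T
        by (simp add: scal_diff_right scal_minus_one[symmetric] scal_scal)
      show ?thesis
      proof (cases "d m mod int n = 0")
        case True
        have "E (M m) = e ?l'"
        proof -
          have *: "m ! h - int r + int n * M m = m ! other h k"
            "m ! other h k - int n * M m + int r = m ! h"
            using bounds(5)[OF True] by (auto simp: d_def)
          show ?thesis unfolding E_def carry_shift[OF len] * by simp
        qed
        moreover have "{M m..0} = insert (M m) {M m<..0}" using M by auto
        ultimately have "(\<Sum>t\<in>{M m..0}. E t) = e ?l' + (\<Sum>t\<in>{M m<..0}. E t)" by simp
        then show ?thesis using True False unfolding T2 T_inv_coeff
          by (intro poly_mapping_eqI)
             (simp add: I_def lookup_add lookup_minus c_def algebra_simps flip: E_def)
      next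
        case f: False
        then show ?thesis using False unfolding T2 T_inv_coeff
          by (intro poly_mapping_eqI)
             (simp add: I_def lookup_add lookup_minus algebra_simps flip: E_def)
      qed
    qed
  qed
qed

lemma triangular_T:
  assumes h: "h < N" and hk: "k < h"
  shows "triangular N (carry h k 0) (carry h (Suc k) 0) (\<lambda>m. T_coeff n v (m ! h) (m ! k)) (Tk k)"
proof -
  define c where "c = v - inverse v"
  define d where "d m = m ! h - m ! k" for m :: "int list"
  define M where "M m = - (d m div int n)" for m
  \<comment> \<open>Here \<open>t = 0\<close> survives only for \<open>m ! h < m ! k\<close>, an
    exchange that lowers the weight because \<open>k < h\<close>. This is the opposite side from
    \<open>triangular_T_inv\<close> with \<open>r = 0\<close>.\<close>
  define I where "I m = (if d m \<le> 0 then {0..<M m} else if d m mod int n = 0 then {M m<..<0} else {M m..<0})" for m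
  have k: "Suc k < N" using h hk by simp
  have oth: "other h k = k" using hk by (simp add: other_def)
  show ?thesis
  proof (rule triangular_step[OF h k, where I = I and d = "\<lambda>m. if d m \<le> 0 then c else - c"])
    fix m t assume m: "m \<in> weights N" and t: "t \<in> I m"
    have len: "length m = N" using m by (simp add: weights_def)
    note bounds = neg_div_bounds(1-4)[OF n, where t = t and d = "d m", folded M_def]
    let ?a = "m ! h - int 0 + int n * t"
    have a: "?a = m ! k + (d m + int n * t)" by (simp add: d_def)
    have "prec N (m[k := ?a, h := m ! k - int n * t + int 0]) m"
    proof (cases "d m \<le> 0")
      case True
      then have t: "0 \<le> t" "t < M m" using t by (auto simp: I_def)
      have lt: "?a < m ! k" using bounds(1)[OF t(2)] a by linarith
      show ?thesis
      proof (cases "t = 0")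
        case True
        then have "prec N (m[k := m ! h, h := m ! k]) m"
          using lt hk h len by (intro prec_swap) auto
        then show ?thesis using True by simp
      next
        case False
        have "int n * 1 \<le> int n * t" using t False by (intro mult_left_mono) auto
        then have "m ! h < ?a" using n by linarith
        then show ?thesis using lt m h hk by (intro prec_between) auto
      qed
    next
      case False
      have gt: "m ! k < ?a"
        using False t bounds(3,4) unfolding a by (auto simp: I_def split: if_splits)
      have t0: "t < 0" using False t by (auto simp: I_def split: if_splits)
      have "int n * t \<le> int n * (-1)" using t0 by (intro mult_left_mono) auto
      then have "?a < m ! h" using n by linarith
      then show ?thesis using gt m h hk by (intro prec_between) auto
    qed
    then show "prec N (m[other h k := ?a, h := m ! other h k - int n * t + int 0]) m"
      by (simp add: oth)
  next
    fix m assume m: "m \<in> weights N"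
    then have len: "h < length m" "Suc k < length m" using h k by (auto simp: weights_def)
    let ?l = "carry h k 0 m" and ?l' = "carry h (Suc k) 0 m"
    define E where "E t = e (shift n k t ?l)" for t
    have dk: "?l ! k - ?l ! Suc k = d m" using len by (simp add: carry_nth d_def oth)
    have T: "Tk k (e ?l) = scal (if d m mod int n = 0 then v else 1) (e ?l') + scal c (geom n k (M m) ?l)"
      by (simp add: T_lin_e T_basis_def dk carry_swap_index[OF len] c_def M_def)
    have T_inv_coeff: "T_coeff n v (m ! h) (m ! k) =
        (if d m mod int n = 0 then (if d m \<le> 0 then v else inverse v) else 1)"
      by (auto simp: T_coeff_def d_def)
    note bounds = neg_div_bounds[OF n, where d = "d m", folded M_def]
    show "Tk k (e ?l) = scal (T_coeff n v (m ! h) (m ! k)) (e ?l') +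
        scal (if d m \<le> 0 then c else - c) (\<Sum>t\<in>I m. e (shift n k t ?l))"
    proof (cases "d m \<le> 0")
      case True
      then have M: "0 \<le> M m" using bounds(3)[of 0] by force
      then show ?thesis using True by (simp add: T T_inv_coeff I_def geom_pos)
    next
      case False
      then have M: "M m < 0" if "d m mod int n = 0" using bounds(5)[OF that] n
        by (metis add.right_neutral linorder_not_less mult_nonneg_nonneg of_nat_0_le_iff add_increasing2 nle_le order_refl)
      have M0: "M m \<le> 0" using False bounds(1)[of 0] by force
      have T2: "Tk k (e ?l) = scal (if d m mod int n = 0 then v else 1) (e ?l') - scal c (\<Sum>t\<in>{M m..<0}. E t)"
        using M0 unfolding T by (intro poly_mapping_eqI) (simp add: geom_neg lookup_add lookup_minus flip: E_def)
      show ?thesis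
      proof (cases "d m mod int n = 0")
        case True
        have "E (M m) = e ?l'"
        proof -
          have *: "m ! h - int 0 + int n * M m = m ! k" "m ! k - int n * M m + int 0 = m ! h"
            using bounds(5)[OF True] by (auto simp: d_def)
          show ?thesis unfolding E_def carry_shift[OF len] oth * by simp
        qed
        moreover have "{M m..<0} = insert (M m) {M m<..<0}" using M[OF True] by auto
        ultimately have "(\<Sum>t\<in>{M m..<0}. E t) = e ?l' + (\<Sum>t\<in>{M m<..<0}. E t)" by simp
        then show ?thesis using True False unfolding T2 T_inv_coeff
          by (intro poly_mapping_eqI)
             (simp add: I_def lookup_add lookup_minus c_def algebra_simps flip: E_def)
      next
        case f: False
        then show ?thesis using False unfolding T2 T_inv_coeff
          by (intro poly_mapping_eqI)
             (simp add: I_def lookup_add lookup_minus algebra_simps flip: E_def)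
      qed
    qed
  qed
qed

end

section \<open>Composing the factors of one operator of the family\<close>

lemma chain_add: "chain F a (m + p) x = chain F (a + m) p (chain F a m x)"
  by (induction p) (auto simp: add.assoc)

lemma conj_family_eq: "conj_family F B i x = chain F 0 i (B (op_prod (map F [0..<i]) x))"
  by (induction i arbitrary: x) auto

lemma mult_mod_eq_0_iff:
  fixes i n m :: nat
  assumes "coprime n m" "0 < i" "i < m"
  shows "i * n mod m \<noteq> 0"
proof
  assume "i * n mod m = 0"
  then have "m dvd i * n" by auto
  then have "m dvd i" using assms(1) by (simp add: coprime_commute coprime_dvd_mult_left_iff)
  then show False using assms(2,3) by (auto dest: dvd_imp_le)
qed

text \<open>Used with \<open>m = n + n'\<close>: along the word every nonzero deficit occurs exactly
  once.\<close>

lemma bij_betw_mult_mod: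
  fixes n m :: nat
  assumes "coprime n m"
  shows "bij_betw (\<lambda>i. i * n mod m) {1..<m} {1..<m}"
proof -
  have inj: "i = j" if "i \<le> j" "j < m" "i * n mod m = j * n mod m" for i j
  proof -
    have "i * n \<le> j * n" using that(1) by simp
    from mod_eq_dvd_iff_nat[OF this, of m] have "m dvd j * n - i * n" using that(3) by metis
    then have "m dvd (j - i) * n" by (simp add: diff_mult_distrib)
    then have "m dvd j - i" using assms by (simp add: coprime_commute coprime_dvd_mult_left_iff)
    then show ?thesis using that by (auto dest: dvd_imp_le)
  qed
  have "inj_on (\<lambda>i. i * n mod m) {1..<m}"
  proof (rule inj_onI)
    fix i j assume "i \<in> {1..<m}" "j \<in> {1..<m}" "i * n mod m = j * n mod m"
    then show "i = j" using inj[of i j] inj[of j i] by (cases "i \<le> j") auto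
  qed
  moreover have "(\<lambda>i. i * n mod m) ` {1..<m} \<subseteq> {1..<m}"
  proof
    fix x assume "x \<in> (\<lambda>i. i * n mod m) ` {1..<m}"
    then obtain i where i: "x = i * n mod m" "0 < i" "i < m" by auto
    then show "x \<in> {1..<m}" using mult_mod_eq_0_iff[OF assms i(2,3)] by auto
  qed
  ultimately show ?thesis by (simp add: bij_betw_def endo_inj_surj)
qed

context elliptic_rep
begin

lemma triangular_chain:
  assumes "h < N" "r < n" "r = 0 \<Longrightarrow> h \<le> a"
  shows "a + m < N \<Longrightarrow> triangular N (carry h a r) (carry h (a + m) r)
    (\<lambda>l. \<Prod>k=a..<a + m. T_inv_coeff n v r (l ! h) (l ! other h k)) (chain Tk_inv a m)"
proof (induction m)
  case 0 then show ?case using triangular_id[of N "carry h a r"] by simp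
next
  case (Suc m)
  then have IH: "triangular N (carry h a r) (carry h (a + m) r)
    (\<lambda>l. \<Prod>k=a..<a + m. T_inv_coeff n v r (l ! h) (l ! other h k)) (chain Tk_inv a m)" by simp
  have "triangular N (carry h (a + m) r) (carry h (Suc (a + m)) r)
      (\<lambda>l. T_inv_coeff n v r (l ! h) (l ! other h (a + m))) (Tk_inv (a + m))"
    by (rule triangular_T_inv) (use Suc.prems assms in auto)
  from triangular_comp[OF IH this lin_T_inv] show ?case by (simp add: mult.commute)
qed

lemma triangular_chain_T:
  assumes "h < N"
  shows "m \<le> h \<Longrightarrow> triangular N (carry h 0 0) (carry h m 0)
    (\<lambda>l. \<Prod>k<m. T_coeff n v (l ! h) (l ! k)) (chain Tk 0 m)"
proof (induction m)
  case 0 then show ?case using triangular_id[of N "carry h 0 0"] by simp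
next
  case (Suc m)
  then have "triangular N (carry h 0 0) (carry h m 0)
    (\<lambda>l. \<Prod>k<m. T_coeff n v (l ! h) (l ! k)) (chain Tk 0 m)" by simp
  from triangular_comp[OF this triangular_T[OF assms]] show ?case
    using Suc.prems by (simp add: mult.commute)
qed

text \<open>The rotation is monomial, so there are no lower terms; it returns the carried entry to
  the front and raises the deficit by \<open>n'\<close>.\<close>

lemma triangular_P:
  assumes "h < N"
  shows "triangular N (carry h (N - 1) r) (carry h 0 (r + n')) (\<lambda>l. pi_coeff n q u (l ! h - int r)) P"
  unfolding triangular_def
proof
  fix l assume "l \<in> weights N"
  then have l: "length l = N" by (simp add: weights_def)
  define w where "w = map (\<lambda>i. l ! other h i) [0..<N - 1]"
  have "carry h (N - 1) r l = w @ [l ! h - int r]"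
    using l N by (intro nth_equalityI) (auto simp: nth_carry w_def nth_append)
  moreover have "carry h 0 (r + n') l = (l ! h - int r - int n') # w"
    using l N by (intro nth_equalityI) (auto simp: nth_carry w_def nth_Cons')
  ultimately show "P (e (carry h (N - 1) r l)) - scal (pi_coeff n q u (l ! h - int r)) (e (carry h 0 (r + n') l))
      \<in> lower N (carry h 0 (r + n')) l"
    by (simp add: pi_lin_snoc)
qed

lemma triangular_Y:
  assumes "n \<le> r"
  shows "triangular N (carry h 0 r) (carry h 0 (r - n)) (\<lambda>_. 1) (Y 0)"
  unfolding triangular_def
proof
  fix l assume "l \<in> weights N"
  then have l: "length l = N" by (simp add: weights_def)
  have "(carry h 0 r l)[0 := carry h 0 r l ! 0 + int n] = carry h 0 (r - n) l"
    using l N assms by (intro nth_equalityI) (auto simp: nth_carry nth_list_update)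
  then show "Y 0 (e (carry h 0 r l)) - scal 1 (e (carry h 0 (r - n) l)) \<in> lower N (carry h 0 (r - n)) l"
    by (simp add: Y_pow_e)
qed

lemma lin_chain_gen:
  assumes "\<And>k. lin (F k)"
  shows "lin (chain F a m)"
proof (induction m)
  case 0
  have "chain F a 0 = (\<lambda>x. x)" by auto
  then show ?case by simp
next
  case (Suc m)
  have "chain F a (Suc m) = (\<lambda>x. F (a + m) (chain F a m x))" by auto
  then show ?case using lin_compose[OF assms Suc] by simp
qed

lemma lin_chain_inv: "lin (chain Tk_inv a m)"
  by (rule lin_chain_gen) simp

lemma lin_chain: "lin (chain Tk a m)"
  by (rule lin_chain_gen) simp

lemma lin_X: "lin X"
  using lin_compose[OF lin_pi_lin(1) lin_chain_inv] unfolding X_inv_def[abs_def] .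

lemma lin_word: "lin (word_op (Y 0) X w)"
  by (induction w) (auto simp: comp_def id_def intro!: lin_compose[OF lin_X] lin_compose[OF lin_Y_pow])

lemma lin_B_lin: "lin (BBk i)"
proof -
  have "lin (op_prod (map Tk [0..<i]))" by (rule lin_op_prod) auto
  then have "lin (\<lambda>f. W (op_prod (map Tk [0..<i]) f))" by (rule lin_compose[OF lin_word])
  then show ?thesis unfolding B_lin_def conj_family_eq[abs_def] by (rule lin_compose[OF lin_chain])
qed

definition weight_X :: "nat \<Rightarrow> int list \<Rightarrow> nat \<Rightarrow> complex" where
  "weight_X h l r = pi_coeff n q u (l ! h - int r) * (\<Prod>k<N - 1. T_inv_coeff n v r (l ! h) (l ! other h k))"

text \<open>The carried entry starts at position 0 and also meets entries from its left. For these
  \<open>triangular_T_inv\<close> asks for a nonzero deficit.\<close>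

lemma triangular_X:
  assumes "h < N" "0 < r" "r < n"
  shows "triangular N (carry h 0 r) (carry h 0 (r + n')) (\<lambda>l. weight_X h l r) X"
proof -
  have "triangular N (carry h 0 r) (carry h (N - 1) r)
      (\<lambda>l. \<Prod>k<N - 1. T_inv_coeff n v r (l ! h) (l ! other h k)) (chain Tk_inv 0 (N - 1))"
    using triangular_chain[of h r 0 "N - 1"] assms N by (simp add: atLeast0LessThan)
  from triangular_comp[OF this triangular_P[OF assms(1)] lin_pi_lin(1)] show ?thesis
    unfolding X_inv_def[abs_def] weight_X_def .
qed

text \<open>The rightmost letter acts first and takes the deficit one step back along the rotation:
  \<open>X\<close> adds \<open>n'\<close> to a deficit below \<open>n\<close>, and \<open>Y\<close>
  subtracts \<open>n\<close> from a larger one. So the prefix of length \<open>j\<close> ends with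
  deficit 0.\<close>

lemma triangular_word:
  assumes h: "h < N"
  shows "j < n + n' \<Longrightarrow> triangular N (carry h 0 (j * n mod (n + n'))) (carry h 0 0)
    (\<lambda>l. \<Prod>i=1..<Suc j. if i * n mod (n + n') < n then weight_X h l (i * n mod (n + n')) else 1)
    (word_op (Y 0) X (map (\<lambda>j. j * n mod (n + n') < n) [1..<Suc j]))"
proof (induction j)
  case 0 then show ?case using triangular_id[of N "carry h 0 0"] by (simp add: id_def)
next
  case (Suc j)
  define r where "r = Suc j * n mod (n + n')"
  define x where "x = j * n mod (n + n')"
  have x: "x < n + n'" using n by (simp add: x_def)
  have r: "r = (if x < n' then x + n else x - n')"
    unfolding r_def x_def by (rule rotation_step[OF n n'])
  have "coprime n (n + n')" using coprime by (metis coprime_iff_gcd_eq_1 gcd_add2)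
  then have r0: "0 < r" using mult_mod_eq_0_iff[of n "n + n'" "Suc j"] Suc.prems by (simp add: r_def)
  have letter: "triangular N (carry h 0 r) (carry h 0 x) (\<lambda>l. if r < n then weight_X h l r else 1)
      (if r < n then X else Y 0)"
  proof (cases "r < n")
    case True
    then have "r + n' = x" using r by (auto split: if_splits)
    then show ?thesis using triangular_X[OF h r0 True] True by simp
  next
    case False
    then have "r - n = x" using r x by (auto split: if_splits)
    then show ?thesis using triangular_Y[of r h] False by simp
  qed
  have IH: "triangular N (carry h 0 x) (carry h 0 0)
    (\<lambda>l. \<Prod>i=1..<Suc j. if i * n mod (n + n') < n then weight_X h l (i * n mod (n + n')) else 1)
    (word_op (Y 0) X (map (\<lambda>j. j * n mod (n + n') < n) [1..<Suc j]))"
    using Suc by (simp add: x_def)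
  show ?case
  proof (rule triangular_cong[OF triangular_comp[OF letter IH lin_word]])
    fix l
    show "(\<Prod>i=1..<Suc j. if i * n mod (n + n') < n then weight_X h l (i * n mod (n + n')) else 1) *
        (if r < n then weight_X h l r else 1) =
        (\<Prod>i=1..<Suc (Suc j). if i * n mod (n + n') < n then weight_X h l (i * n mod (n + n')) else 1)"
      unfolding r_def by (subst (2) prod.atLeastLessThan_Suc) simp_all
    show "word_op (Y 0) X (map (\<lambda>j. j * n mod (n + n') < n) [1..<Suc j])
        ((if r < n then X else Y 0) (e (carry h 0 r l))) =
      word_op (Y 0) X (map (\<lambda>j. j * n mod (n + n') < n) [1..<Suc (Suc j)]) (e (carry h 0 r l))"
      unfolding r_def by (subst (2) upt_Suc) (simp add: word_op_append del: upt_Suc mult_Suc)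
  qed (simp_all add: r_def)
qed

lemma chain_op_prod_T_lin:
  "m < N \<Longrightarrow> f \<in> S \<Longrightarrow> chain Tk_inv 0 m (op_prod (map Tk [0..<m]) f) = f"
  by (induction m arbitrary: f) (simp_all add: T_lin_tensor_space T_lin_T_inv[OF n v])

definition diag :: "nat \<Rightarrow> int list \<Rightarrow> complex" where
  "diag h l = (\<Prod>k<h. T_coeff n v (l ! h) (l ! k)) *
     ((\<Prod>i=1..<n + n'. if i * n mod (n + n') < n then weight_X h l (i * n mod (n + n')) else 1) *
      (pi_coeff n q u (l ! h) * (\<Prod>k=h..<N - 1. T_inv_coeff n v 0 (l ! h) (l ! other h k))))"

text \<open>The factor \<open>T\<^sub>0 \<dots> T\<^sub>h\<^sub>-\<^sub>1\<close> on the right of the conjugation cancels against the last letter of the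
  Christoffel word. Without this cancellation the product would not be a product of triangular factors.\<close>

lemma triangular_B_lin:
  assumes h: "h < N"
  shows "triangular N (\<lambda>l. l) (\<lambda>l. l) (diag h) (BBk h)"
proof -
  define j where "j = n + n' - 1"
  define w where "w = map (\<lambda>j. j * n mod (n + n') < n) [1..<Suc j]"
  have j: "n + n' = Suc j" "j < n + n'" using n by (auto simp: j_def)
  \<comment> \<open>The final letter is an \<open>X\<close> acting at deficit 0, the case excluded
    in \<open>triangular_X\<close>; it leaves deficit \<open>n'\<close> for the remaining
    prefix.\<close>
  have jn: "j * n mod (n + n') = n'"
    using rotation_step[OF n n', of j] n j(1) by (auto split: if_splits simp del: mult_Suc)
  have "christoffel n n' = w @ [True]"
    using n j unfolding christoffel_def w_def by (simp del: mult_Suc)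
  then have W: "W f = word_op (Y 0) X w (X f)" for f by (simp add: word_op_append)
  have 1: "triangular N (carry h h 0) (carry h (N - 1) 0)
      (\<lambda>l. \<Prod>k=h..<N - 1. T_inv_coeff n v 0 (l ! h) (l ! other h k)) (chain Tk_inv h (N - 1 - h))"
    using triangular_chain[of h 0 h "N - 1 - h"] h n by simp
  have 2: "triangular N (carry h (N - 1) 0) (carry h 0 n') (\<lambda>l. pi_coeff n q u (l ! h)) P"
    using triangular_P[OF h, of 0] by simp
  have 3: "triangular N (carry h 0 n') (carry h 0 0)
     (\<lambda>l. \<Prod>i=1..<n + n'. if i * n mod (n + n') < n then weight_X h l (i * n mod (n + n')) else 1)
     (word_op (Y 0) X w)"
    using triangular_word[OF h j(2)] unfolding jn w_def j(1)[symmetric] .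
  have 4: "triangular N (carry h 0 0) (carry h h 0) (\<lambda>l. \<Prod>k<h. T_coeff n v (l ! h) (l ! k)) (chain Tk 0 h)"
    using triangular_chain_T[OF h] by simp
  note tri = triangular_comp[OF triangular_comp[OF triangular_comp[OF 1 2 lin_pi_lin(1)] 3 lin_word] 4 lin_chain]
  show ?thesis
  proof (rule triangular_cong[OF tri])
    fix l assume "l \<in> weights N"
    then have l: "length l = N" by (simp add: weights_def)
    then show c: "carry h h 0 l = l" "carry h h 0 l = l" using h by (simp_all add: carry_self)
    show "(\<Prod>k<h. T_coeff n v (l ! h) (l ! k)) *
       ((\<Prod>i=1..<n + n'. if i * n mod (n + n') < n then weight_X h l (i * n mod (n + n')) else 1) *
       (pi_coeff n q u (l ! h) * (\<Prod>k=h..<N - 1. T_inv_coeff n v 0 (l ! h) (l ! other h k)))) = diag h l"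
      by (simp add: diag_def)
    have "X (op_prod (map Tk [0..<h]) (e l)) = P (chain Tk_inv h (N - 1 - h) (e l))"
      using chain_add[of Tk_inv 0 h "N - 1 - h"] h chain_op_prod_T_lin[OF h tensor_space_e[OF l]]
      by (simp add: X_inv_def)
    then show "chain Tk 0 h (word_op (Y 0) X w (P (chain Tk_inv h (N - 1 - h) (e (carry h h 0 l))))) =
        BBk h (e (carry h h 0 l))"
      unfolding c by (simp add: B_lin_def conj_family_eq W)
  qed
qed

section \<open>Evaluation of the diagonal\<close>

text \<open>The numbers \<open>x - r\<close> represent every residue once, which collects all
  \<open>u a\<close>. The exponents of \<open>q\<close> are summed by Hermite's identity.\<close>

lemma prod_pi_coeff:
  "(\<Prod>r<n. pi_coeff n q u (x - int r)) = (\<Prod>a<n. u a) * (q powi (1 - int n) * q powi x)"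
proof -
  have "(\<Prod>r<n. u (nat ((x - int r) mod int n))) = (\<Prod>a<n. u a)"
  proof (rule prod.reindex_bij_betw)
    let ?f = "\<lambda>r. nat ((x - int r) mod int n)"
    have "inj_on ?f {..<n}"
    proof (rule inj_onI)
      fix r s assume rs: "r \<in> {..<n}" "s \<in> {..<n}" and eq: "?f r = ?f s"
      have "(x - int r) mod int n = (x - int s) mod int n"
        using eq n by (subst (asm) eq_nat_nat_iff) auto
      then have "int n dvd int s - int r" by (simp add: mod_eq_dvd_iff)
      then show "r = s" using rs zdvd_imp_le[of "int n" "int s - int r"] zdvd_imp_le[of "int n" "int r - int s"]
        by (cases r s rule: linorder_cases) (auto simp: dvd_diff_commute)
    qed
    moreover have "?f ` {..<n} \<subseteq> {..<n}" using n by (auto simp: nat_less_iff)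
    ultimately show "bij_betw ?f {..<n} {..<n}" by (simp add: bij_betw_def endo_inj_surj)
  qed
  moreover have "(\<Prod>r<n. q powi ((x - int r) div int n)) = q powi (1 - int n) * q powi x"
  proof -
    define F where "F x = (\<Prod>r<n. q powi ((x - int r) div int n))" for x
    \<comment> \<open>Raising \<open>x\<close> replaces only the factor at \<open>x + 1 - n\<close>
      by the one at \<open>x + 1\<close>, whose floor is larger by one.\<close>
    have step: "F (x + 1) = F x * q" for x
    proof -
      have "F (x + 1) * q powi ((x + 1 - int n) div int n) = (\<Prod>r<Suc n. q powi ((x + 1 - int r) div int n))"
        by (simp add: F_def)
      also have "\<dots> = q powi ((x + 1) div int n) * F x"
        by (subst prod.lessThan_Suc_shift) (simp add: F_def)
      also have "(x + 1) div int n = (x + 1 - int n) div int n + 1"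
        using n div_mult_self2[of "int n" "x + 1" "-1"] by simp
      finally show ?thesis using q by (simp add: power_int_add)
    qed
    \<comment> \<open>The induction starts at \<open>n - 1\<close>, where all floors vanish.\<close>
    have "F x * q powi (int n - 1) = q powi x"
    proof (induction x rule: int_induct[where k = "int n - 1"])
      case base
      have "F (int n - 1) = (\<Prod>r<n. 1)"
        unfolding F_def by (intro prod.cong) (auto simp: div_pos_pos_trivial)
      then show ?case by simp
    next
      case (step1 i) then show ?case using q by (simp add: step power_int_add)
    next
      case (step2 i)
      then show ?case using step[of "i - 1"] q by (simp add: power_int_diff field_simps)
    qed
    then show ?thesis unfolding F_def[symmetric] using q by (simp add: power_int_diff field_simps)
  qed
  ultimately show ?thesis by (simp add: pi_coeff_def prod.distrib)
qed

text \<open>At the single deficit with a nontrivial factor, \<open>x - r - y\<close> equals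
  \<open>n\<close> times the floor of \<open>(x - y) / n\<close>, which is negative exactly for
  \<open>x < y\<close>.\<close>

lemma T_inv_coeff_eq:
  assumes "r < n"
  shows "T_inv_coeff n v r x y = (if int r = (x - y) mod int n then (if x < y then v else inverse v) else 1)"
proof -
  have iff: "(x - int r - y) mod int n = 0 \<longleftrightarrow> int r = (x - y) mod int n"
  proof -
    have "(x - int r - y) mod int n = 0 \<longleftrightarrow> (x - y) mod int n = int r mod int n"
      by (simp add: mod_eq_dvd_iff mod_eq_0_iff_dvd algebra_simps)
    then show ?thesis using assms by auto
  qed
  have "x - int r < y \<longleftrightarrow> x < y" if "int r = (x - y) mod int n"
  proof -
    have "x - int r - y = int n * ((x - y) div int n)"
      using minus_mod_eq_mult_div[of "x - y" "int n"] that by simp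
    then have "x - int r < y \<longleftrightarrow> (x - y) div int n < 0"
      using n mult_less_0_iff[of "int n" "(x - y) div int n"] by (metis (no_types) diff_less_0_iff_less less_imp_not_less of_nat_0_less_iff less_le_trans zero_less_one)
    also have "\<dots> \<longleftrightarrow> x < y" using n by (simp add: neg_imp_zdiv_neg_iff pos_imp_zdiv_neg_iff)
    finally show ?thesis .
  qed
  then show ?thesis by (auto simp: T_inv_coeff_def iff)
qed

text \<open>Exactly one round has a factor different from 1. A tie \<open>x = y\<close> falls into
  the round of deficit 0, where entries on the left are passed by \<open>T\<close> and give
  \<open>v\<close>, and entries on the right by its inverse and give \<open>inverse v\<close>; this
  is the tie rule of \<open>ell\<close>.\<close>

lemma prod_T_inv_coeff:
  "T_inv_coeff n v 0 x y * (\<Prod>r=1..<n. T_inv_coeff n v r x y) = (if x < y then v else inverse v)"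
  "T_coeff n v x y * (\<Prod>r=1..<n. T_inv_coeff n v r x y) = (if x \<le> y then v else inverse v)"
proof -
  define R where "R = nat ((x - y) mod int n)"
  have R: "int R = (x - y) mod int n" "R < n" using n by (auto simp: R_def nat_less_iff)
  define s where "s = (if x < y then v else inverse v)"
  have T_inv_coeff: "T_inv_coeff n v r x y = (if r = R then s else 1)" if "r < n" for r
    using T_inv_coeff_eq[OF that, of x y] by (simp add: R(1)[symmetric] s_def)
  have "(\<Prod>r=1..<n. T_inv_coeff n v r x y) = (\<Prod>r=1..<n. if r = R then s else 1)"
    by (intro prod.cong) (auto simp: T_inv_coeff)
  also have "\<dots> = (if R = 0 then 1 else s)" using R(2) by (simp add: prod.delta)
  finally have P: "(\<Prod>r=1..<n. T_inv_coeff n v r x y) = (if R = 0 then 1 else s)" .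
  show "T_inv_coeff n v 0 x y * (\<Prod>r=1..<n. T_inv_coeff n v r x y) = (if x < y then v else inverse v)"
    using n T_inv_coeff[of 0] unfolding P by (auto simp: s_def)
  have "(x - y) mod int n = 0 \<longleftrightarrow> R = 0" using R(1) by auto
  then show "T_coeff n v x y * (\<Prod>r=1..<n. T_inv_coeff n v r x y) = (if x \<le> y then v else inverse v)"
    unfolding P by (auto simp: T_coeff_def s_def)
qed

lemma card_eq_sum:
  fixes M :: nat
  shows "int (card {j. j < M \<and> Q j}) = (\<Sum>j<M. if Q j then 1 else 0)"
proof -
  have "{j. j < M \<and> Q j} = {..<M} \<inter> {j. Q j}" by auto
  then show ?thesis by (simp add: sum.If_cases)
qed

lemma powi_ell:
  assumes l: "length l = N" and h: "h < N"
  shows "v powi ell l h = (\<Prod>k<h. if l ! h \<le> l ! k then v else inverse v) *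
    (\<Prod>k=h..<N - 1. if l ! h < l ! Suc k then v else inverse v)"
proof -
  define s :: "nat \<Rightarrow> int" where "s j = (if j = h then 0 else
      if j < h then (if l ! h \<le> l ! j then 1 else -1) else (if l ! h < l ! j then 1 else -1))" for j
  have "{j. j < h \<and> l ! j = l ! h} = {j. j < N \<and> j < h \<and> l ! j = l ! h}"
    "{j. h < j \<and> j < length l \<and> l ! j = l ! h} = {j. j < N \<and> h < j \<and> l ! j = l ! h}"
    using l h by auto
  then have "ell l h = (\<Sum>j<N. (if l ! j > l ! h then 1 else 0) + (if j < h \<and> l ! j = l ! h then 1 else 0)
      - (if l ! j < l ! h then 1 else 0) - (if h < j \<and> l ! j = l ! h then 1 else 0))"
    unfolding ell_def l by (simp only: card_eq_sum sum.distrib sum_subtractf)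
  also have "\<dots> = (\<Sum>j<N. s j)"
    by (intro sum.cong) (auto simp: s_def)
  finally have "v powi ell l h = v powi (\<Sum>j<N. s j)" by simp
  also have "\<dots> = (\<Prod>j<N. v powi s j)"
  proof -
    have "v powi (\<Sum>j<M. s j) = (\<Prod>j<M. v powi s j)" for M
      using v by (induction M) (auto simp: power_int_add)
    then show ?thesis .
  qed
  also have "\<dots> = (\<Prod>j<h. v powi s j) * (\<Prod>j=h..<N. v powi s j)"
    using h by (simp add: prod.atLeastLessThan_concat[of 0 h N, symmetric] flip: atLeast0LessThan)
  also have "(\<Prod>j=h..<N. v powi s j) = v powi s h * (\<Prod>j=Suc h..<N. v powi s j)"
    using h by (simp add: prod.atLeast_Suc_lessThan)
  also have "(\<Prod>j=Suc h..<N. v powi s j) = (\<Prod>k=h..<N - 1. v powi s (Suc k))"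
    using h prod.shift_bounds_Suc_ivl[of "\<lambda>j. v powi s j" h "N - 1"] by simp
  also have "\<dots> = (\<Prod>k=h..<N - 1. if l ! h < l ! Suc k then v else inverse v)"
    by (intro prod.cong) (auto simp: s_def power_int_minus)
  also have "(\<Prod>j<h. v powi s j) = (\<Prod>k<h. if l ! h \<le> l ! k then v else inverse v)"
    by (intro prod.cong) (auto simp: s_def power_int_minus)
  finally show ?thesis by (simp add: s_def)
qed

lemma diag_eq:
  assumes l: "l \<in> weights N" and h: "h < N"
  shows "diag h l = (\<Prod>a<n. u a) * q powi (1 - int n) * v powi (ell l h) * q powi (l ! h)"
proof -
  have len: "length l = N" using l by (simp add: weights_def)
  define x where "x = l ! h"
  define Z where "Z k = (\<Prod>r=1..<n. T_inv_coeff n v r x (l ! other h k))" for k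
  have "coprime n (n + n')" using coprime by (metis coprime_iff_gcd_eq_1 gcd_add2)
  \<comment> \<open>Reordering the letters by their deficits leaves the rounds
    \<open>r = 1, ..., n - 1\<close>; round 0 is made of the separate factors of
    \<open>diag\<close>.\<close>
  then have "(\<Prod>i=1..<n + n'. if i * n mod (n + n') < n then weight_X h l (i * n mod (n + n')) else 1) =
      (\<Prod>r=1..<n + n'. if r < n then weight_X h l r else 1)"
    by (rule prod.reindex_bij_betw[OF bij_betw_mult_mod])
  also have "\<dots> = (\<Prod>r=1..<n. weight_X h l r)"
    by (rule prod.mono_neutral_cong_right) auto
  also have "\<dots> = (\<Prod>r=1..<n. pi_coeff n q u (x - int r)) * (\<Prod>k<N - 1. Z k)"
    unfolding weight_X_def Z_def x_def prod.distrib by (subst prod.swap) simp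
  also have "(\<Prod>k<N - 1. Z k) = (\<Prod>k<h. Z k) * (\<Prod>k=h..<N - 1. Z k)"
    using h prod.atLeastLessThan_concat[of 0 h "N - 1" Z] by (simp add: atLeast0LessThan)
  finally have "diag h l = (pi_coeff n q u x * (\<Prod>r=1..<n. pi_coeff n q u (x - int r))) *
     (((\<Prod>k<h. T_coeff n v x (l ! k)) * (\<Prod>k<h. Z k)) *
      ((\<Prod>k=h..<N - 1. T_inv_coeff n v 0 x (l ! other h k)) * (\<Prod>k=h..<N - 1. Z k)))"
    unfolding diag_def x_def by (simp add: mult_ac)
  also have "(\<Prod>k<h. T_coeff n v x (l ! k)) * (\<Prod>k<h. Z k) = (\<Prod>k<h. if x \<le> l ! k then v else inverse v)"
    unfolding prod.distrib[symmetric] by (intro prod.cong) (auto simp: Z_def other_def prod_T_inv_coeff(2)[unfolded One_nat_def])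
  also have "(\<Prod>k=h..<N - 1. T_inv_coeff n v 0 x (l ! other h k)) * (\<Prod>k=h..<N - 1. Z k) =
      (\<Prod>k=h..<N - 1. if x < l ! Suc k then v else inverse v)"
    unfolding prod.distrib[symmetric] by (intro prod.cong) (auto simp: Z_def other_def prod_T_inv_coeff(1)[unfolded One_nat_def])
  also have "pi_coeff n q u x * (\<Prod>r=1..<n. pi_coeff n q u (x - int r)) = (\<Prod>r<n. pi_coeff n q u (x - int r))"
    using n prod.atLeast_Suc_lessThan[of 0 n "\<lambda>r. pi_coeff n q u (x - int r)"] by (simp add: atLeast0LessThan)
  finally show ?thesis
    by (simp add: powi_ell[OF len h] prod_pi_coeff x_def[symmetric] mult_ac)
qed

end

section \<open>Joint eigenvectors\<close>

lemma lower_id_iff: "f \<in> lower N (\<lambda>l. l) l \<longleftrightarrow> Poly_Mapping.keys f \<subseteq> {m. prec N m l}"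
  by (simp add: lower_def)

lemma keys_lin:
  assumes "lin F" "\<And>m. m \<in> Poly_Mapping.keys f \<Longrightarrow> Poly_Mapping.keys (F (e m)) \<subseteq> K"
  shows "Poly_Mapping.keys (F f) \<subseteq> K"
proof -
  have F: "F f = (\<Sum>m\<in>Poly_Mapping.keys f. scal (Poly_Mapping.lookup f m) (F (e m)))"
    using arg_cong[OF vec_decomp[of f], of F] by (simp add: lin_sum[OF assms(1)] lin_scal[OF assms(1)])
  show ?thesis
  proof
    fix k assume "k \<in> Poly_Mapping.keys (F f)"
    then have "(\<Sum>m\<in>Poly_Mapping.keys f. Poly_Mapping.lookup f m * Poly_Mapping.lookup (F (e m)) k) \<noteq> 0"
      by (subst (asm) F) (simp add: in_keys_iff lookup_sum)
    then obtain m where "m \<in> Poly_Mapping.keys f" "Poly_Mapping.lookup (F (e m)) k \<noteq> 0"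
      by (metis (no_types, lifting) mult_eq_0_iff sum.neutral)
    then have "m \<in> Poly_Mapping.keys f" "k \<in> Poly_Mapping.keys (F (e m))" by (auto simp: in_keys_iff)
    then show "k \<in> K" using assms(2) by blast
  qed
qed

text \<open>The operator \<open>G\<close> constructed here is the product over \<open>\<mu> \<in> A\<close> of factors
  \<open>(B\<^sub>i - b\<^sub>i(\<mu>)) / (b\<^sub>i(\<lambda>) - b\<^sub>i(\<mu>))\<close>, where \<open>i\<close> depends on \<open>\<mu>\<close>.\<close>

lemma separating_operator:
  fixes B :: "nat \<Rightarrow> vec \<Rightarrow> vec"
  assumes lin: "\<And>i. i < N \<Longrightarrow> lin (B i)"
    and S: "\<And>i f. i < N \<Longrightarrow> f \<in> tensor_space N \<Longrightarrow> B i f \<in> tensor_space N"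
    and tri: "\<And>i. i < N \<Longrightarrow> triangular N (\<lambda>l. l) (\<lambda>l. l) (b i) (B i)"
    and comm: "\<And>i j f. i < N \<Longrightarrow> j < N \<Longrightarrow> f \<in> tensor_space N \<Longrightarrow> B i (B j f) = B j (B i f)"
    and sep: "\<And>m. prec N m l \<Longrightarrow> \<exists>i<N. b i m \<noteq> b i l"
    and l: "l \<in> weights N"
    and A: "finite A" "A \<subseteq> {m. prec N m l}" "\<And>m p. m \<in> A \<Longrightarrow> prec N p m \<Longrightarrow> p \<in> A"
  shows "\<exists>G. lin G \<and> (\<forall>f\<in>tensor_space N. \<forall>i<N. G (B i f) = B i (G f)) \<and>
    (\<forall>f. Poly_Mapping.keys f \<subseteq> A \<longrightarrow> G f = 0) \<and> G (e l) - e l \<in> lower N (\<lambda>l. l) l \<and>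
    (\<forall>f\<in>lower N (\<lambda>l. l) l. G f \<in> lower N (\<lambda>l. l) l)"
  using A
proof (induction "card A" arbitrary: A)
  case 0
  then have "A = {}" by simp
  then show ?case by (intro exI[of _ "\<lambda>f. f"]) simp
next
  case (Suc c)
  \<comment> \<open>A rank function provides a maximal element of \<open>A\<close>; removing it
    keeps the set closed downwards.\<close>
  define rank where "rank m = card {p. prec N p m}" for m
  have rank: "rank p < rank m" if "prec N p m" for p m
  proof -
    have "{x. prec N x p} \<subset> {x. prec N x m}"
      using that prec_trans prec_irrefl by blast
    then show ?thesis unfolding rank_def by (intro psubset_card_mono finite_prec)
  qed
  have "A \<noteq> {}" using Suc.hyps(2) by auto
  then have "Max (rank ` A) \<in> rank ` A" using Suc.prems(1) by (intro Max_in) auto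
  then obtain m where m: "m \<in> A" "rank m = Max (rank ` A)" by auto
  have max: "\<not> prec N m p" if "p \<in> A" for p
  proof
    assume "prec N m p"
    then have "rank m < rank p" by (rule rank)
    moreover have "rank p \<le> rank m" unfolding m(2) using Suc.prems(1) that by simp
    ultimately show False by simp
  qed
  define A' where "A' = A - {m}"
  have "c = card A'" using Suc.hyps(2) Suc.prems(1) m by (simp add: A'_def)
  moreover have "p \<in> A'" if "k \<in> A'" "prec N p k" for p k
    using that Suc.prems(3) max by (auto simp: A'_def)
  moreover have "finite A'" "A' \<subseteq> {m. prec N m l}" using Suc.prems by (auto simp: A'_def)
  ultimately obtain G where G: "lin G" "\<And>f i. f \<in> tensor_space N \<Longrightarrow> i < N \<Longrightarrow> G (B i f) = B i (G f)"
    "\<And>f. Poly_Mapping.keys f \<subseteq> A' \<Longrightarrow> G f = 0" "G (e l) - e l \<in> lower N (\<lambda>l. l) l"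
    "\<And>f. f \<in> lower N (\<lambda>l. l) l \<Longrightarrow> G f \<in> lower N (\<lambda>l. l) l"
    using Suc.hyps(1)[of A'] by blast
  have ml: "prec N m l" using m Suc.prems by auto
  then obtain i where i: "i < N" "b i m \<noteq> b i l" using sep by blast
  define a where "a = inverse (b i l - b i m)"
  define F where "F f = scal a (B i f - scal (b i m) f)" for f
  note linB = lin[OF i(1)]
  have linF: "lin F" unfolding F_def[abs_def] by (intro lin_smult lin_minus linB lin_id)
  have Flow: "F f \<in> lower N (\<lambda>l. l) p" if "f \<in> lower N (\<lambda>l. l) p" for f p
  proof -
    have "B i f + scal (- b i m) f \<in> lower N (\<lambda>l. l) p"
      by (intro lower_add lower_scal triangular_lower[OF tri[OF i(1)] linB] that)
    moreover have "B i f + scal (- b i m) f = B i f - scal (b i m) f"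
      by (rule poly_mapping_eqI) (simp add: lookup_add lookup_minus)
    ultimately show ?thesis by (simp add: F_def lower_scal)
  qed
  have Fe: "F (e p) = scal (a * (b i p - b i m)) (e p) + scal a (B i (e p) - scal (b i p) (e p))" for p
    by (rule poly_mapping_eqI) (simp add: F_def lookup_add lookup_minus algebra_simps)
  have low: "B i (e p) - scal (b i p) (e p) \<in> lower N (\<lambda>l. l) p" if "p \<in> weights N" for p
    using tri[OF i(1)] that by (simp add: triangular_def)
  show ?case
  proof (intro exI[of _ "\<lambda>f. G (F f)"] conjI ballI allI impI)
    show "lin (\<lambda>f. G (F f))" by (rule lin_compose[OF G(1) linF])
  next
    fix f j assume f: "f \<in> tensor_space N" and j: "j < N"
    have "F f \<in> tensor_space N"
      using f S[OF i(1)] by (simp add: F_def tensor_space_scal tensor_space_diff)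
    moreover have "F (B j f) = B j (F f)"
      using f i(1) j by (simp add: F_def comm[of i j] lin_scal[OF lin] lin_diff[OF lin])
    ultimately show "G (F (B j f)) = B j (G (F f))" using G(2) j by simp
  next
    fix f :: vec assume f: "Poly_Mapping.keys f \<subseteq> A"
    \<comment> \<open>The factor for \<open>m\<close> annihilates the diagonal coefficient at
      \<open>m\<close>, and lower terms of members of \<open>A\<close> avoid \<open>m\<close> by
      maximality.\<close>
    have "Poly_Mapping.keys (F f) \<subseteq> A'"
    proof (rule keys_lin[OF linF])
      fix p assume "p \<in> Poly_Mapping.keys f"
      then have p: "p \<in> A" using f by auto
      then have pw: "p \<in> weights N" using Suc.prems(2) prec_length by (auto simp: weights_def)
      have "Poly_Mapping.keys (scal a (B i (e p) - scal (b i p) (e p))) \<subseteq> {k. prec N k p}"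
        using lower_scal[OF low[OF pw], of a] by (simp add: lower_id_iff)
      moreover have "{k. prec N k p} \<subseteq> A'"
        using p Suc.prems(3) max by (auto simp: A'_def)
      moreover have "Poly_Mapping.keys (scal (a * (b i p - b i m)) (e p)) \<subseteq> A'"
        using p by (auto simp: A'_def in_keys_iff lookup_e split: if_splits)
      ultimately show "Poly_Mapping.keys (F (e p)) \<subseteq> A'"
        unfolding Fe using Poly_Mapping.keys_add[of "scal (a * (b i p - b i m)) (e p)"] by blast
    qed
    then show "G (F f) = 0" by (rule G(3))
  next
    have "F (e l) = e l + scal a (B i (e l) - scal (b i l) (e l))"
      unfolding Fe using i(2) by (simp add: a_def)
    then have "G (F (e l)) - e l = (G (e l) - e l) + G (scal a (B i (e l) - scal (b i l) (e l)))"
      by (simp add: lin_add[OF G(1)])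
    then show "G (F (e l)) - e l \<in> lower N (\<lambda>l. l) l"
      using lower_add[OF G(4) G(5)[OF lower_scal[OF low[OF l], of a]]] by (simp only:)
  next
    fix f assume "f \<in> lower N (\<lambda>l. l) l"
    then show "G (F f) \<in> lower N (\<lambda>l. l) l" by (intro G(5) Flow)
  qed
qed

text \<open>With \<open>A\<close> the set of all smaller weights, \<open>G\<close> kills the lower
  vector \<open>B i (e l) - b i l e l\<close>. Since \<open>G\<close> commutes with
  \<open>B i\<close>, the vector \<open>G (e l)\<close> is the joint eigenvector.\<close>

lemma joint_eigenvector:
  fixes B :: "nat \<Rightarrow> vec \<Rightarrow> vec"
  assumes lin: "\<And>i. i < N \<Longrightarrow> lin (B i)"
    and S: "\<And>i f. i < N \<Longrightarrow> f \<in> tensor_space N \<Longrightarrow> B i f \<in> tensor_space N"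
    and tri: "\<And>i. i < N \<Longrightarrow> triangular N (\<lambda>l. l) (\<lambda>l. l) (b i) (B i)"
    and comm: "\<And>i j f. i < N \<Longrightarrow> j < N \<Longrightarrow> f \<in> tensor_space N \<Longrightarrow> B i (B j f) = B j (B i f)"
    and sep: "\<And>m. prec N m l \<Longrightarrow> \<exists>i<N. b i m \<noteq> b i l"
    and l: "l \<in> weights N"
  shows "\<exists>r\<in>lower N (\<lambda>l. l) l. \<forall>i<N. B i (e l + r) = scal (b i l) (e l + r)"
proof -
  have "\<exists>G. lin G \<and> (\<forall>f\<in>tensor_space N. \<forall>i<N. G (B i f) = B i (G f)) \<and>
    (\<forall>f. Poly_Mapping.keys f \<subseteq> {m. prec N m l} \<longrightarrow> G f = 0) \<and> G (e l) - e l \<in> lower N (\<lambda>l. l) l \<and>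
    (\<forall>f\<in>lower N (\<lambda>l. l) l. G f \<in> lower N (\<lambda>l. l) l)"
    by (rule separating_operator[where b = b]) (use assms prec_trans finite_prec in \<open>auto\<close>)
  then obtain G where G: "lin G" "\<And>f i. f \<in> tensor_space N \<Longrightarrow> i < N \<Longrightarrow> G (B i f) = B i (G f)"
    "\<And>f. Poly_Mapping.keys f \<subseteq> {m. prec N m l} \<Longrightarrow> G f = 0" "G (e l) - e l \<in> lower N (\<lambda>l. l) l"
    by blast
  have "B i (G (e l)) = scal (b i l) (G (e l))" if "i < N" for i
  proof -
    have "B i (e l) - scal (b i l) (e l) \<in> lower N (\<lambda>l. l) l"
      using tri[OF that] l by (simp add: triangular_def)
    then have "G (B i (e l) - scal (b i l) (e l)) = 0" by (intro G(3)) (simp add: lower_id_iff)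
    moreover have "e l \<in> tensor_space N" using l by (intro tensor_space_e) (simp add: weights_def)
    ultimately show ?thesis using G(2) that by (simp add: lin_diff[OF G(1)] lin_scal[OF G(1)])
  qed
  then show ?thesis by (intro bexI[OF _ G(4)]) simp
qed

lemma sum_lower:
  assumes "r \<in> lower N (\<lambda>l. l) l"
  shows "r = (\<Sum>m\<in>{m. prec N m l}. scal (Poly_Mapping.lookup r m) (e m))"
proof -
  have "r = (\<Sum>m\<in>Poly_Mapping.keys r. scal (Poly_Mapping.lookup r m) (e m))" by (rule vec_decomp)
  also have "\<dots> = (\<Sum>m\<in>{m. prec N m l}. scal (Poly_Mapping.lookup r m) (e m))"
    using assms by (intro sum.mono_neutral_left finite_prec) (auto simp: lower_id_iff in_keys_iff)
  finally show ?thesis .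
qed

theorem corollary3p4:
  fixes n n' N :: nat and q v :: complex and u :: "nat \<Rightarrow> complex"
  assumes "n \<ge> 1" and "n' \<ge> 1" and "coprime n n'" and "N \<ge> 1"
    and "q \<noteq> 0" and "v \<noteq> 0"
    and "\<forall>a b :: int. (a, b) \<noteq> (0, 0) \<longrightarrow> q powi a * v powi b \<noteq> 1"
    and "\<forall>a<n. u a \<noteq> 0"
  shows "\<exists>(E :: int list \<Rightarrow> vec) (\<beta> :: int list \<Rightarrow> int list \<Rightarrow> complex).
    \<forall>l\<in>weights N.
      E l = e l + (\<Sum>m\<in>{m. prec N m l}. scal (\<beta> l m) (e m)) \<and>
      (\<forall>i<N. B_op n n' N q v u i (E l) =
         scal ((\<Prod>a<n. u a) * q powi (1 - int n) * v powi (ell l i) * q powi (l ! i)) (E l))"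
proof -
  interpret elliptic_rep n n' N q v u
    by unfold_locales (use assms in auto)
  \<comment> \<open>The common constant is nonzero and cancels. Equal eigenvalues for
    \<open>i\<close> give a relation between powers of \<open>q\<close> and \<open>v\<close>, and
    genericity makes the exponent \<open>m ! i - l ! i\<close> of \<open>q\<close> vanish.\<close>
  have sep: "\<exists>i<N. diag i m \<noteq> diag i l" if l: "l \<in> weights N" and ml: "prec N m l" for l m
  proof (rule ccontr)
    assume contra: "\<not> (\<exists>i<N. diag i m \<noteq> diag i l)"
    have len: "length m = N" "length l = N" using prec_length[OF ml] by auto
    have "m ! i = l ! i" if i: "i < N" for i
    proof -
      define K where "K = (\<Prod>a<n. u a) * q powi (1 - int n)"
      have K: "K \<noteq> 0" using assms(5,8) by (simp add: K_def)
      have "K * v powi ell m i * q powi (m ! i) = K * v powi ell l i * q powi (l ! i)"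
      proof -
        have "m \<in> weights N" using len by (simp add: weights_def)
        moreover have "diag i m = diag i l" using contra i by blast
        ultimately show ?thesis using diag_eq[of m i] diag_eq[OF l i] i by (simp only: K_def)
      qed
      then have "v powi ell m i * q powi (m ! i) = v powi ell l i * q powi (l ! i)"
        using K by (simp add: mult.assoc)
      then have "q powi (m ! i - l ! i) * v powi (ell m i - ell l i) = 1"
        using assms(5,6) by (simp add: power_int_diff field_simps)
      then show ?thesis
        using assms(7)[rule_format, of "m ! i - l ! i" "ell m i - ell l i"] by auto
    qed
    then have "m = l" using len by (intro nth_equalityI) auto
    then show False using ml prec_irrefl by simp
  qed
  have "\<forall>l\<in>weights N. \<exists>r. r \<in> lower N (\<lambda>l. l) l \<and> (\<forall>i<N. BBk i (e l + r) = scal (diag i l) (e l + r))"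
  proof
    fix l assume l: "l \<in> weights N"
    show "\<exists>r. r \<in> lower N (\<lambda>l. l) l \<and> (\<forall>i<N. BBk i (e l + r) = scal (diag i l) (e l + r))"
      using joint_eigenvector[of N BBk diag l] l sep triangular_B_lin B_lin_eq B_lin_commute lin_B_lin
      by blast
  qed
  then obtain r where r: "\<And>l. l \<in> weights N \<Longrightarrow> r l \<in> lower N (\<lambda>l. l) l"
    "\<And>l i. l \<in> weights N \<Longrightarrow> i < N \<Longrightarrow> BBk i (e l + r l) = scal (diag i l) (e l + r l)"
    by metis
  show ?thesis
  proof (intro exI ballI conjI allI impI)
    fix l assume l: "l \<in> weights N"
    show "e l + r l = e l + (\<Sum>m\<in>{m. prec N m l}. scal (Poly_Mapping.lookup (r l) m) (e m))"
      using sum_lower[OF r(1)[OF l]] by simp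
    fix i assume i: "i < N"
    have "r l \<in> tensor_space N"
      using r(1)[OF l] prec_length by (auto simp: lower_id_iff tensor_space_def weights_def)
    then have "e l + r l \<in> tensor_space N"
      using l by (intro tensor_space_add tensor_space_e) (auto simp: weights_def)
    then show "B_op n n' N q v u i (e l + r l) =
         scal ((\<Prod>a<n. u a) * q powi (1 - int n) * v powi (ell l i) * q powi (l ! i)) (e l + r l)"
      using r(2)[OF l i] i by (simp add: B_op_eq diag_eq[OF l i])
  qed
qed

end
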